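(* Let $\mathcal T$ be a compactly generated triangulated category with a compact silting generator $M$ and heart $\mathcal H_M$. Then $$\begin{aligned}\mathrm{fpd}(\mathcal T,M)&=\sup\{\mathrm{projdim}_{\mathcal T}X+\inf X: X\in\mathcal T^c\cap\mathcal T^{\mathrm b}\}\\&=\sup\{\mathrm{projdim}_{\mathcal T}X+\inf X: X\in\mathcal T^{\mathrm b}_c\ \text{with}\ \mathrm{projdim}_{\mathcal T}X<\infty\}\\&=\sup\{\mathrm{projdim}_{\mathcal T}X: X\in\mathcal T^-_c\cap\mathcal T^{\ge0}\ \text{with}\ \mathrm{projdim}_{\mathcal T}X<\infty\}\\&\le\mathrm{findim}(\mathcal T^c,M)\\&\le\max\{0,\mathrm{fpd}(\mathcal T,M)\}.\end{aligned}$$ Moreover, if $M$ is tilting then $\mathrm{fpd}(\mathcal T,M)=\mathrm{fpd}(\mathcal H_M)=\mathrm{findim}(\mathcal T^c,M)$.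
   Context: **Setting.** $\mathcal T$ is a triangulated category with arbitrary coproducts and shift $[1]$, compactly generated; $\mathcal T^c$ denotes its compact objects. A compact generator $M$ is a compact object such that $\mathrm{Hom}_{\mathcal T}(M,X[i])=0$ for all $i$ implies $X=0$. A $t$-structure is a pair $(\mathcal U,\mathcal V)$ of full subcategories with $\mathcal V=\mathcal U^\perp$, $\mathcal U={}^\perp\mathcal V$, every object $X$ fitting in a triangle $U\to X\to V\to U[1]$ with $U\in\mathcal U,V\in\mathcal V$, and $\mathcal U[1]\subseteq\mathcal U$. $\mathrm{Add}(M)$ (resp. $\mathrm{add}(M)$) is the class of direct summands of coproducts (resp. finite direct sums) of copies of $M$. $M$ is silting if $(M^{\perp_{>0}},M^{\perp_{\le0}})$ is a $t$-structure, where $M^{\perp_{>n}}=\{Y:\mathrm{Hom}(M,Y[i])=0\ \forall i>n\}$ and $M^{\perp_{\le n}}=\{Y:\mathrm{Hom}(M,Y[i])=0\ \forall i\le n\}$; $M$ is tilting if moreover $\mathrm{Hom}(P,P'[i])=0$ for $P,P'\in\mathrm{Add}(M)$, $i\neq0$. For $n\in\mathbb Z$: $\mathcal T^{\le n}=M^{\perp_{>n}}$, $\mathcal T^{\ge n+1}=M^{\perp_{\le n}}$; $\mathcal T^-=\bigcup_{n>0}\mathcal T^{\le n}$, $\mathcal T^+=\bigcup_{n>0}\mathcal T^{\ge-n}$, $\mathcal T^{\mathrm b}=\mathcal T^-\cap\mathcal T^+$. $\mathcal H_M=\mathcal T^{\le0}\cap\mathcal T^{\ge0}$ is the abelian heart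 with cohomological functor $\mathcal H^0_M$, $\mathcal H^\ell_M(X)=\mathcal H^0_M(X[\ell])$; $\sup X=\sup\{\ell:\mathcal H^\ell_M(X)\ne0\}$, $\inf X=\inf\{\ell:\mathcal H^\ell_M(X)\neq0\}$. $\mathcal X*\mathcal Y$ is the class of $Z$ in an exact triangle $X\to Z\to Y\to X[1]$ with $X\in\mathcal X$, $Y\in\mathcal Y$. $\mathcal T^-_c=\bigcap_{m\ge1}(\mathcal T^c*\mathcal T^{\le-m})$ and $\mathcal T^{\mathrm b}_c=\mathcal T^-_c\cap\mathcal T^{\mathrm b}$. **Dimensions.** $\mathrm{projdim}_{\mathcal T}X=\inf\{n\in\mathbb Z:\mathrm{Hom}_{\mathcal T}(X,U[i])=0\ \forall U\in\mathcal T^-,\ i>n+\sup U\}$. $\mathrm{fpd}(\mathcal T,M)=\sup\{\mathrm{projdim}_{\mathcal T}X:X\in\mathcal T^c\cap\mathcal T^{\mathrm b}\cap\mathcal T^{\ge0},\ \mathrm{projdim}_{\mathcal T}X<\infty\}$. $\mathrm{findim}(\mathcal T^c,M)=\inf\{n\in\mathbb N:\mathcal C\cap\mathcal T^c\subseteq\langle M\rangle^{[0,+\infty)}[n]\}$, where $\mathcal C=\{X:\mathrm{Hom}_{\mathcal T}(M[n],X)=0\ \forall n\ge1\}$ and $\langle M\rangle^{[0,+\infty)}=\bigcup_{n>0}\mathrm{smd}(\mathrm{coprod}_n\{M[-i]:i\ge0\})$, with $\mathrm{coprod}_1(\mathcal A)$ the finite direct sums of objects of $\mathcal A$, $\mathrm{coprod}_{n+1}(\mathcal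 A)=\mathrm{coprod}_1(\mathcal A)*\mathrm{coprod}_n(\mathcal A)$, and $\mathrm{smd}$ closure under direct summands. For $M$ tilting (so $M\in\mathcal H_M$), $\mathrm{fpd}(\mathcal H_M)=\sup\{\mathrm{projdim}_{\mathcal H_M}H\}$ over those $H\in\mathcal H_M$ having a finite resolution $0\to P_n\to\cdots\to P_0\to H\to0$ exact in $\mathcal H_M$ with all $P_i\in\mathrm{add}(M)$; $\mathrm{projdim}_{\mathcal H_M}$ is projective dimension in $\mathcal H_M$. *)

theory Defs
  imports "HOL-Library.Extended_Real" "HOL-Algebra.Free_Abelian_Groups"
begin

section \<open>Additive categories with shift\<close>

text \<open>
  The objects are all elements of the type \<open>'o\<close>, the morphisms all elements of \<open>'m\<close>.
  \<open>compose T g f\<close> is \<open>g\<close> after \<open>f\<close>; it is only meaningful when \<open>target T f = source T g\<close>, and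
  \<open>arr_add T f g\<close> only when \<open>f\<close> and \<open>g\<close> are parallel.  A triple \<open>(f, g, h)\<close> in \<open>triangles T\<close>
  stands for a distinguished triangle \<open>X \<rightarrow> Y \<rightarrow> Z \<rightarrow> X[1]\<close>.
\<close>

record ('o, 'm) tricat =
  source :: "'m \<Rightarrow> 'o"
  target :: "'m \<Rightarrow> 'o"
  ident :: "'o \<Rightarrow> 'm"
  compose :: "'m \<Rightarrow> 'm \<Rightarrow> 'm"
  arr_add :: "'m \<Rightarrow> 'm \<Rightarrow> 'm"
  arr_zero :: "'o \<Rightarrow> 'o \<Rightarrow> 'm"
  shift_ob :: "'o \<Rightarrow> 'o"
  shift_arr :: "'m \<Rightarrow> 'm"
  triangles :: "('m \<times> 'm \<times> 'm) set"

definition Hom :: "('o, 'm) tricat \<Rightarrow> 'o \<Rightarrow> 'o \<Rightarrow> 'm set" where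
  "Hom T X Y = {f. source T f = X \<and> target T f = Y}"

definition hom_group :: "('o, 'm) tricat \<Rightarrow> 'o \<Rightarrow> 'o \<Rightarrow> 'm monoid" where
  "hom_group T X Y =
     \<lparr>carrier = Hom T X Y, monoid.mult = arr_add T, monoid.one = arr_zero T X Y\<rparr>"

definition arr_neg :: "('o, 'm) tricat \<Rightarrow> 'm \<Rightarrow> 'm" where
  "arr_neg T f = m_inv (hom_group T (source T f) (target T f)) f"

definition hom_vanishes :: "('o, 'm) tricat \<Rightarrow> 'o \<Rightarrow> 'o \<Rightarrow> bool" where
  "hom_vanishes T X Y \<longleftrightarrow> (\<forall>f\<in>Hom T X Y. f = arr_zero T X Y)"

definition is_iso_arr :: "('o, 'm) tricat \<Rightarrow> 'm \<Rightarrow> bool" where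
  "is_iso_arr T f \<longleftrightarrow>
     (\<exists>g\<in>Hom T (target T f) (source T f).
        compose T g f = ident T (source T f) \<and> compose T f g = ident T (target T f))"

definition is_zero :: "('o, 'm) tricat \<Rightarrow> 'o \<Rightarrow> bool" where
  "is_zero T Z \<longleftrightarrow> (\<forall>Y. (\<exists>!f. f \<in> Hom T Z Y) \<and> (\<exists>!f. f \<in> Hom T Y Z))"

definition is_coproduct ::
  "('o, 'm) tricat \<Rightarrow> 'i set \<Rightarrow> ('i \<Rightarrow> 'o) \<Rightarrow> 'o \<Rightarrow> ('i \<Rightarrow> 'm) \<Rightarrow> bool" where
  "is_coproduct T I F C \<iota> \<longleftrightarrow>
     (\<forall>i\<in>I. \<iota> i \<in> Hom T (F i) C) \<and>
     (\<forall>Y g. (\<forall>i\<in>I. g i \<in> Hom T (F i) Y) \<longrightarrow>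
        (\<exists>!u. u \<in> Hom T C Y \<and> (\<forall>i\<in>I. compose T u (\<iota> i) = g i)))"

locale additive_shift_category =
  fixes T :: "('o, 'm) tricat"
  assumes ident_in: "ident T X \<in> Hom T X X"
    and compose_in: "\<lbrakk>f \<in> Hom T X Y; g \<in> Hom T Y Z\<rbrakk> \<Longrightarrow> compose T g f \<in> Hom T X Z"
    and compose_ident_right: "f \<in> Hom T X Y \<Longrightarrow> compose T f (ident T X) = f"
    and compose_ident_left: "f \<in> Hom T X Y \<Longrightarrow> compose T (ident T Y) f = f"
    and compose_assoc:
      "\<lbrakk>f \<in> Hom T X Y; g \<in> Hom T Y Z; h \<in> Hom T Z W\<rbrakk> \<Longrightarrow>
         compose T h (compose T g f) = compose T (compose T h g) f"
    and comm_group_hom: "comm_group (hom_group T X Y)"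
    and compose_add_right:
      "\<lbrakk>f \<in> Hom T X Y; f' \<in> Hom T X Y; g \<in> Hom T Y Z\<rbrakk> \<Longrightarrow>
         compose T g (arr_add T f f') = arr_add T (compose T g f) (compose T g f')"
    and compose_add_left:
      "\<lbrakk>f \<in> Hom T X Y; g \<in> Hom T Y Z; g' \<in> Hom T Y Z\<rbrakk> \<Longrightarrow>
         compose T (arr_add T g g') f = arr_add T (compose T g f) (compose T g' f)"
    and finite_coproducts: "\<exists>C \<iota>. is_coproduct T {..<n::nat} F C \<iota>"
    and bij_shift_ob: "bij (shift_ob T)"
    and bij_shift_arr: "bij (shift_arr T)"
    and shift_arr_in:
      "f \<in> Hom T X Y \<Longrightarrow> shift_arr T f \<in> Hom T (shift_ob T X) (shift_ob T Y)"
    and shift_ident: "shift_arr T (ident T X) = ident T (shift_ob T X)"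
    and shift_compose:
      "\<lbrakk>f \<in> Hom T X Y; g \<in> Hom T Y Z\<rbrakk> \<Longrightarrow>
         shift_arr T (compose T g f) = compose T (shift_arr T g) (shift_arr T f)"
    and shift_add:
      "\<lbrakk>f \<in> Hom T X Y; f' \<in> Hom T X Y\<rbrakk> \<Longrightarrow>
         shift_arr T (arr_add T f f') = arr_add T (shift_arr T f) (shift_arr T f')"

definition shift :: "('o, 'm) tricat \<Rightarrow> int \<Rightarrow> 'o \<Rightarrow> 'o" where
  "shift T n X =
     (if 0 \<le> n then (shift_ob T ^^ nat n) X else (inv_into UNIV (shift_ob T) ^^ nat (- n)) X)"


section \<open>Triangulated categories\<close>

locale triangulated_category = additive_shift_category T
  for T :: "('o, 'm) tricat" +
  assumes triangle_arrows:
      "(f, g, h) \<in> triangles T \<Longrightarrow>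
         target T f = source T g \<and> target T g = source T h \<and> target T h = shift_ob T (source T f)"
    and TR1_ident:
      "is_zero T Z \<Longrightarrow>
         (ident T X, arr_zero T X Z, arr_zero T Z (shift_ob T X)) \<in> triangles T"
    and TR1_complete: "\<exists>g h. (f, g, h) \<in> triangles T"
    and TR1_iso:
      "\<lbrakk>(f, g, h) \<in> triangles T;
        f' \<in> Hom T X' Y'; g' \<in> Hom T Y' Z'; h' \<in> Hom T Z' (shift_ob T X');
        a \<in> Hom T (source T f) X'; b \<in> Hom T (source T g) Y'; c \<in> Hom T (source T h) Z';
        is_iso_arr T a; is_iso_arr T b; is_iso_arr T c;
        compose T f' a = compose T b f; compose T g' b = compose T c g;
        compose T h' c = compose T (shift_arr T a) h\<rbrakk> \<Longrightarrow>
       (f', g', h') \<in> triangles T"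
    and TR2:
      "\<lbrakk>f \<in> Hom T X Y; g \<in> Hom T Y Z; h \<in> Hom T Z (shift_ob T X)\<rbrakk> \<Longrightarrow>
         (f, g, h) \<in> triangles T \<longleftrightarrow> (g, h, arr_neg T (shift_arr T f)) \<in> triangles T"
    and TR3:
      "\<lbrakk>(f, g, h) \<in> triangles T; (f', g', h') \<in> triangles T;
        a \<in> Hom T (source T f) (source T f'); b \<in> Hom T (source T g) (source T g');
        compose T f' a = compose T b f\<rbrakk> \<Longrightarrow>
       \<exists>c\<in>Hom T (source T h) (source T h').
         compose T g' b = compose T c g \<and> compose T h' c = compose T (shift_arr T a) h"
    and TR4:
      "\<lbrakk>target T f = source T g;
        (f, f1, f2) \<in> triangles T; (g, g1, g2) \<in> triangles T;
        (compose T g f, k1, k2) \<in> triangles T\<rbrakk> \<Longrightarrow>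
       \<exists>u v w. (u, v, w) \<in> triangles T \<and>
         u \<in> Hom T (source T f2) (source T k2) \<and> v \<in> Hom T (source T k2) (source T g2) \<and>
         compose T u f1 = compose T k1 g \<and> compose T k2 u = f2 \<and>
         compose T v k1 = g1 \<and> compose T g2 v = compose T (shift_arr T f) k2 \<and>
         w = compose T (shift_arr T f1) g2"


section \<open>Smallness, coproducts and compact objects\<close>

text \<open>
  The distinction between sets and proper classes is expressed by a regular uncountable cardinal
  \<open>\<kappa>\<close>: a collection is a (small) set iff it has fewer than \<open>\<kappa>\<close> elements, whereas \<open>'o\<close> and \<open>'m\<close>
  may be of any size.  When \<open>\<kappa>\<close> is the (inaccessible) cardinality of a Grothendieck universe
  this is the usual meaning of "small".  Every index set of size below \<open>\<kappa>\<close> is, up to bijection, a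
  subset of the type \<open>'i\<close> that carries \<open>\<kappa>\<close>.
\<close>

definition small :: "'i rel \<Rightarrow> 'a set \<Rightarrow> bool" where
  "small \<kappa> A \<longleftrightarrow> (card_of A, \<kappa>) \<in> ordLess"

text \<open>
  \<open>X\<close> is compact iff for every small family the canonical group homomorphism
  from the direct sum of the \<open>Hom(X, F i)\<close> to \<open>Hom(X, C)\<close>, \<open>C\<close> the coproduct of the \<open>F i\<close>, is an
  isomorphism.  \<open>sum_group\<close> is the direct sum and \<open>gfinprod\<close> the sum of a family of finite
  support, both in multiplicative notation.
\<close>

definition compact_obj :: "'i rel \<Rightarrow> ('o, 'm) tricat \<Rightarrow> 'o \<Rightarrow> bool" where
  "compact_obj \<kappa> T X \<longleftrightarrow>
     (\<forall>(I :: 'i set) F C \<iota>. small \<kappa> I \<longrightarrow> is_coproduct T I F C \<iota> \<longrightarrow>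
        (\<lambda>\<phi>. gfinprod (hom_group T X C) (\<lambda>i. compose T (\<iota> i) (\<phi> i)) I)
          \<in> iso (sum_group I (\<lambda>i. hom_group T X (F i))) (hom_group T X C))"

definition compacts :: "'i rel \<Rightarrow> ('o, 'm) tricat \<Rightarrow> 'o set" where
  "compacts \<kappa> T = {X. compact_obj \<kappa> T X}"

definition generates :: "('o, 'm) tricat \<Rightarrow> 'o set \<Rightarrow> bool" where
  "generates T S \<longleftrightarrow>
     (\<forall>X. (\<forall>C\<in>S. \<forall>i. hom_vanishes T C (shift T i X)) \<longrightarrow> is_zero T X)"

text \<open>
  Of local smallness only the part concerning morphisms out of compact objects is required.
\<close>

locale compactly_generated_triangulated_category = triangulated_category T
  for \<kappa> :: "'i rel" and T :: "('o, 'm) tricat" +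
  assumes card_order_small: "Card_order \<kappa>"
    and regular_small: "regularCard \<kappa>"
    and uncountable_small: "(natLeq, \<kappa>) \<in> ordLess"
    and small_hom: "compact_obj \<kappa> T C \<Longrightarrow> small \<kappa> (Hom T C X)"
    and small_coproducts: "small \<kappa> (I :: 'i set) \<Longrightarrow> \<exists>C \<iota>. is_coproduct T I F C \<iota>"
    and compactly_generated: "\<exists>S. small \<kappa> S \<and> S \<subseteq> compacts \<kappa> T \<and> generates T S"


section \<open>Subcategories\<close>

text \<open>Full subcategories are given by their sets of objects.\<close>

definition direct_sum_of :: "('o, 'm) tricat \<Rightarrow> 'o \<Rightarrow> 'o \<Rightarrow> 'o \<Rightarrow> bool" where
  "direct_sum_of T X Y C \<longleftrightarrow>
     (\<exists>\<iota>. is_coproduct T (UNIV :: bool set) (\<lambda>b. if b then X else Y) C \<iota>)"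

definition smd :: "('o, 'm) tricat \<Rightarrow> 'o set \<Rightarrow> 'o set" where
  "smd T A = {X. \<exists>Y. \<exists>C\<in>A. direct_sum_of T X Y C}"

definition Add :: "'i rel \<Rightarrow> ('o, 'm) tricat \<Rightarrow> 'o \<Rightarrow> 'o set" where
  "Add \<kappa> T M =
     smd T {C. \<exists>(I :: 'i set) \<iota>. small \<kappa> I \<and> is_coproduct T I (\<lambda>_. M) C \<iota>}"

definition finite_sums :: "('o, 'm) tricat \<Rightarrow> 'o set \<Rightarrow> 'o set" where
  "finite_sums T A =
     {C. \<exists>(n::nat) F \<iota>. (\<forall>i<n. F i \<in> A) \<and> is_coproduct T {..<n} F C \<iota>}"

definition add_fin :: "('o, 'm) tricat \<Rightarrow> 'o \<Rightarrow> 'o set" where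
  "add_fin T M = smd T (finite_sums T {M})"

definition star :: "('o, 'm) tricat \<Rightarrow> 'o set \<Rightarrow> 'o set \<Rightarrow> 'o set" where
  "star T A B =
     {Z. \<exists>f g h. (f, g, h) \<in> triangles T \<and> source T f \<in> A \<and> target T f = Z \<and> target T g \<in> B}"

text \<open>\<open>coprod T A n\<close> is \<open>coprod\<^sub>n(A)\<close> for \<open>n \<ge> 1\<close>; the value at \<open>0\<close> is not used.\<close>

fun coprod :: "('o, 'm) tricat \<Rightarrow> 'o set \<Rightarrow> nat \<Rightarrow> 'o set" where
  "coprod T A 0 = {}"
| "coprod T A (Suc 0) = finite_sums T A"
| "coprod T A (Suc (Suc n)) = star T (finite_sums T A) (coprod T A (Suc n))"

definition right_perp :: "('o, 'm) tricat \<Rightarrow> 'o set \<Rightarrow> 'o set" where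
  "right_perp T A = {Y. \<forall>X\<in>A. hom_vanishes T X Y}"

definition left_perp :: "('o, 'm) tricat \<Rightarrow> 'o set \<Rightarrow> 'o set" where
  "left_perp T B = {X. \<forall>Y\<in>B. hom_vanishes T X Y}"

definition t_structure :: "('o, 'm) tricat \<Rightarrow> 'o set \<Rightarrow> 'o set \<Rightarrow> bool" where
  "t_structure T U V \<longleftrightarrow>
     V = right_perp T U \<and> U = left_perp T V \<and> (\<forall>X. X \<in> star T U V) \<and>
     (\<forall>X\<in>U. shift T 1 X \<in> U)"

definition perp_gt :: "('o, 'm) tricat \<Rightarrow> 'o \<Rightarrow> int \<Rightarrow> 'o set" where
  "perp_gt T M n = {Y. \<forall>i>n. hom_vanishes T M (shift T i Y)}"

definition perp_le :: "('o, 'm) tricat \<Rightarrow> 'o \<Rightarrow> int \<Rightarrow> 'o set" where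
  "perp_le T M n = {Y. \<forall>i\<le>n. hom_vanishes T M (shift T i Y)}"


section \<open>Silting objects and the associated t-structure\<close>

definition silting :: "('o, 'm) tricat \<Rightarrow> 'o \<Rightarrow> bool" where
  "silting T M \<longleftrightarrow> t_structure T (perp_gt T M 0) (perp_le T M 0)"

definition tilting :: "'i rel \<Rightarrow> ('o, 'm) tricat \<Rightarrow> 'o \<Rightarrow> bool" where
  "tilting \<kappa> T M \<longleftrightarrow> silting T M \<and>
     (\<forall>P\<in>Add \<kappa> T M. \<forall>P'\<in>Add \<kappa> T M. \<forall>i. i \<noteq> 0 \<longrightarrow> hom_vanishes T P (shift T i P'))"

definition compact_silting_generator :: "'i rel \<Rightarrow> ('o, 'm) tricat \<Rightarrow> 'o \<Rightarrow> bool" where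
  "compact_silting_generator \<kappa> T M \<longleftrightarrow> compact_obj \<kappa> T M \<and> generates T {M} \<and> silting T M"

definition T_le :: "('o, 'm) tricat \<Rightarrow> 'o \<Rightarrow> int \<Rightarrow> 'o set" where
  "T_le T M n = perp_gt T M n"

definition T_ge :: "('o, 'm) tricat \<Rightarrow> 'o \<Rightarrow> int \<Rightarrow> 'o set" where
  "T_ge T M n = perp_le T M (n - 1)"

definition T_minus :: "('o, 'm) tricat \<Rightarrow> 'o \<Rightarrow> 'o set" where
  "T_minus T M = (\<Union>n\<in>{0<..}. T_le T M n)"

definition T_plus :: "('o, 'm) tricat \<Rightarrow> 'o \<Rightarrow> 'o set" where
  "T_plus T M = (\<Union>n\<in>{0<..}. T_ge T M (- n))"

definition T_b :: "('o, 'm) tricat \<Rightarrow> 'o \<Rightarrow> 'o set" where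
  "T_b T M = T_minus T M \<inter> T_plus T M"

definition T_minus_c :: "'i rel \<Rightarrow> ('o, 'm) tricat \<Rightarrow> 'o \<Rightarrow> 'o set" where
  "T_minus_c \<kappa> T M = (\<Inter>m\<in>{1..}. star T (compacts \<kappa> T) (T_le T M (- m)))"

definition T_b_c :: "'i rel \<Rightarrow> ('o, 'm) tricat \<Rightarrow> 'o \<Rightarrow> 'o set" where
  "T_b_c \<kappa> T M = T_minus_c \<kappa> T M \<inter> T_b T M"

definition heart :: "('o, 'm) tricat \<Rightarrow> 'o \<Rightarrow> 'o set" where
  "heart T M = T_le T M 0 \<inter> T_ge T M 0"

text \<open>
  The truncations of \<open>X\<close> are the outer terms of the triangle given by the t-structure; they are
  determined up to isomorphism, and one is chosen.
\<close>

definition trunc_le :: "('o, 'm) tricat \<Rightarrow> 'o \<Rightarrow> int \<Rightarrow> 'o \<Rightarrow> 'o" where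
  "trunc_le T M n X =
     (SOME U. U \<in> T_le T M n \<and>
        (\<exists>f g h. (f, g, h) \<in> triangles T \<and> source T f = U \<and> target T f = X \<and>
           target T g \<in> T_ge T M (n + 1)))"

definition trunc_ge :: "('o, 'm) tricat \<Rightarrow> 'o \<Rightarrow> int \<Rightarrow> 'o \<Rightarrow> 'o" where
  "trunc_ge T M n X =
     (SOME V. V \<in> T_ge T M n \<and>
        (\<exists>f g h. (f, g, h) \<in> triangles T \<and> source T f \<in> T_le T M (n - 1) \<and> target T f = X \<and>
           target T g = V))"

definition H0 :: "('o, 'm) tricat \<Rightarrow> 'o \<Rightarrow> 'o \<Rightarrow> 'o" where
  "H0 T M X = trunc_ge T M 0 (trunc_le T M 0 X)"

definition Hl :: "('o, 'm) tricat \<Rightarrow> 'o \<Rightarrow> int \<Rightarrow> 'o \<Rightarrow> 'o" where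
  "Hl T M l X = H0 T M (shift T l X)"

definition coh_sup :: "('o, 'm) tricat \<Rightarrow> 'o \<Rightarrow> 'o \<Rightarrow> ereal" where
  "coh_sup T M X = (SUP l\<in>{l. \<not> is_zero T (Hl T M l X)}. ereal (of_int l))"

definition coh_inf :: "('o, 'm) tricat \<Rightarrow> 'o \<Rightarrow> 'o \<Rightarrow> ereal" where
  "coh_inf T M X = (INF l\<in>{l. \<not> is_zero T (Hl T M l X)}. ereal (of_int l))"


section \<open>Dimensions of the triangulated category\<close>

definition projdim :: "('o, 'm) tricat \<Rightarrow> 'o \<Rightarrow> 'o \<Rightarrow> ereal" where
  "projdim T M X =
     (INF n\<in>{n::int. \<forall>U\<in>T_minus T M. \<forall>i::int.
               ereal (of_int i) > ereal (of_int n) + coh_sup T M U \<longrightarrow>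
               hom_vanishes T X (shift T i U)}. ereal (of_int n))"

definition fpd :: "'i rel \<Rightarrow> ('o, 'm) tricat \<Rightarrow> 'o \<Rightarrow> ereal" where
  "fpd \<kappa> T M =
     (SUP X\<in>{X \<in> compacts \<kappa> T \<inter> T_b T M \<inter> T_ge T M 0. projdim T M X < \<infinity>}. projdim T M X)"

definition coconnective :: "('o, 'm) tricat \<Rightarrow> 'o \<Rightarrow> 'o set" where
  "coconnective T M = {X. \<forall>n\<ge>1. hom_vanishes T (shift T n M) X}"

definition gen_nonneg :: "('o, 'm) tricat \<Rightarrow> 'o \<Rightarrow> 'o set" where
  "gen_nonneg T M = (\<Union>n\<in>{0<..}. smd T (coprod T {shift T (- i) M |i. 0 \<le> i} n))"

definition findim :: "'i rel \<Rightarrow> ('o, 'm) tricat \<Rightarrow> 'o \<Rightarrow> ereal" where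
  "findim \<kappa> T M =
     (INF n\<in>{n::nat. coconnective T M \<inter> compacts \<kappa> T \<subseteq> shift T (int n) ` gen_nonneg T M}.
        ereal (of_nat n))"


section \<open>Homological algebra in the heart\<close>

text \<open>
  The following notions are relative to the full subcategory with set of objects \<open>A\<close>, which below
  is the heart (an abelian category); kernels, cokernels and images are those of \<open>A\<close>, not of \<open>T\<close>.
\<close>

definition arr_in :: "('o, 'm) tricat \<Rightarrow> 'o set \<Rightarrow> 'm \<Rightarrow> bool" where
  "arr_in T A f \<longleftrightarrow> source T f \<in> A \<and> target T f \<in> A"

definition mono_in :: "('o, 'm) tricat \<Rightarrow> 'o set \<Rightarrow> 'm \<Rightarrow> bool" where
  "mono_in T A f \<longleftrightarrow> arr_in T A f \<and>
     (\<forall>W\<in>A. \<forall>u\<in>Hom T W (source T f). \<forall>v\<in>Hom T W (source T f).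
        compose T f u = compose T f v \<longrightarrow> u = v)"

definition epi_in :: "('o, 'm) tricat \<Rightarrow> 'o set \<Rightarrow> 'm \<Rightarrow> bool" where
  "epi_in T A f \<longleftrightarrow> arr_in T A f \<and>
     (\<forall>W\<in>A. \<forall>u\<in>Hom T (target T f) W. \<forall>v\<in>Hom T (target T f) W.
        compose T u f = compose T v f \<longrightarrow> u = v)"

definition kernel_in :: "('o, 'm) tricat \<Rightarrow> 'o set \<Rightarrow> 'm \<Rightarrow> 'm \<Rightarrow> bool" where
  "kernel_in T A k f \<longleftrightarrow> arr_in T A k \<and> arr_in T A f \<and> target T k = source T f \<and>
     compose T f k = arr_zero T (source T k) (target T f) \<and>
     (\<forall>W\<in>A. \<forall>u\<in>Hom T W (source T f).
        compose T f u = arr_zero T W (target T f) \<longrightarrow>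
        (\<exists>!v. v \<in> Hom T W (source T k) \<and> compose T k v = u))"

definition cokernel_in :: "('o, 'm) tricat \<Rightarrow> 'o set \<Rightarrow> 'm \<Rightarrow> 'm \<Rightarrow> bool" where
  "cokernel_in T A c f \<longleftrightarrow> arr_in T A c \<and> arr_in T A f \<and> source T c = target T f \<and>
     compose T c f = arr_zero T (source T f) (target T c) \<and>
     (\<forall>W\<in>A. \<forall>u\<in>Hom T (target T f) W.
        compose T u f = arr_zero T (source T f) W \<longrightarrow>
        (\<exists>!v. v \<in> Hom T (target T c) W \<and> compose T v c = u))"

definition image_in :: "('o, 'm) tricat \<Rightarrow> 'o set \<Rightarrow> 'm \<Rightarrow> 'm \<Rightarrow> bool" where
  "image_in T A j f \<longleftrightarrow> (\<exists>c. cokernel_in T A c f \<and> kernel_in T A j c)"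

definition exact_in :: "('o, 'm) tricat \<Rightarrow> 'o set \<Rightarrow> 'm \<Rightarrow> 'm \<Rightarrow> bool" where
  "exact_in T A f g \<longleftrightarrow> (\<exists>j. image_in T A j f \<and> kernel_in T A j g)"

definition projective_in :: "('o, 'm) tricat \<Rightarrow> 'o set \<Rightarrow> 'o \<Rightarrow> bool" where
  "projective_in T A Q \<longleftrightarrow> Q \<in> A \<and>
     (\<forall>g. epi_in T A g \<longrightarrow>
        (\<forall>f\<in>Hom T Q (target T g). \<exists>f'\<in>Hom T Q (source T g). compose T g f' = f))"

text \<open>
  \<open>0 \<rightarrow> P n \<rightarrow> \<dots> \<rightarrow> P 0 \<rightarrow> H \<rightarrow> 0\<close> is exact in \<open>A\<close> with all \<open>P i\<close> in \<open>B\<close>, where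
  \<open>d 0 : P 0 \<rightarrow> H\<close> and \<open>d (i + 1) : P (i + 1) \<rightarrow> P i\<close>.
\<close>

definition has_resolution ::
  "('o, 'm) tricat \<Rightarrow> 'o set \<Rightarrow> 'o set \<Rightarrow> nat \<Rightarrow> 'o \<Rightarrow> bool" where
  "has_resolution T A B n H \<longleftrightarrow>
     (\<exists>P d. (\<forall>i\<le>n. P i \<in> A \<inter> B) \<and>
        d 0 \<in> Hom T (P 0) H \<and> (\<forall>i<n. d (Suc i) \<in> Hom T (P (Suc i)) (P i)) \<and>
        epi_in T A (d 0) \<and> (\<forall>i<n. exact_in T A (d (Suc i)) (d i)) \<and> mono_in T A (d n))"

definition projdim_in :: "('o, 'm) tricat \<Rightarrow> 'o set \<Rightarrow> 'o \<Rightarrow> ereal" where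
  "projdim_in T A H =
     (INF n\<in>{n. has_resolution T A {Q. projective_in T A Q} n H}. ereal (of_nat n))"

definition fpd_heart :: "('o, 'm) tricat \<Rightarrow> 'o \<Rightarrow> ereal" where
  "fpd_heart T M =
     (SUP H\<in>{H \<in> heart T M. \<exists>n. has_resolution T (heart T M) (add_fin T M) n H}.
        projdim_in T (heart T M) H)"

end

theory Submission
  imports Defs
begin

text \<open>
  Everything is measured by the groups \<open>Hom(M, Y[i])\<close>: since \<open>M\<close> generates, \<open>H\<^sup>i(Y) = 0\<close> iff
  \<open>Hom(M, Y[i]) = 0\<close>, and \<open>projdim X \<le> n\<close> iff \<open>Hom(X, -)\<close> kills the objects in degrees
  \<open>\<le> - n - 1\<close>.

  Given \<open>X\<close> compact, iterate \<open>X \<rightarrow> X\<^sub>1 \<rightarrow> X\<^sub>2 \<rightarrow> \<dots>\<close>, each step being the cone of the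
  universal map from a coproduct of shifts of \<open>M\<close>. Some composite \<open>X \<rightarrow> X\<^sub>n\<close> vanishes, and
  factoring backwards through finite subcoproducts exhibits \<open>X\<close> as a retract of a finite extension
  of shifts of \<open>M\<close>. Hence compact objects are bounded above and of finite projective dimension, so
  the suprema range over the same objects up to shift. Killing one degree at a time with finite sums
  gives triangles \<open>F \<rightarrow> X \<rightarrow> X'\<close> with \<open>F\<close> built from low shifts of \<open>M\<close> and \<open>X'\<close> in very
  negative degrees; if \<open>projdim X\<close> is small, then \<open>X \<rightarrow> X'\<close> is zero and \<open>X\<close> is a summand of \<open>F\<close>,
  which bounds \<open>findim\<close>. If \<open>M\<close> is tilting, stopping in degree \<open>0\<close> leaves \<open>X'\<close> in the heart,
  where finite \<open>add(M)\<close>-resolutions and \<open>projdim\<close> correspond.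
\<close>

section \<open>Additive calculus\<close>

text \<open>Compactness is given as an isomorphism of Hom groups, a form that does not visibly
  survive retracts and cones. It is traded for a support condition on single arrows: u is supported
  on finitely many legs if every endomorphism fixing those legs fixes u. This can be checked one
  term of a triangle at a time and still yields factorizations through finite coproducts. The degree
  argument needs finite covers of the top cohomology, but the universal maps start at possibly
  infinite coproducts. Hence the detour over a whole tower, cut down to finite sums only once its
  composite has vanished. The zero object has projective dimension -\<infinity> and infimum
  \<infinity>, and their sum is \<infinity> in \<open>ereal\<close>; so the suprema with
  \<open>coh_inf\<close> run over nonzero objects. If all objects are zero, \<open>fpd\<close> is
  -\<infinity> while \<open>findim\<close> and \<open>fpd_heart\<close> are not negative; so the
  tilting equalities ask for a nonzero object.\<close>

context additive_shift_category
begin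

abbreviation comp :: "'m \<Rightarrow> 'm \<Rightarrow> 'm"  (infixr "\<bullet>" 70)
  where "g \<bullet> f \<equiv> compose T g f"

abbreviation sh :: "'o \<Rightarrow> 'o" where "sh \<equiv> shift_ob T"

abbreviation sha :: "'m \<Rightarrow> 'm" where "sha \<equiv> shift_arr T"

definition arr_sub :: "'m \<Rightarrow> 'm \<Rightarrow> 'm" where
  "arr_sub f g = arr_add T f (arr_neg T g)"

lemma Hom_source: "f \<in> Hom T X Y \<Longrightarrow> source T f = X"
  by (simp add: Hom_def)

lemma Hom_target: "f \<in> Hom T X Y \<Longrightarrow> target T f = Y"
  by (simp add: Hom_def)

lemma zero_in: "arr_zero T X Y \<in> Hom T X Y"
proof -
  interpret G: comm_group "hom_group T X Y" by (rule comm_group_hom)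
  show ?thesis using G.one_closed by (simp add: hom_group_def)
qed

lemma source_ident [simp]: "source T (ident T X) = X"
  and target_ident [simp]: "target T (ident T X) = X"
  using ident_in[of X] by (auto simp: Hom_def)

lemma source_zero [simp]: "source T (arr_zero T X Y) = X"
  and target_zero [simp]: "target T (arr_zero T X Y) = Y"
  using zero_in[of X Y] by (auto simp: Hom_def)

lemma add_in: "f \<in> Hom T X Y \<Longrightarrow> g \<in> Hom T X Y \<Longrightarrow> arr_add T f g \<in> Hom T X Y"
proof -
  assume *: "f \<in> Hom T X Y" "g \<in> Hom T X Y"
  interpret G: comm_group "hom_group T X Y" by (rule comm_group_hom)
  show ?thesis using * G.m_closed[of f g] by (simp add: hom_group_def)
qed

lemma neg_in: assumes "f \<in> Hom T X Y" shows "arr_neg T f \<in> Hom T X Y"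
proof -
  interpret G: comm_group "hom_group T X Y" by (rule comm_group_hom)
  show ?thesis using assms G.inv_closed[of f]
    by (simp add: hom_group_def arr_neg_def Hom_source Hom_target)
qed

lemma sub_in: "f \<in> Hom T X Y \<Longrightarrow> g \<in> Hom T X Y \<Longrightarrow> arr_sub f g \<in> Hom T X Y"
  by (simp add: arr_sub_def add_in neg_in)

lemma add_zero_right: assumes "f \<in> Hom T X Y" shows "arr_add T f (arr_zero T X Y) = f"
proof -
  interpret G: comm_group "hom_group T X Y" by (rule comm_group_hom)
  show ?thesis using assms G.r_one[of f] by (simp add: hom_group_def)
qed

lemma add_zero_left: assumes "f \<in> Hom T X Y" shows "arr_add T (arr_zero T X Y) f = f"
proof -
  interpret G: comm_group "hom_group T X Y" by (rule comm_group_hom)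
  show ?thesis using assms G.l_one[of f] by (simp add: hom_group_def)
qed

lemma add_neg_right: assumes "f \<in> Hom T X Y" shows "arr_add T f (arr_neg T f) = arr_zero T X Y"
proof -
  interpret G: comm_group "hom_group T X Y" by (rule comm_group_hom)
  show ?thesis using assms G.r_inv[of f]
    by (simp add: hom_group_def arr_neg_def Hom_source Hom_target)
qed

lemma add_eq_zero_imp_neg:
  assumes "f \<in> Hom T X Y" "g \<in> Hom T X Y" "arr_add T f g = arr_zero T X Y"
  shows "g = arr_neg T f"
proof -
  interpret G: comm_group "hom_group T X Y" by (rule comm_group_hom)
  show ?thesis using assms G.inv_equality[of g f] G.m_comm[of f g]
    by (simp add: hom_group_def arr_neg_def Hom_source Hom_target)
qed

lemma add_assoc:
  assumes "f \<in> Hom T X Y" "g \<in> Hom T X Y" "h \<in> Hom T X Y"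
  shows "arr_add T (arr_add T f g) h = arr_add T f (arr_add T g h)"
proof -
  interpret G: comm_group "hom_group T X Y" by (rule comm_group_hom)
  show ?thesis using assms G.m_assoc[of f g h] by (simp add: hom_group_def)
qed

lemma add_comm:
  assumes "f \<in> Hom T X Y" "g \<in> Hom T X Y"
  shows "arr_add T f g = arr_add T g f"
proof -
  interpret G: comm_group "hom_group T X Y" by (rule comm_group_hom)
  show ?thesis using assms G.m_comm[of f g] by (simp add: hom_group_def)
qed

lemma add_cancel_left:
  assumes "f \<in> Hom T X Y" "g \<in> Hom T X Y" "h \<in> Hom T X Y" "arr_add T f g = arr_add T f h"
  shows "g = h"
proof -
  interpret G: comm_group "hom_group T X Y" by (rule comm_group_hom)
  show ?thesis using assms G.Units_l_cancel[of f g h] G.Units_eq by (simp add: hom_group_def)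
qed

lemma neg_neg: assumes "f \<in> Hom T X Y" shows "arr_neg T (arr_neg T f) = f"
  using add_eq_zero_imp_neg[OF neg_in[OF assms] assms] add_neg_right[OF assms]
    add_comm[OF assms neg_in[OF assms]] by simp

lemma sub_add: assumes "f \<in> Hom T X Y" "g \<in> Hom T X Y"
  shows "arr_add T (arr_sub f g) g = f"
  using assms by (simp add: arr_sub_def add_assoc neg_in add_neg_right add_zero_right
      add_comm[OF neg_in[OF assms(2)] assms(2)])

lemma sub_eq_zero: assumes "f \<in> Hom T X Y" "g \<in> Hom T X Y"
  shows "arr_sub f g = arr_zero T X Y \<longleftrightarrow> f = g"
  using sub_add[OF assms] add_zero_left[OF assms(2)] add_neg_right[OF assms(2)]
  by (auto simp: arr_sub_def)

lemma comp_zero_right: assumes "g \<in> Hom T Y Z" shows "g \<bullet> arr_zero T X Y = arr_zero T X Z"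
proof -
  let ?z = "arr_zero T X Y"
  have z: "?z \<in> Hom T X Y" by (rule zero_in)
  have gz: "g \<bullet> ?z \<in> Hom T X Z" using z assms by (rule compose_in)
  have "arr_add T (g \<bullet> ?z) (g \<bullet> ?z) = g \<bullet> ?z"
    using compose_add_right[OF z z assms] add_zero_right[OF z] by simp
  then show ?thesis using add_cancel_left[OF gz gz zero_in] add_zero_right[OF gz] by simp
qed

lemma comp_zero_left: assumes "f \<in> Hom T X Y" shows "arr_zero T Y Z \<bullet> f = arr_zero T X Z"
proof -
  let ?z = "arr_zero T Y Z"
  have z: "?z \<in> Hom T Y Z" by (rule zero_in)
  have gz: "?z \<bullet> f \<in> Hom T X Z" using assms z by (rule compose_in)
  have "arr_add T (?z \<bullet> f) (?z \<bullet> f) = ?z \<bullet> f"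
    using compose_add_left[OF assms z z] add_zero_right[OF z] by simp
  then show ?thesis using add_cancel_left[OF gz gz zero_in] add_zero_right[OF gz] by simp
qed

lemma comp_neg_right: assumes "f \<in> Hom T X Y" "g \<in> Hom T Y Z"
  shows "g \<bullet> arr_neg T f = arr_neg T (g \<bullet> f)"
proof (rule add_eq_zero_imp_neg)
  show "arr_add T (g \<bullet> f) (g \<bullet> arr_neg T f) = arr_zero T X Z"
    using compose_add_right[OF assms(1) neg_in[OF assms(1)] assms(2)] add_neg_right[OF assms(1)]
      comp_zero_right[OF assms(2)] by simp
qed (use assms in \<open>auto intro: compose_in neg_in\<close>)

lemma comp_neg_left: assumes "f \<in> Hom T X Y" "g \<in> Hom T Y Z"
  shows "arr_neg T g \<bullet> f = arr_neg T (g \<bullet> f)"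
proof (rule add_eq_zero_imp_neg)
  show "arr_add T (g \<bullet> f) (arr_neg T g \<bullet> f) = arr_zero T X Z"
    using compose_add_left[OF assms(1,2) neg_in[OF assms(2)]] add_neg_right[OF assms(2)]
      comp_zero_left[OF assms(1)] by simp
qed (use assms in \<open>auto intro: compose_in neg_in\<close>)

lemma comp_sub_right: assumes "f \<in> Hom T X Y" "f' \<in> Hom T X Y" "g \<in> Hom T Y Z"
  shows "g \<bullet> arr_sub f f' = arr_sub (g \<bullet> f) (g \<bullet> f')"
  using assms by (simp add: arr_sub_def compose_add_right[OF _ neg_in] comp_neg_right)

lemma comp_sub_left: assumes "f \<in> Hom T X Y" "g \<in> Hom T Y Z" "g' \<in> Hom T Y Z"
  shows "arr_sub g g' \<bullet> f = arr_sub (g \<bullet> f) (g' \<bullet> f)"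
  using assms by (simp add: arr_sub_def compose_add_left[OF _ _ neg_in] comp_neg_left)

lemma neg_zero: "arr_neg T (arr_zero T X Y) = arr_zero T X Y"
  using add_eq_zero_imp_neg[OF zero_in zero_in add_zero_right[OF zero_in]] by simp

lemma neg_eq_zero: assumes "f \<in> Hom T X Y"
  shows "arr_neg T f = arr_zero T X Y \<longleftrightarrow> f = arr_zero T X Y"
  using neg_neg[OF assms] neg_zero by metis

lemma sub_zero_right: "f \<in> Hom T X Y \<Longrightarrow> arr_sub f (arr_zero T X Y) = f"
  by (simp add: arr_sub_def neg_zero add_zero_right)

lemma hom_vanishesD: "hom_vanishes T X Y \<Longrightarrow> f \<in> Hom T X Y \<Longrightarrow> f = arr_zero T X Y"
  by (simp add: hom_vanishes_def)

lemma hom_vanishesI: "(\<And>f. f \<in> Hom T X Y \<Longrightarrow> f = arr_zero T X Y) \<Longrightarrow> hom_vanishes T X Y"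
  by (simp add: hom_vanishes_def)

subsection \<open>Shift\<close>

lemma sh_eq_iff: "sh X = sh Y \<longleftrightarrow> X = Y"
  using bij_shift_ob by (auto dest: bij_is_inj injD)

lemma sha_eq_iff: "sha f = sha g \<longleftrightarrow> f = g"
  using bij_shift_arr by (auto dest: bij_is_inj injD)

lemma sh_surj: "\<exists>Y. sh Y = X"
  using bij_shift_ob by (metis bij_pointE)

lemma sha_surj: "\<exists>g. sha g = f"
  using bij_shift_arr by (metis bij_pointE)

lemma sha_in_iff: "sha f \<in> Hom T (sh X) (sh Y) \<longleftrightarrow> f \<in> Hom T X Y"
proof
  assume *: "sha f \<in> Hom T (sh X) (sh Y)"
  have "sha f \<in> Hom T (sh (source T f)) (sh (target T f))"
    by (rule shift_arr_in) (simp add: Hom_def)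
  with * show "f \<in> Hom T X Y" by (simp add: Hom_def sh_eq_iff)
qed (rule shift_arr_in)

lemma sha_obtain: assumes "g \<in> Hom T (sh X) (sh Y)" obtains f where "f \<in> Hom T X Y" "g = sha f"
  using assms sha_surj[of g] sha_in_iff by metis

lemma sha_zero: "sha (arr_zero T X Y) = arr_zero T (sh X) (sh Y)"
proof -
  let ?z = "arr_zero T X Y"
  have z: "?z \<in> Hom T X Y" by (rule zero_in)
  have sz: "sha ?z \<in> Hom T (sh X) (sh Y)" using z by (rule shift_arr_in)
  have "arr_add T (sha ?z) (sha ?z) = sha ?z"
    using shift_add[OF z z] add_zero_right[OF z] by simp
  then show ?thesis using add_cancel_left[OF sz sz zero_in] add_zero_right[OF sz] by simp
qed

lemma sha_eq_zero: "sha f = arr_zero T (sh X) (sh Y) \<longleftrightarrow> f = arr_zero T X Y"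
  using sha_zero sha_eq_iff by metis

lemma sha_neg: assumes "f \<in> Hom T X Y" shows "sha (arr_neg T f) = arr_neg T (sha f)"
proof (rule add_eq_zero_imp_neg)
  show "arr_add T (sha f) (sha (arr_neg T f)) = arr_zero T (sh X) (sh Y)"
    using shift_add[OF assms neg_in[OF assms]] add_neg_right[OF assms] sha_zero by simp
qed (use assms in \<open>auto intro: shift_arr_in neg_in\<close>)

lemma hom_vanishes_sh: "hom_vanishes T (sh X) (sh Y) \<longleftrightarrow> hom_vanishes T X Y"
  unfolding hom_vanishes_def
  by (metis sha_eq_zero sha_obtain shift_arr_in)

lemma inv_sh: "inv_into UNIV sh (sh X) = X" "sh (inv_into UNIV sh X) = X"
  using bij_shift_ob by (auto simp: bij_is_inj inv_f_f bij_is_surj surj_f_inv_f)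

lemma shift_0: "shift T 0 X = X"
  by (simp add: shift_def)

lemma shift_plus1: "shift T (n + 1) X = sh (shift T n X)"
proof (cases "0 \<le> n")
  case True
  then have "nat (n + 1) = Suc (nat n)" by simp
  with True show ?thesis by (simp add: shift_def)
next
  case False
  then have "nat (- n) = Suc (nat (- (n + 1)))" by simp
  with False show ?thesis by (cases "n + 1 = 0") (auto simp: shift_def inv_sh)
qed

lemma shift_1: "shift T 1 X = sh X"
  using shift_plus1[of 0 X] by (simp add: shift_0)

lemma shift_shift: "shift T m (shift T n X) = shift T (m + n) X"
proof (induction m rule: int_induct[where k = 0])
  case base then show ?case by (simp add: shift_0)
next
  case (step1 i) then show ?case
    using shift_plus1[of i "shift T n X"] shift_plus1[of "i + n" X] by (simp add: ac_simps)
next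
  case (step2 i) then show ?case
    using shift_plus1[of "i - 1" "shift T n X"] shift_plus1[of "i - 1 + n" X]
    by (simp add: ac_simps sh_eq_iff)
qed

lemma sh_shift: "sh (shift T n X) = shift T (n + 1) X"
  by (simp add: shift_plus1)

lemma hom_vanishes_shift: "hom_vanishes T (shift T n X) (shift T n Y) \<longleftrightarrow> hom_vanishes T X Y"
proof (induction n rule: int_induct[where k = 0])
  case base then show ?case by (simp add: shift_0)
next
  case (step1 i) then show ?case by (simp add: shift_plus1 hom_vanishes_sh)
next
  case (step2 i) then show ?case
    using hom_vanishes_sh[of "shift T (i - 1) X" "shift T (i - 1) Y"] by (simp add: sh_shift)
qed

lemma hom_vanishes_shift_right:
  "hom_vanishes T X (shift T n Y) \<longleftrightarrow> hom_vanishes T (shift T (- n) X) Y"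
  using hom_vanishes_shift[of n "shift T (- n) X" Y] by (simp add: shift_shift shift_0)

subsection \<open>Zero objects\<close>

lemma is_zero_iff: "is_zero T Z \<longleftrightarrow> ident T Z = arr_zero T Z Z"
proof
  assume "is_zero T Z"
  then show "ident T Z = arr_zero T Z Z"
    using ident_in zero_in unfolding is_zero_def by metis
next
  assume *: "ident T Z = arr_zero T Z Z"
  show "is_zero T Z" unfolding is_zero_def
  proof (intro allI conjI)
    fix Y
    show "\<exists>!f. f \<in> Hom T Z Y"
      using * compose_ident_right[of _ Z Y] comp_zero_right[of _ Z Y Z] zero_in[of Z Y] by metis
    show "\<exists>!f. f \<in> Hom T Y Z"
      using * compose_ident_left[of _ Y Z] comp_zero_left[of _ Y Z Z] zero_in[of Y Z] by metis
  qed
qed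

lemma is_zero_vanish: assumes "is_zero T Z"
  shows "hom_vanishes T Z Y" "hom_vanishes T Y Z"
  using assms zero_in unfolding is_zero_def hom_vanishes_def by blast+

lemma is_zero_self_vanish: "hom_vanishes T Z Z \<Longrightarrow> is_zero T Z"
  by (simp add: is_zero_iff hom_vanishes_def ident_in)

lemma zero_object: "\<exists>Z. is_zero T Z"
proof -
  \<comment> \<open>The empty coproduct is initial, so its only endomorphism is both the identity
    and zero.\<close>
  obtain C and \<iota> :: "nat \<Rightarrow> 'm" where "is_coproduct T {..<0::nat} undefined C \<iota>"
    using finite_coproducts by blast
  then have "\<exists>!u. u \<in> Hom T C C" by (simp add: is_coproduct_def)
  then show ?thesis using is_zero_iff ident_in zero_in by metis
qed

lemma is_zero_sh: "is_zero T (sh X) \<longleftrightarrow> is_zero T X"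
  by (metis is_zero_iff shift_ident sha_eq_zero)

lemma is_zero_shift: "is_zero T (shift T n X) \<longleftrightarrow> is_zero T X"
  using hom_vanishes_shift is_zero_self_vanish is_zero_vanish by metis

subsection \<open>Coproducts\<close>

lemma coproduct_leg: "is_coproduct T I F C \<iota> \<Longrightarrow> i \<in> I \<Longrightarrow> \<iota> i \<in> Hom T (F i) C"
  by (simp add: is_coproduct_def)

lemma coproduct_desc:
  assumes "is_coproduct T I F C \<iota>" and "\<And>i. i \<in> I \<Longrightarrow> g i \<in> Hom T (F i) Y"
  shows "\<exists>u\<in>Hom T C Y. \<forall>i\<in>I. u \<bullet> \<iota> i = g i"
proof -
  have "\<forall>i\<in>I. g i \<in> Hom T (F i) Y" using assms(2) by simp
  from assms(1)[unfolded is_coproduct_def, THEN conjunct2, THEN spec, THEN spec, THEN mp, OF this]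
  obtain u where "u \<in> Hom T C Y \<and> (\<forall>i\<in>I. u \<bullet> \<iota> i = g i)" by (elim ex1E)
  then show ?thesis by blast
qed

lemma coproduct_eq:
  assumes c: "is_coproduct T I F C \<iota>" and u: "u \<in> Hom T C Y" and v: "v \<in> Hom T C Y"
    and eq: "\<And>i. i \<in> I \<Longrightarrow> u \<bullet> \<iota> i = v \<bullet> \<iota> i"
  shows "u = v"
proof -
  have "\<forall>i\<in>I. u \<bullet> \<iota> i \<in> Hom T (F i) Y"
    using coproduct_leg[OF c] u by (blast intro: compose_in)
  from c[unfolded is_coproduct_def, THEN conjunct2, THEN spec, THEN spec, THEN mp, OF this]
  obtain w where w: "\<And>z. z \<in> Hom T C Y \<and> (\<forall>i\<in>I. z \<bullet> \<iota> i = u \<bullet> \<iota> i) \<Longrightarrow> z = w"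
    by (elim ex1E) blast
  have "u = w" using w[of u] u by simp
  moreover have "v = w" using w[of v] v eq by simp
  ultimately show ?thesis by simp
qed

lemma coproductI:
  assumes "\<And>i. i \<in> I \<Longrightarrow> \<iota> i \<in> Hom T (F i) C"
    and "\<And>Y g. (\<And>i. i \<in> I \<Longrightarrow> g i \<in> Hom T (F i) Y) \<Longrightarrow> \<exists>u\<in>Hom T C Y. \<forall>i\<in>I. u \<bullet> \<iota> i = g i"
    and "\<And>Y u v. u \<in> Hom T C Y \<Longrightarrow> v \<in> Hom T C Y \<Longrightarrow> \<forall>i\<in>I. u \<bullet> \<iota> i = v \<bullet> \<iota> i \<Longrightarrow> u = v"
  shows "is_coproduct T I F C \<iota>"
  unfolding is_coproduct_def
proof (intro conjI allI impI ballI)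
  fix Y g assume *: "\<forall>i\<in>I. g i \<in> Hom T (F i) Y"
  obtain u where u: "u \<in> Hom T C Y" "\<forall>i\<in>I. u \<bullet> \<iota> i = g i" using assms(2)[of g Y] * by auto
  show "\<exists>!u. u \<in> Hom T C Y \<and> (\<forall>i\<in>I. u \<bullet> \<iota> i = g i)"
  proof (rule ex1I)
    show "u \<in> Hom T C Y \<and> (\<forall>i\<in>I. u \<bullet> \<iota> i = g i)" using u by blast
  next
    fix v assume v: "v \<in> Hom T C Y \<and> (\<forall>i\<in>I. v \<bullet> \<iota> i = g i)"
    show "v = u" by (rule assms(3)) (use u v in simp_all)
  qed
qed (rule assms(1))

text \<open>The shift is bijective on objects and arrows, so every test object and every test arrow
  can be shifted back. This moves compactness between an object and its shift.\<close>

lemma coproduct_sh: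
  "is_coproduct T I (\<lambda>i. sh (F i)) (sh C) (\<lambda>i. sha (\<iota> i)) \<longleftrightarrow> is_coproduct T I F C \<iota>"
proof
  assume c: "is_coproduct T I F C \<iota>"
  show "is_coproduct T I (\<lambda>i. sh (F i)) (sh C) (\<lambda>i. sha (\<iota> i))"
  proof (rule coproductI)
    show "sha (\<iota> i) \<in> Hom T (sh (F i)) (sh C)" if "i \<in> I" for i
      using coproduct_leg[OF c that] by (rule shift_arr_in)
  next
    fix Y g assume g: "\<And>i. i \<in> I \<Longrightarrow> g i \<in> Hom T (sh (F i)) Y"
    obtain Y' where Y': "Y = sh Y'" using sh_surj by metis
    let ?g = "\<lambda>i. SOME k. sha k = g i"
    have eq: "sha (?g i) = g i" for i using sha_surj by (rule someI_ex)
    have "?g i \<in> Hom T (F i) Y'" if "i \<in> I" for i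
      using g[OF that] eq[of i] sha_in_iff Y' by metis
    from coproduct_desc[OF c, of ?g, OF this]
    obtain u where u: "u \<in> Hom T C Y'" "\<forall>i\<in>I. u \<bullet> \<iota> i = ?g i" by blast
    have "sha u \<bullet> sha (\<iota> i) = g i" if "i \<in> I" for i
      using shift_compose[OF coproduct_leg[OF c that] u(1)] u(2) that eq by metis
    then show "\<exists>u\<in>Hom T (sh C) Y. \<forall>i\<in>I. u \<bullet> sha (\<iota> i) = g i"
      using shift_arr_in[OF u(1)] Y' by blast
  next
    fix Y u v assume u: "u \<in> Hom T (sh C) Y" and v: "v \<in> Hom T (sh C) Y"
      and eq: "\<forall>i\<in>I. u \<bullet> sha (\<iota> i) = v \<bullet> sha (\<iota> i)"
    obtain Y' where Y': "Y = sh Y'" using sh_surj by metis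
    obtain u' where u': "u' \<in> Hom T C Y'" "u = sha u'" using u Y' sha_obtain by metis
    obtain v' where v': "v' \<in> Hom T C Y'" "v = sha v'" using v Y' sha_obtain by metis
    have "u' = v'"
    proof (rule coproduct_eq[OF c u'(1) v'(1)])
      fix i assume "i \<in> I"
      then show "u' \<bullet> \<iota> i = v' \<bullet> \<iota> i"
        using eq u' v' shift_compose[OF coproduct_leg[OF c] u'(1)]
          shift_compose[OF coproduct_leg[OF c] v'(1)] by (metis sha_eq_iff)
    qed
    then show "u = v" using u' v' by simp
  qed
next
  assume c: "is_coproduct T I (\<lambda>i. sh (F i)) (sh C) (\<lambda>i. sha (\<iota> i))"
  show "is_coproduct T I F C \<iota>"
  proof (rule coproductI)
    show leg: "\<iota> i \<in> Hom T (F i) C" if "i \<in> I" for i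
      using coproduct_leg[OF c that] by (simp add: sha_in_iff)
    fix Y g assume g: "\<And>i. i \<in> I \<Longrightarrow> g i \<in> Hom T (F i) Y"
    obtain u where u: "u \<in> Hom T (sh C) (sh Y)" "\<forall>i\<in>I. u \<bullet> sha (\<iota> i) = sha (g i)"
      using coproduct_desc[OF c, of "\<lambda>i. sha (g i)" "sh Y"] g shift_arr_in by blast
    obtain u' where u': "u' \<in> Hom T C Y" "u = sha u'" using u(1) by (rule sha_obtain)
    have "u' \<bullet> \<iota> i = g i" if "i \<in> I" for i
      using u(2) u'(2) shift_compose[OF leg[OF that] u'(1)] that sha_eq_iff by metis
    then show "\<exists>u\<in>Hom T C Y. \<forall>i\<in>I. u \<bullet> \<iota> i = g i" using u'(1) by blast
  next
    fix Y u v assume u: "u \<in> Hom T C Y" and v: "v \<in> Hom T C Y"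
      and eq: "\<forall>i\<in>I. u \<bullet> \<iota> i = v \<bullet> \<iota> i"
    have leg: "\<iota> i \<in> Hom T (F i) C" if "i \<in> I" for i
      using coproduct_leg[OF c that] by (simp add: sha_in_iff)
    have "sha u = sha v"
    proof (rule coproduct_eq[OF c shift_arr_in[OF u] shift_arr_in[OF v]])
      fix i assume "i \<in> I"
      then show "sha u \<bullet> sha (\<iota> i) = sha v \<bullet> sha (\<iota> i)"
        using eq shift_compose[OF leg u] shift_compose[OF leg v] by metis
    qed
    then show "u = v" by (simp add: sha_eq_iff)
  qed
qed

lemma coproduct_reindex: assumes "bij_betw e J I" and c: "is_coproduct T I F C \<iota>"
  shows "is_coproduct T J (\<lambda>j. F (e j)) C (\<lambda>j. \<iota> (e j))"
proof (rule coproductI)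
  have e: "e j \<in> I" if "j \<in> J" for j using assms that by (auto simp: bij_betw_def)
  show "\<iota> (e j) \<in> Hom T (F (e j)) C" if "j \<in> J" for j
    using coproduct_leg[OF c e[OF that]] .
  let ?r = "inv_into J e"
  have r: "?r i \<in> J" "e (?r i) = i" if "i \<in> I" for i
    using assms that by (auto simp: bij_betw_def inv_into_into f_inv_into_f)
  have re: "?r (e j) = j" if "j \<in> J" for j using assms that by (auto simp: bij_betw_def)
  fix Y g assume g: "\<And>j. j \<in> J \<Longrightarrow> g j \<in> Hom T (F (e j)) Y"
  have "g (?r i) \<in> Hom T (F i) Y" if "i \<in> I" for i using g[OF r(1)[OF that]] r(2)[OF that] by simp
  from coproduct_desc[OF c, of "\<lambda>i. g (?r i)", OF this]
  obtain u where "u \<in> Hom T C Y" "\<forall>i\<in>I. u \<bullet> \<iota> i = g (?r i)" by blast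
  then show "\<exists>u\<in>Hom T C Y. \<forall>j\<in>J. u \<bullet> \<iota> (e j) = g j" using e re by (intro bexI[of _ u]) auto
next
  fix Y u v assume *: "u \<in> Hom T C Y" "v \<in> Hom T C Y" "\<forall>j\<in>J. u \<bullet> \<iota> (e j) = v \<bullet> \<iota> (e j)"
  have "I = e ` J" using assms by (auto simp: bij_betw_def)
  with *(3) show "u = v" by (auto intro: coproduct_eq[OF c *(1,2)])
qed

lemma coproduct_vanish: assumes c: "is_coproduct T I F C \<iota>" and "\<And>i. i \<in> I \<Longrightarrow> hom_vanishes T (F i) Y"
  shows "hom_vanishes T C Y"
proof (rule hom_vanishesI)
  fix u assume u: "u \<in> Hom T C Y"
  show "u = arr_zero T C Y"
  proof (rule coproduct_eq[OF c u zero_in])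
    fix i assume i: "i \<in> I"
    note l = coproduct_leg[OF c i]
    show "u \<bullet> \<iota> i = arr_zero T C Y \<bullet> \<iota> i"
      using hom_vanishesD[OF assms(2)[OF i] compose_in[OF l u]] comp_zero_left[OF l] by simp
  qed
qed

end


section \<open>Triangles\<close>

context triangulated_category
begin

text \<open>\<open>triangles\<close> records arrows only; here the objects are carried along, so
  that the Hom set of each arrow can be read off.\<close>

definition tri :: "'o \<Rightarrow> 'o \<Rightarrow> 'o \<Rightarrow> 'm \<Rightarrow> 'm \<Rightarrow> 'm \<Rightarrow> bool" where
  "tri X Y Z f g h \<longleftrightarrow> (f, g, h) \<in> triangles T \<and>
     f \<in> Hom T X Y \<and> g \<in> Hom T Y Z \<and> h \<in> Hom T Z (sh X)"

lemma tri_in: assumes "tri X Y Z f g h"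
  shows "f \<in> Hom T X Y" "g \<in> Hom T Y Z" "h \<in> Hom T Z (sh X)"
  using assms by (auto simp: tri_def)

lemma triangles_tri: "(f, g, h) \<in> triangles T \<Longrightarrow>
    tri (source T f) (target T f) (target T g) f g h"
  using triangle_arrows[of f g h] by (auto simp: tri_def Hom_def)

lemma star_iff: "Z \<in> star T A B \<longleftrightarrow> (\<exists>X\<in>A. \<exists>Y\<in>B. \<exists>f g h. tri X Z Y f g h)"
  unfolding star_def using triangles_tri by (auto simp: tri_def Hom_def) blast+

lemma cone_ex: assumes "f \<in> Hom T X Y" shows "\<exists>Z g h. tri X Y Z f g h"
  using TR1_complete[of f] triangles_tri assms by (auto simp: Hom_def) blast

lemma tri_rotate: assumes "tri X Y Z f g h"
  shows "tri Y Z (sh X) g h (arr_neg T (sha f))"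
  using assms TR2[of f X Y g Z h] by (auto simp: tri_def intro: neg_in shift_arr_in)

text \<open>\<open>TR2\<close> is an equivalence, so a triangle may be rotated backwards once its
  last arrow is a negated shift. Bijectivity of the shift on arrows provides f up to the
  sign.\<close>

lemma tri_rotate_back: assumes "tri Y Z (sh X) g h k"
  obtains f where "tri X Y Z f g h" "k = arr_neg T (sha f)"
proof -
  from assms have "k \<in> Hom T (sh X) (sh Y)" by (simp add: tri_def)
  then obtain f' where f': "f' \<in> Hom T X Y" "k = sha f'" by (rule sha_obtain)
  let ?f = "arr_neg T f'"
  have k: "k = arr_neg T (sha ?f)"
    using f' sha_neg[OF neg_in[OF f'(1)]] neg_neg[OF f'(1)] by metis
  have "?f \<in> Hom T X Y" using f' by (simp add: neg_in)
  then have "tri X Y Z ?f g h" using assms TR2[of ?f X Y g Z h] k by (auto simp: tri_def)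
  then show thesis using k that by blast
qed

lemma cocone_ex: assumes "g \<in> Hom T Y Z" shows "\<exists>X f h. tri X Y Z f g h"
proof -
  obtain C h k where "tri Y Z C g h k" using cone_ex[OF assms] by blast
  moreover obtain X where "C = sh X" using sh_surj by metis
  ultimately show ?thesis using tri_rotate_back by metis
qed

lemma tri_zero_right: assumes "is_zero T Z"
  shows "tri X X Z (ident T X) (arr_zero T X Z) (arr_zero T Z (sh X))"
  using TR1_ident[OF assms] by (simp add: tri_def ident_in zero_in)

lemma tri_comp1: assumes "tri X Y Z f g h" shows "g \<bullet> f = arr_zero T X Z"
proof -
  obtain O0 where O0: "is_zero T O0" using zero_object by blast
  note t = tri_in[OF assms] and o = tri_zero_right[OF O0, of X]
  \<comment> \<open>Map the triangle X -> X -> 0 to the given one by the identity and f: the next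
    square factors g f through 0.\<close>
  have "\<exists>c\<in>Hom T O0 Z. g \<bullet> f = c \<bullet> arr_zero T X O0 \<and> h \<bullet> c = sha (ident T X) \<bullet> arr_zero T O0 (sh X)"
    using TR3[of "ident T X" "arr_zero T X O0" "arr_zero T O0 (sh X)" f g h "ident T X" f]
      o assms t by (auto simp: tri_def Hom_source ident_in compose_ident_right)
  then show ?thesis using comp_zero_right by metis
qed

lemma tri_comp2: assumes "tri X Y Z f g h" shows "h \<bullet> g = arr_zero T Y (sh X)"
  using tri_comp1[OF tri_rotate[OF assms]] .

lemma tri_comp3: assumes "tri X Y Z f g h" shows "sha f \<bullet> h = arr_zero T Z (sh Y)"
proof -
  note t = tri_in[OF assms]
  have "arr_neg T (sha f) \<bullet> h = arr_zero T Z (sh Y)" using tri_comp2[OF tri_rotate[OF assms]] .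
  then have "arr_neg T (sha f \<bullet> h) = arr_zero T Z (sh Y)"
    using comp_neg_left[OF t(3) shift_arr_in[OF t(1)]] by simp
  then show ?thesis using neg_eq_zero[OF compose_in[OF t(3) shift_arr_in[OF t(1)]]] by simp
qed

lemma TR3': assumes "tri X Y Z f g h" "tri X' Y' Z' f' g' h'" "a \<in> Hom T X X'" "b \<in> Hom T Y Y'"
    "f' \<bullet> a = b \<bullet> f"
  obtains c where "c \<in> Hom T Z Z'" "g' \<bullet> b = c \<bullet> g" "h' \<bullet> c = sha a \<bullet> h"
  using TR3[of f g h f' g' h' a b] assms that by (auto simp: tri_def Hom_source)

text \<open>\<open>TR3\<close> supplies the third arrow. Rotating both triangles turns the missing
  first arrow into a third one, at the price of a shift and of signs that cancel.\<close>

lemma TR3_first: assumes "tri X Y Z f g h" "tri X' Y' Z' f' g' h'" "b \<in> Hom T Y Y'" "c \<in> Hom T Z Z'"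
    "g' \<bullet> b = c \<bullet> g"
  obtains a where "a \<in> Hom T X X'" "f' \<bullet> a = b \<bullet> f" "h' \<bullet> c = sha a \<bullet> h"
proof -
  note t = tri_in[OF assms(1)] and t' = tri_in[OF assms(2)]
  obtain d where d: "d \<in> Hom T (sh X) (sh X')" "h' \<bullet> c = d \<bullet> h"
    "arr_neg T (sha f') \<bullet> d = sha b \<bullet> arr_neg T (sha f)"
    using TR3'[OF tri_rotate[OF assms(1)] tri_rotate[OF assms(2)] assms(3,4,5)] by blast
  obtain a where a: "a \<in> Hom T X X'" "d = sha a" using d(1) by (rule sha_obtain)
  have "arr_neg T (sha f' \<bullet> sha a) = arr_neg T (sha b \<bullet> sha f)"
    using d(3) a comp_neg_left[OF shift_arr_in[OF a(1)] shift_arr_in[OF t'(1)]]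
      comp_neg_right[OF shift_arr_in[OF t(1)] shift_arr_in[OF assms(3)]] by simp
  then have "sha f' \<bullet> sha a = sha b \<bullet> sha f"
    using neg_neg compose_in[OF shift_arr_in[OF a(1)] shift_arr_in[OF t'(1)]]
      compose_in[OF shift_arr_in[OF t(1)] shift_arr_in[OF assms(3)]] by metis
  then have "f' \<bullet> a = b \<bullet> f"
    using shift_compose[OF a(1) t'(1)] shift_compose[OF t(1) assms(3)] sha_eq_iff by metis
  then show thesis using that a d by blast
qed

text \<open>Comparing with the trivial triangle W -> W -> 0, the arrow filled in by the axiom is the
  lift of u.\<close>

lemma tri_exact2: assumes "tri X Y Z f g h" "u \<in> Hom T W Y" "g \<bullet> u = arr_zero T W Z"
  shows "\<exists>v\<in>Hom T W X. f \<bullet> v = u"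
proof -
  obtain O0 where O0: "is_zero T O0" using zero_object by blast
  note t = tri_in[OF assms(1)]
  have "g \<bullet> u = arr_zero T O0 Z \<bullet> arr_zero T W O0"
    using assms(3) comp_zero_right[OF zero_in] by simp
  with TR3_first[OF tri_zero_right[OF O0, of W] assms(1,2) zero_in] obtain v where
    "v \<in> Hom T W X" "f \<bullet> v = u \<bullet> ident T W" by blast
  then show ?thesis using compose_ident_right[OF assms(2)] by auto
qed

lemma tri_exact3: assumes "tri X Y Z f g h" "u \<in> Hom T W Z" "h \<bullet> u = arr_zero T W (sh X)"
  shows "\<exists>v\<in>Hom T W Y. g \<bullet> v = u"
  using tri_exact2[OF tri_rotate[OF assms(1)] assms(2,3)] .

lemma tri_exact4: assumes "tri X Y Z f g h" "u \<in> Hom T W (sh X)" "sha f \<bullet> u = arr_zero T W (sh Y)"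
  shows "\<exists>v\<in>Hom T W Z. h \<bullet> v = u"
proof (rule tri_exact3[OF tri_rotate[OF assms(1)] assms(2)])
  show "arr_neg T (sha f) \<bullet> u = arr_zero T W (sh Y)"
    using comp_neg_left[OF assms(2) shift_arr_in[OF tri_in(1)[OF assms(1)]]] assms(3) neg_zero by simp
qed

lemma tri_coexact2: assumes "tri X Y Z f g h" "u \<in> Hom T Y W" "u \<bullet> f = arr_zero T X W"
  shows "\<exists>v\<in>Hom T Z W. v \<bullet> g = u"
proof -
  obtain O0 where O0: "is_zero T O0" using zero_object by blast
  obtain W' where W': "W = sh W'" using sh_surj by metis
  \<comment> \<open>The dual comparison triangle 0 -> W -> W, obtained by rotating a trivial one
    backwards.\<close>
  obtain q where "tri O0 W W (arr_zero T O0 W) (ident T W) q"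
  proof -
    have "is_zero T (sh O0)" using O0 is_zero_sh by blast
    from tri_zero_right[OF this, of W] that show thesis by (metis tri_rotate_back tri_in(1) O0
        is_zero_vanish(1) hom_vanishesD)
  qed
  note o = this
  have "arr_zero T O0 W \<bullet> arr_zero T X O0 = u \<bullet> f"
    using assms(3) comp_zero_right[OF zero_in] by simp
  with TR3'[OF assms(1) o zero_in assms(2)] obtain v where
    "v \<in> Hom T Z W" "ident T W \<bullet> u = v \<bullet> g" by blast
  then show ?thesis using compose_ident_left[OF assms(2)] by auto
qed

lemma tri_coexact3: assumes "tri X Y Z f g h" "u \<in> Hom T Z W" "u \<bullet> g = arr_zero T Y W"
  shows "\<exists>v\<in>Hom T (sh X) W. v \<bullet> h = u"
  using tri_coexact2[OF tri_rotate[OF assms(1)] assms(2,3)] .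

lemma tri_coexact1: assumes "tri X Y Z f g h" "u \<in> Hom T X W" "sha u \<bullet> h = arr_zero T Z (sh W)"
  shows "\<exists>v\<in>Hom T Y W. v \<bullet> f = u"
proof -
  note t = tri_in[OF assms(1)]
  obtain v where v: "v \<in> Hom T (sh Y) (sh W)" "v \<bullet> arr_neg T (sha f) = sha u"
    using tri_coexact3[OF tri_rotate[OF assms(1)] shift_arr_in[OF assms(2)] assms(3)] by blast
  obtain w where w: "w \<in> Hom T Y W" "v = sha w" using v(1) by (rule sha_obtain)
  have "sha (arr_neg T w \<bullet> f) = sha u"
    using v(2) w comp_neg_right[OF shift_arr_in[OF t(1)] v(1)] comp_neg_left[OF t(1) w(1)]
      shift_compose[OF t(1) w(1)] sha_neg[OF compose_in[OF t(1) w(1)]] by simp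
  then show ?thesis using sha_eq_iff neg_in[OF w(1)] by blast
qed

lemma tri_vanish2: assumes "tri X Y Z f g h" "hom_vanishes T W X" "hom_vanishes T W Z"
  shows "hom_vanishes T W Y"
proof (rule hom_vanishesI)
  fix u assume u: "u \<in> Hom T W Y"
  note t = tri_in[OF assms(1)]
  obtain v where "v \<in> Hom T W X" "f \<bullet> v = u"
    using tri_exact2[OF assms(1) u] hom_vanishesD[OF assms(3) compose_in[OF u t(2)]] by blast
  then show "u = arr_zero T W Y" using comp_zero_right[OF t(1)] hom_vanishesD[OF assms(2)] by metis
qed

lemma tri_vanish3: assumes "tri X Y Z f g h" "hom_vanishes T W Y" "hom_vanishes T W (sh X)"
  shows "hom_vanishes T W Z"
  using tri_vanish2[OF tri_rotate[OF assms(1)] assms(2,3)] .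

lemma tri_vanish1: assumes "tri X Y Z f g h" "hom_vanishes T (sh W) Z" "hom_vanishes T W Y"
  shows "hom_vanishes T W X"
  using tri_vanish3[OF tri_rotate[OF assms(1)] assms(2)] assms(3) by (simp add: hom_vanishes_sh)

lemma tri_covanish2: assumes "tri X Y Z f g h" "hom_vanishes T X W" "hom_vanishes T Z W"
  shows "hom_vanishes T Y W"
proof (rule hom_vanishesI)
  fix u assume u: "u \<in> Hom T Y W"
  note t = tri_in[OF assms(1)]
  obtain v where "v \<in> Hom T Z W" "v \<bullet> g = u"
    using tri_coexact2[OF assms(1) u] hom_vanishesD[OF assms(2) compose_in[OF t(1) u]] by blast
  then show "u = arr_zero T Y W" using comp_zero_left[OF t(2)] hom_vanishesD[OF assms(3)] by metis
qed

lemma iso_arr_ident: "is_iso_arr T (ident T X)"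
  unfolding is_iso_arr_def using ident_in compose_ident_left by (metis Hom_source Hom_target)

lemma iso_arr_neg_ident: "is_iso_arr T (arr_neg T (ident T X))"
proof -
  let ?n = "arr_neg T (ident T X)"
  have n: "?n \<in> Hom T X X" by (rule neg_in[OF ident_in])
  have "?n \<bullet> ?n = ident T X"
    using comp_neg_left[OF n ident_in] compose_ident_left[OF n] neg_neg[OF ident_in] by simp
  then show ?thesis unfolding is_iso_arr_def using n by (auto simp: Hom_source Hom_target)
qed

text \<open>Three rotations shift the triangle and negate all its arrows. The isomorphism with
  components 1, -1, 1 removes the first two signs and leaves the third.\<close>

lemma tri_sh: assumes "tri X Y Z f g h"
  shows "tri (sh X) (sh Y) (sh Z) (sha f) (sha g) (arr_neg T (sha h))"
proof -
  note t = tri_in[OF assms]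
  note s = t[THEN shift_arr_in]
  have r: "tri (sh X) (sh Y) (sh Z) (arr_neg T (sha f)) (arr_neg T (sha g)) (arr_neg T (sha h))"
    using tri_rotate[OF tri_rotate[OF tri_rotate[OF assms]]] .
  let ?b = "arr_neg T (ident T (sh Y))"
  have b: "?b \<in> Hom T (sh Y) (sh Y)" by (rule neg_in[OF ident_in])
  have "sha f \<bullet> ident T (sh X) = ?b \<bullet> arr_neg T (sha f)"
    using comp_neg_left[OF neg_in[OF s(1)] ident_in] compose_ident_left[OF neg_in[OF s(1)]]
      neg_neg[OF s(1)] compose_ident_right[OF s(1)] by simp
  moreover have "sha g \<bullet> ?b = ident T (sh Z) \<bullet> arr_neg T (sha g)"
    using comp_neg_right[OF ident_in s(2)] compose_ident_right[OF s(2)]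
      compose_ident_left[OF neg_in[OF s(2)]] by simp
  moreover have "arr_neg T (sha h) \<bullet> ident T (sh Z) = sha (ident T (sh X)) \<bullet> arr_neg T (sha h)"
    using compose_ident_right[OF neg_in[OF s(3)]] compose_ident_left[OF neg_in[OF s(3)]]
    by (simp add: shift_ident)
  ultimately have "(sha f, sha g, arr_neg T (sha h)) \<in> triangles T"
    using r s neg_in[OF s(3)] b
    by (intro TR1_iso[of "arr_neg T (sha f)" "arr_neg T (sha g)" "arr_neg T (sha h)"
          "sha f" "sh X" "sh Y" "sha g" "sh Z" "arr_neg T (sha h)" "ident T (sh X)" ?b "ident T (sh Z)"])
      (auto simp: tri_def Hom_source iso_arr_ident iso_arr_neg_ident intro: ident_in)
  then show ?thesis using s neg_in[OF s(3)] by (simp add: tri_def)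
qed

lemma tri_sh_back: assumes "tri (sh X) (sh Y) (sh Z) f g h"
  shows "\<exists>f' g' h'. tri X Y Z f' g' h'"
  using assms by (metis tri_rotate_back)

lemma tri_shift: assumes "tri X Y Z f g h"
  shows "\<exists>f g h. tri (shift T n X) (shift T n Y) (shift T n Z) f g h"
proof (induction n rule: int_induct[where k = 0])
  case base show ?case using assms by (auto simp: shift_0)
next
  case (step1 i) then show ?case using tri_sh by (metis sh_shift)
next
  case (step2 i) then show ?case
    using tri_sh_back[of "shift T (i - 1) X" "shift T (i - 1) Y" "shift T (i - 1) Z"]
    by (simp add: sh_shift) blast
qed

lemma octahedral: assumes "tri X Y A f f1 f2" "tri Y Z B g g1 g2" "tri X Z C (g \<bullet> f) k1 k2"
  obtains u v w where "tri A C B u v w" "u \<bullet> f1 = k1 \<bullet> g" "k2 \<bullet> u = f2" "v \<bullet> k1 = g1"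
  "g2 \<bullet> v = sha f \<bullet> k2"
proof -
  have "\<exists>u v w. (u, v, w) \<in> triangles T \<and>
         u \<in> Hom T (source T f2) (source T k2) \<and> v \<in> Hom T (source T k2) (source T g2) \<and>
         u \<bullet> f1 = k1 \<bullet> g \<and> k2 \<bullet> u = f2 \<and>
         v \<bullet> k1 = g1 \<and> g2 \<bullet> v = sha f \<bullet> k2 \<and>
         w = sha f1 \<bullet> g2"
    by (rule TR4) (use assms in \<open>auto simp: tri_def Hom_source Hom_target\<close>)
  then obtain u v w where *: "(u, v, w) \<in> triangles T"
    "u \<in> Hom T (source T f2) (source T k2)" "v \<in> Hom T (source T k2) (source T g2)"
    "u \<bullet> f1 = k1 \<bullet> g" "k2 \<bullet> u = f2" "v \<bullet> k1 = g1" "g2 \<bullet> v = sha f \<bullet> k2" "w = sha f1 \<bullet> g2" by blast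
  have "w \<in> Hom T B (sh A)" using *(8) tri_in[OF assms(1)] tri_in[OF assms(2)]
    by (auto intro: compose_in shift_arr_in)
  then have "tri A C B u v w" using * assms by (auto simp: tri_def Hom_source)
  then show thesis using * that by blast
qed

text \<open>The octahedral axiom seen from first arrows: the cocone of a composite is an extension
  of the two cocones. The axiom speaks of their shifts, which are undone at the end.\<close>

lemma octahedral_cocone: assumes "tri A X Y a f b" "tri B Y Z c g d"
  shows "\<exists>F p q r s t. tri F X Z p (g \<bullet> f) q \<and> tri A F B r s t"
proof -
  note f = tri_in(2)[OF assms(1)] and g = tri_in(2)[OF assms(2)]
  obtain F p q where F: "tri F X Z p (g \<bullet> f) q" using cocone_ex[OF compose_in[OF f g]] by blast
  have "\<exists>u v w. tri (sh A) (sh F) (sh B) u v w"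
    by (rule octahedral[OF tri_rotate[OF assms(1)] tri_rotate[OF assms(2)] tri_rotate[OF F]]) (intro exI)
  then obtain r s t where "tri A F B r s t" using tri_sh_back by metis
  with F show ?thesis by (intro exI conjI)
qed

text \<open>As the connecting arrow is zero, the identity of B lifts to a section s of g, and f and
  s are the legs.\<close>

lemma split_direct_sum: assumes "tri A Z B f g (arr_zero T B (sh A))"
  shows "direct_sum_of T A B Z"
proof -
  let ?h = "arr_zero T B (sh A)"
  note t = tri_in[OF assms]
  obtain s where s: "s \<in> Hom T B Z" "g \<bullet> s = ident T B"
    using tri_exact3[OF assms ident_in comp_zero_left[OF ident_in]] by blast
  have "is_coproduct T (UNIV::bool set) (\<lambda>b. if b then A else B) Z (\<lambda>b. if b then f else s)"
  proof (rule coproductI)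
    fix i :: bool show "(if i then f else s) \<in> Hom T (if i then A else B) Z"
      using t s by auto
  next
    fix Y and q :: "bool \<Rightarrow> 'm"
    assume q: "\<And>i. i\<in>UNIV \<Longrightarrow> q i \<in> Hom T (if i then A else B) Y"
    then have qA: "q True \<in> Hom T A Y" and qB: "q False \<in> Hom T B Y"
      using q[of True] q[of False] by simp_all
    obtain e where e: "e \<in> Hom T Z Y" "e \<bullet> f = q True"
      using tri_coexact1[OF assms qA] comp_zero_right[OF shift_arr_in[OF qA]] by blast
    \<comment> \<open>The arrow e already has the right value on A; a correction through g changes
      only the value on B.\<close>
    let ?k = "arr_sub (q False) (e \<bullet> s)"
    have es: "e \<bullet> s \<in> Hom T B Y" using s e by (auto intro: compose_in)
    have k: "?k \<in> Hom T B Y" using qB es by (rule sub_in)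
    let ?u = "arr_add T e (?k \<bullet> g)"
    have kg: "?k \<bullet> g \<in> Hom T Z Y" using t k by (auto intro: compose_in)
    have u: "?u \<in> Hom T Z Y" using e kg by (auto intro: add_in)
    have "?u \<bullet> f = q True"
      using compose_add_left[OF t(1) e(1) kg] e(2) compose_assoc[OF t(1,2) k] tri_comp1[OF assms]
        comp_zero_right[OF k] add_zero_right[OF qA] by simp
    moreover have "?u \<bullet> s = q False"
      using compose_add_left[OF s(1) e(1) kg] compose_assoc[OF s(1) t(2) k] s(2)
        compose_ident_right[OF k] sub_add[OF qB es] add_comm[OF es k] by simp
    ultimately show "\<exists>u\<in>Hom T Z Y. \<forall>i\<in>UNIV. u \<bullet> (if i then f else s) = q i"
      using u by (intro bexI[of _ ?u]) (auto simp: all_bool_eq)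
  next
    fix Y x y
    assume x: "x \<in> Hom T Z Y" and y: "y \<in> Hom T Z Y"
      and eq: "\<forall>i\<in>UNIV. x \<bullet> (if i then f else s) = y \<bullet> (if i then f else s)"
    have eqf: "x \<bullet> f = y \<bullet> f" and eqs: "x \<bullet> s = y \<bullet> s"
      using eq by (auto dest: spec[of _ True] spec[of _ False])
    let ?d = "arr_sub x y"
    have d: "?d \<in> Hom T Z Y" using x y by (auto intro: sub_in)
    have "?d \<bullet> f = arr_zero T A Y"
      using comp_sub_left[OF t(1) x y] sub_eq_zero[OF compose_in[OF t(1) x] compose_in[OF t(1) y]] eqf
      by simp
    then obtain v where v: "v \<in> Hom T B Y" "v \<bullet> g = ?d" using tri_coexact2[OF assms d] by blast
    have "?d \<bullet> s = arr_zero T B Y"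
      using comp_sub_left[OF s(1) x y] sub_eq_zero[OF compose_in[OF s(1) x] compose_in[OF s(1) y]] eqs
      by simp
    then have "v = arr_zero T B Y"
      using v compose_assoc[OF s(1) t(2) v(1)] s(2) compose_ident_right[OF v(1)] by simp
    then have "?d = arr_zero T Z Y" using v comp_zero_left[OF t(2)] by simp
    then show "x = y" using sub_eq_zero[OF x y] by simp
  qed
  then show ?thesis unfolding direct_sum_of_def by blast
qed

section \<open>Retracts and direct summands\<close>

definition retract :: "'o \<Rightarrow> 'o \<Rightarrow> bool" where
  "retract X Y \<longleftrightarrow> (\<exists>i\<in>Hom T X Y. \<exists>p\<in>Hom T Y X. p \<bullet> i = ident T X)"

lemma direct_sum_retract: assumes "direct_sum_of T X Y C" shows "retract X C"
proof -
  obtain \<iota> where c: "is_coproduct T (UNIV :: bool set) (\<lambda>b. if b then X else Y) C \<iota>"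
    using assms unfolding direct_sum_of_def by blast
  let ?q = "\<lambda>i. if i then ident T X else arr_zero T Y X"
  have "?q i \<in> Hom T (if i then X else Y) X" for i by (simp add: ident_in zero_in)
  from coproduct_desc[OF c, of ?q X, OF this]
  obtain u where "u \<in> Hom T C X" "\<forall>i\<in>UNIV. u \<bullet> \<iota> i = ?q i" by (elim bexE)
  then have "u \<in> Hom T C X" "u \<bullet> \<iota> True = ident T X" by simp_all
  moreover have "\<iota> True \<in> Hom T X C" using coproduct_leg[OF c, of True] by simp
  ultimately show ?thesis unfolding retract_def by blast
qed

lemma retract_smd: assumes "tri K P H k p h" "h = arr_zero T H (sh K)" "P \<in> A" shows "K \<in> smd T A"
  using split_direct_sum assms unfolding smd_def by blast

lemma smd_retract: "X \<in> smd T A \<Longrightarrow> \<exists>Y\<in>A. retract X Y"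
  unfolding smd_def using direct_sum_retract by blast

lemma subset_smd: "A \<subseteq> smd T A"
proof
  fix P assume P: "P \<in> A"
  obtain O0 where O0: "is_zero T O0" using zero_object by blast
  show "P \<in> smd T A" using retract_smd[OF tri_zero_right[OF O0, of P] refl P] .
qed

lemma retract_vanish_right: assumes "retract X Y" "hom_vanishes T W Y" shows "hom_vanishes T W X"
proof (rule hom_vanishesI)
  fix u assume u: "u \<in> Hom T W X"
  obtain i p where ip: "i \<in> Hom T X Y" "p \<in> Hom T Y X" "p \<bullet> i = ident T X"
    using assms unfolding retract_def by blast
  have "u = p \<bullet> (i \<bullet> u)" using compose_assoc[OF u ip(1,2)] ip(3) compose_ident_left[OF u] by simp
  then show "u = arr_zero T W X"
    using hom_vanishesD[OF assms(2) compose_in[OF u ip(1)]] comp_zero_right[OF ip(2)] by simp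
qed

lemma retract_vanish_left: assumes "retract X Y" "hom_vanishes T Y W" shows "hom_vanishes T X W"
proof (rule hom_vanishesI)
  fix u assume u: "u \<in> Hom T X W"
  obtain i p where ip: "i \<in> Hom T X Y" "p \<in> Hom T Y X" "p \<bullet> i = ident T X"
    using assms unfolding retract_def by blast
  have "u = (u \<bullet> p) \<bullet> i" using compose_assoc[OF ip(1,2) u] ip(3) compose_ident_right[OF u] by simp
  then show "u = arr_zero T X W"
    using hom_vanishesD[OF assms(2) compose_in[OF ip(2) u]] comp_zero_left[OF ip(1)] by simp
qed

text \<open>The identity of X lifts to a section s of p. Membership in \<open>smd\<close> asks for
  an actual complement, and the cone of s is one: its connecting arrow r satisfies
  \<open>sha s \<bullet> r = 0\<close>, and \<open>sha s\<close> is split by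
  \<open>sha p\<close>.\<close>

lemma tri_split_smd: assumes "tri F X X' p t h" "t = arr_zero T X X'" "F \<in> A" shows "X \<in> smd T A"
proof -
  obtain s where s: "s \<in> Hom T X F" "p \<bullet> s = ident T X"
    using tri_exact2[OF assms(1) ident_in] assms(2) compose_ident_right[OF zero_in] by auto
  note t = tri_in[OF assms(1)]
  obtain C q r where c: "tri X F C s q r" using cone_ex[OF s(1)] by blast
  note ct = tri_in[OF c]
  have "r = arr_zero T C (sh X)"
  proof -
    have "r = sha p \<bullet> (sha s \<bullet> r)"
      using compose_assoc[OF ct(3) shift_arr_in[OF s(1)] shift_arr_in[OF t(1)]]
        shift_compose[OF s(1) t(1)] s(2) shift_ident compose_ident_left[OF ct(3)] by metis
    then show ?thesis using tri_comp3[OF c] comp_zero_right[OF shift_arr_in[OF t(1)]] by simp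
  qed
  then show ?thesis using retract_smd[OF c] assms(3) by blast
qed

end

section \<open>Compact objects\<close>

context additive_shift_category
begin

text \<open>Stands for a factorization of u through the coproduct of the finite subfamily J. Testing
  against endomorphisms avoids choosing that coproduct.\<close>

definition supported :: "'o \<Rightarrow> ('i \<Rightarrow> 'm) \<Rightarrow> 'i set \<Rightarrow> 'm \<Rightarrow> bool" where
  "supported C \<iota> J u \<longleftrightarrow> finite J \<and> (\<forall>e\<in>Hom T C C. (\<forall>i\<in>J. e \<bullet> \<iota> i = \<iota> i) \<longrightarrow> e \<bullet> u = u)"

lemma supported_zero: assumes "u = arr_zero T X C" shows "supported C \<iota> {} u"
  unfolding supported_def using assms comp_zero_right by blast

lemma supported_add: assumes "supported C \<iota> J u" "supported C \<iota> K v" "u \<in> Hom T X C" "v \<in> Hom T X C"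
  shows "supported C \<iota> (J \<union> K) (arr_add T u v)"
  using assms compose_add_right[OF assms(3,4)] unfolding supported_def by auto

lemma supported_comp: assumes "supported C \<iota> J u" "u \<in> Hom T X C" "v \<in> Hom T Y X"
  shows "supported C \<iota> J (u \<bullet> v)"
  using assms compose_assoc[OF assms(3,2)] unfolding supported_def by auto

lemma supported_leg: assumes "\<iota> i \<in> Hom T X C" "v \<in> Hom T Y X" shows "supported C \<iota> {i} (\<iota> i \<bullet> v)"
  using compose_assoc[OF assms(2,1)] unfolding supported_def by auto

lemma supported_sha: "supported (sh C) (\<lambda>i. sha (\<iota> i)) J (sha u) \<longleftrightarrow> supported C \<iota> J u"
  if leg: "\<And>i. i \<in> J \<Longrightarrow> \<iota> i \<in> Hom T (F i) C" and u: "u \<in> Hom T X C"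
proof
  assume s: "supported (sh C) (\<lambda>i. sha (\<iota> i)) J (sha u)"
  show "supported C \<iota> J u" unfolding supported_def
  proof (intro conjI ballI impI)
    fix e assume e: "e \<in> Hom T C C" "\<forall>i\<in>J. e \<bullet> \<iota> i = \<iota> i"
    then have "\<forall>i\<in>J. sha e \<bullet> sha (\<iota> i) = sha (\<iota> i)" using shift_compose[OF leg e(1)] by metis
    then have "sha e \<bullet> sha u = sha u" using s shift_arr_in[OF e(1)] unfolding supported_def by blast
    then show "e \<bullet> u = u" using shift_compose[OF u e(1)] sha_eq_iff by metis
  qed (use s in \<open>simp add: supported_def\<close>)
next
  assume s: "supported C \<iota> J u"
  show "supported (sh C) (\<lambda>i. sha (\<iota> i)) J (sha u)" unfolding supported_def
  proof (intro conjI ballI impI)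
    fix e assume e: "e \<in> Hom T (sh C) (sh C)" and eq: "\<forall>i\<in>J. e \<bullet> sha (\<iota> i) = sha (\<iota> i)"
    obtain e' where e': "e' \<in> Hom T C C" "e = sha e'" using e by (rule sha_obtain)
    then have "\<forall>i\<in>J. e' \<bullet> \<iota> i = \<iota> i" using eq shift_compose[OF leg e'(1)] sha_eq_iff by metis
    then have "e' \<bullet> u = u" using s e' unfolding supported_def by blast
    then show "e \<bullet> sha u = sha u" using shift_compose[OF u e'(1)] e' by metis
  qed (use s in \<open>simp add: supported_def\<close>)
qed

lemma coproduct_truncate: assumes "is_coproduct T I F C \<iota>"
  shows "\<exists>e\<in>Hom T C C. \<forall>i\<in>I. e \<bullet> \<iota> i = (if i \<in> J then \<iota> i else arr_zero T (F i) C)"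
  using coproduct_desc[OF assms, of "\<lambda>i. if i \<in> J then \<iota> i else arr_zero T (F i) C" C]
    coproduct_leg[OF assms] zero_in by auto

lemma coproduct_projection: assumes "is_coproduct T I F C \<iota>" "j \<in> I"
  shows "\<exists>p\<in>Hom T C (F j). p \<bullet> \<iota> j = ident T (F j) \<and> (\<forall>i\<in>I. i \<noteq> j \<longrightarrow> p \<bullet> \<iota> i = arr_zero T (F i) (F j))"
proof -
  let ?q = "\<lambda>i. if i = j then ident T (F j) else arr_zero T (F i) (F j)"
  have "?q i \<in> Hom T (F i) (F j)" for i by (simp add: ident_in zero_in)
  from coproduct_desc[OF assms(1), of ?q "F j", OF this]
  obtain u where "u \<in> Hom T C (F j)" "\<forall>i\<in>I. u \<bullet> \<iota> i = ?q i" by (elim bexE)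
  then show ?thesis using assms(2) by (intro bexI[of _ u]) auto
qed

text \<open>Let a include the finite coproduct A into C, and project C back onto A with value zero
  on the other legs. The composite fixes the legs in J, hence u.\<close>

lemma supported_factor_finite:
  assumes c: "is_coproduct T I F C \<iota>" and s: "supported C \<iota> J u" and J: "J \<subseteq> I" and u: "u \<in> Hom T X C"
  shows "\<exists>n F' A \<kappa> a b. (\<forall>k<(n::nat). F' k \<in> F ` J) \<and> is_coproduct T {..<n} F' A \<kappa> \<and>
    a \<in> Hom T A C \<and> b \<in> Hom T X A \<and> u = a \<bullet> b"
proof -
  have "finite J" using s by (simp add: supported_def)
  then obtain e n where e: "bij_betw e {..<n::nat} J"
    by (metis ex_bij_betw_nat_finite atLeast0LessThan)
  let ?F = "\<lambda>k. F (e k)"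
  obtain A \<kappa> where A: "is_coproduct T {..<n} ?F A \<kappa>" using finite_coproducts by metis
  have eJ: "e k \<in> J" if "k < n" for k using e that by (auto simp: bij_betw_def)
  then have eI: "e k \<in> I" if "k < n" for k using that J by blast
  obtain a where a: "a \<in> Hom T A C" "\<forall>k\<in>{..<n}. a \<bullet> \<kappa> k = \<iota> (e k)"
    using coproduct_desc[OF A, of "\<lambda>k. \<iota> (e k)" C] coproduct_leg[OF c] eI by auto
  let ?r = "inv_into {..<n} e"
  have r: "?r i < n" "e (?r i) = i" if "i \<in> J" for i
    using e that by (auto simp: bij_betw_def inv_into_into f_inv_into_f intro: inv_into_into[of _ e "{..<n}", simplified])
  let ?q = "\<lambda>i. if i \<in> J then \<kappa> (?r i) else arr_zero T (F i) A"
  have "?q i \<in> Hom T (F i) A" if "i \<in> I" for i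
    using coproduct_leg[OF A, of "?r i"] r[of i] zero_in by auto
  from coproduct_desc[OF c, of ?q A, OF this]
  obtain b where b: "b \<in> Hom T C A" "\<forall>i\<in>I. b \<bullet> \<iota> i = ?q i" by blast
  have ab: "a \<bullet> b \<in> Hom T C C" using b(1) a(1) by (rule compose_in)
  have "(a \<bullet> b) \<bullet> \<iota> i = \<iota> i" if i: "i \<in> J" for i
  proof -
    have "(a \<bullet> b) \<bullet> \<iota> i = a \<bullet> (b \<bullet> \<iota> i)"
      using compose_assoc[OF coproduct_leg[OF c] b(1) a(1)] i J by auto
    also have "b \<bullet> \<iota> i = \<kappa> (?r i)" using b(2) i J by auto
    also have "a \<bullet> \<kappa> (?r i) = \<iota> i" using a(2) r[OF i] by auto
    finally show ?thesis .
  qed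
  then have "(a \<bullet> b) \<bullet> u = u" using s ab unfolding supported_def by blast
  then have "u = a \<bullet> (b \<bullet> u)" using compose_assoc[OF u b(1) a(1)] by simp
  then show ?thesis using A a(1) compose_in[OF u b(1)] eJ
    by (intro exI[of _ n] exI[of _ ?F] exI[of _ A] exI[of _ \<kappa>] exI[of _ a] exI[of _ "b \<bullet> u"]) auto
qed

section \<open>Finite sums in Hom groups\<close>

lemma carrier_hom: "carrier (hom_group T X Y) = Hom T X Y"
  by (simp add: hom_group_def)

lemma one_hom: "\<one>\<^bsub>hom_group T X Y\<^esub> = arr_zero T X Y"
  by (simp add: hom_group_def)

lemma finprod_hom_in: assumes "finite S" "\<And>i. i \<in> S \<Longrightarrow> f i \<in> Hom T X Y"
  shows "finprod (hom_group T X Y) f S \<in> Hom T X Y"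
proof -
  interpret G: comm_group "hom_group T X Y" by (rule comm_group_hom)
  show ?thesis using G.finprod_closed[of f S] assms by (auto simp: hom_group_def)
qed

lemma finprod_hom_empty: "finprod (hom_group T X Y) f {} = arr_zero T X Y"
proof -
  interpret G: comm_group "hom_group T X Y" by (rule comm_group_hom)
  show ?thesis using G.finprod_empty[of f] by (simp add: hom_group_def)
qed

lemma finprod_hom_insert: assumes "finite S" "a \<notin> S" "\<And>i. i \<in> insert a S \<Longrightarrow> f i \<in> Hom T X Y"
  shows "finprod (hom_group T X Y) f (insert a S) = arr_add T (f a) (finprod (hom_group T X Y) f S)"
proof -
  interpret G: comm_group "hom_group T X Y" by (rule comm_group_hom)
  show ?thesis using G.finprod_insert[of S a f] assms by (auto simp: hom_group_def)
qed

lemma finprod_hom_proj: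
  assumes "finite S" "\<And>i. i \<in> S \<Longrightarrow> f i \<in> Hom T X Y" "p \<in> Hom T Y Z"
    "\<And>i. i \<in> S \<Longrightarrow> i \<noteq> j \<Longrightarrow> p \<bullet> f i = arr_zero T X Z"
  shows "p \<bullet> finprod (hom_group T X Y) f S = (if j \<in> S then p \<bullet> f j else arr_zero T X Z)"
  using assms(1,2,4)
proof (induction S rule: finite_induct)
  case empty
  show ?case using comp_zero_right[OF assms(3)] by (simp add: finprod_hom_empty)
next
  case (insert i S)
  have fS: "finprod (hom_group T X Y) f S \<in> Hom T X Y" using insert by (auto intro: finprod_hom_in)
  have fi: "f i \<in> Hom T X Y" using insert by simp
  have "p \<bullet> finprod (hom_group T X Y) f (insert i S) =
      arr_add T (p \<bullet> f i) (p \<bullet> finprod (hom_group T X Y) f S)"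
    using finprod_hom_insert[of S i f X Y] insert compose_add_right[OF fi fS assms(3)] by simp
  also have "p \<bullet> finprod (hom_group T X Y) f S = (if j \<in> S then p \<bullet> f j else arr_zero T X Z)"
    using insert by simp
  finally have *: "p \<bullet> finprod (hom_group T X Y) f (insert i S) =
      arr_add T (p \<bullet> f i) (if j \<in> S then p \<bullet> f j else arr_zero T X Z)" .
  show ?case
  proof (cases "i = j")
    case True
    then show ?thesis using * insert.hyps add_zero_right[OF compose_in[OF fi assms(3)]] by simp
  next
    case False
    then have "p \<bullet> f i = arr_zero T X Z" using insert.prems by simp
    moreover have "(if j \<in> S then p \<bullet> f j else arr_zero T X Z) \<in> Hom T X Z"
      using insert.prems assms(3) zero_in by (auto intro: compose_in)
    ultimately show ?thesis using * False add_zero_left by auto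
  qed
qed

text \<open>The endomorphism is the sum of \<open>\<iota> i \<bullet> p i\<close> over S. It keeps
  the legs in S and kills the others, so applied to u it returns the sum of the components of u in
  S.\<close>

lemma finprod_hom_truncate:
  assumes c: "is_coproduct T I F C \<iota>" and p: "\<And>i. i \<in> I \<Longrightarrow> p i \<in> Hom T C (F i)"
    "\<And>i. i \<in> I \<Longrightarrow> p i \<bullet> \<iota> i = ident T (F i)"
    "\<And>i k. i \<in> I \<Longrightarrow> k \<in> I \<Longrightarrow> k \<noteq> i \<Longrightarrow> p i \<bullet> \<iota> k = arr_zero T (F k) (F i)"
    and S: "finite S" "S \<subseteq> I" and u: "u \<in> Hom T X C"
  shows "\<exists>e\<in>Hom T C C. (\<forall>i\<in>I. e \<bullet> \<iota> i = (if i \<in> S then \<iota> i else arr_zero T (F i) C)) \<and>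
    e \<bullet> u = finprod (hom_group T X C) (\<lambda>i. \<iota> i \<bullet> (p i \<bullet> u)) S"
  using S
proof (induction S rule: finite_induct)
  case empty
  show ?case using coproduct_leg[OF c] comp_zero_left u
    by (intro bexI[of _ "arr_zero T C C"]) (auto simp: finprod_hom_empty zero_in)
next
  case (insert k S)
  then obtain e where e: "e \<in> Hom T C C"
    "\<forall>i\<in>I. e \<bullet> \<iota> i = (if i \<in> S then \<iota> i else arr_zero T (F i) C)"
    "e \<bullet> u = finprod (hom_group T X C) (\<lambda>i. \<iota> i \<bullet> (p i \<bullet> u)) S" by auto
  have k: "k \<in> I" using insert by simp
  note lk = coproduct_leg[OF c k]
  have ip: "\<iota> k \<bullet> p k \<in> Hom T C C" using p(1)[OF k] lk by (rule compose_in)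
  let ?e = "arr_add T (\<iota> k \<bullet> p k) e"
  have e': "?e \<in> Hom T C C" using ip e(1) by (rule add_in)
  have "?e \<bullet> u = finprod (hom_group T X C) (\<lambda>i. \<iota> i \<bullet> (p i \<bullet> u)) (insert k S)"
  proof -
    have 1: "\<iota> i \<bullet> (p i \<bullet> u) \<in> Hom T X C" if "i \<in> insert k S" for i
      using that insert.prems u coproduct_leg[OF c] p(1) by (blast intro: compose_in)
    show ?thesis
      using finprod_hom_insert[OF insert.hyps(1,2) 1] compose_add_left[OF u ip e(1)] e(3)
        compose_assoc[OF u p(1)[OF k] lk] by simp
  qed
  moreover have "?e \<bullet> \<iota> i = (if i \<in> insert k S then \<iota> i else arr_zero T (F i) C)" if i: "i \<in> I" for i
  proof -
    note li = coproduct_leg[OF c i]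
    have 1: "?e \<bullet> \<iota> i = arr_add T (\<iota> k \<bullet> (p k \<bullet> \<iota> i)) (e \<bullet> \<iota> i)"
      using compose_add_left[OF li ip e(1)] compose_assoc[OF li p(1)[OF k] lk] by simp
    show ?thesis
    proof (cases "i = k")
      case True
      then show ?thesis
        using 1 e(2) i insert.hyps(2) p(2)[OF k] compose_ident_right[OF lk] add_zero_right[OF lk] by simp
    next
      case False
      then show ?thesis
        using 1 e(2) i p(3)[OF k i] comp_zero_right[OF lk] add_zero_left[OF li]
          add_zero_left[OF zero_in] by simp
    qed
  qed
  ultimately show ?case using e' by blast
qed

end

context compactly_generated_triangulated_category
begin

section \<open>Small sets\<close>

lemma small_image: "small \<kappa> A \<Longrightarrow> small \<kappa> (f ` A)"
  unfolding small_def using card_of_image ordLeq_ordLess_trans by blast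

lemma small_subset: "small \<kappa> B \<Longrightarrow> A \<subseteq> B \<Longrightarrow> small \<kappa> A"
  unfolding small_def using card_of_mono1 ordLeq_ordLess_trans by blast

lemma small_nat: "small \<kappa> (A :: nat set)"
proof -
  have "small \<kappa> (UNIV :: nat set)"
    unfolding small_def using card_of_nat uncountable_small ordIso_ordLess_trans by blast
  then show ?thesis using small_subset by blast
qed

lemma small_int: "small \<kappa> (A :: int set)"
proof -
  have "A \<subseteq> range (\<lambda>n. if even n then int (n div 2) else - int (n div 2))"
  proof
    fix z assume "z \<in> A"
    show "z \<in> range (\<lambda>n. if even n then int (n div 2) else - int (n div 2))"
    proof (cases "0 \<le> z")
      case True then show ?thesis by (intro image_eqI[of _ _ "2 * nat z"]) auto
    next
      case False then show ?thesis by (intro image_eqI[of _ _ "2 * nat (- z) + 1"]) auto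
    qed
  qed
  then show ?thesis using small_image[OF small_nat] small_subset by blast
qed

lemma small_finite: "finite A \<Longrightarrow> small \<kappa> A"
  unfolding small_def using finite_iff_ordLess_natLeq uncountable_small ordLess_transitive by blast

lemma cinfinite_small: "cinfinite \<kappa>"
proof -
  have "\<not> finite (Field \<kappa>)"
  proof
    assume "finite (Field \<kappa>)"
    then have "(card_of (Field \<kappa>), natLeq) \<in> ordLess" using finite_iff_ordLess_natLeq by blast
    then have "(\<kappa>, natLeq) \<in> ordLess"
      using card_of_Field_ordIso[OF card_order_small] ordIso_ordLess_trans ordIso_symmetric by blast
    then show False using uncountable_small not_ordLess_ordLeq ordLess_imp_ordLeq by blast
  qed
  then show ?thesis by (simp add: cinfinite_def)
qed

text \<open>Here regularity of \<open>\<kappa>\<close> enters. It makes the set of all arrows from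
  shifts of M to a given object small.\<close>

lemma small_UN: "small \<kappa> I \<Longrightarrow> (\<And>i. i \<in> I \<Longrightarrow> small \<kappa> (A i)) \<Longrightarrow> small \<kappa> (\<Union>i\<in>I. A i)"
  unfolding small_def
  using card_of_UNION_ordLess_infinite_Field_regularCard[OF regular_small] cinfinite_small card_order_small
  by blast

text \<open>A small set injects into the field of \<open>\<kappa>\<close>. So it has a copy in the
  type that carries \<open>\<kappa>\<close>, the one type of index sets over which compactness is
  defined.\<close>

lemma small_reindex: assumes "small \<kappa> A"
  obtains J :: "'i set" and e where "small \<kappa> J" "bij_betw e J A"
proof -
  have "(card_of A, card_of (Field \<kappa>)) \<in> ordLeq"
    using assms card_of_Field_ordIso[OF card_order_small] unfolding small_def
    by (meson ordIso_symmetric ordLess_imp_ordLeq ordLess_ordIso_trans)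
  then obtain f where f: "inj_on f A" "f ` A \<subseteq> Field \<kappa>" using card_of_ordLeq by metis
  then have "bij_betw (inv_into A f) (f ` A) A" by (simp add: bij_betw_inv_into inj_on_imp_bij_betw)
  then show thesis using that small_image[OF assms] by blast
qed

lemma coproduct_ex: assumes "small \<kappa> A" shows "\<exists>C \<iota>. is_coproduct T A F C \<iota>"
proof -
  obtain J :: "'i set" and e where J: "small \<kappa> J" "bij_betw e J A" using small_reindex[OF assms] .
  obtain C \<iota> where C: "is_coproduct T J (\<lambda>j. F (e j)) C \<iota>" using small_coproducts[OF J(1)] by blast
  have b: "bij_betw (inv_into J e) A J" using J(2) by (rule bij_betw_inv_into)
  have "is_coproduct T A (\<lambda>a. F (e (inv_into J e a))) C (\<lambda>a. \<iota> (inv_into J e a))"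
    using coproduct_reindex[OF b C] .
  moreover have "F (e (inv_into J e a)) = F a" if "a \<in> A" for a
    using J(2) that by (simp add: bij_betw_def f_inv_into_f)
  ultimately have "is_coproduct T A F C (\<lambda>a. \<iota> (inv_into J e a))"
    unfolding is_coproduct_def by auto
  then show ?thesis by blast
qed

section \<open>Maps from compact objects to coproducts\<close>

text \<open>Surjectivity of the canonical map writes u as a finite sum of arrows through single
  legs, so a property closed under sums need only be checked on those.\<close>

lemma compact_induct_small:
  assumes "compact_obj \<kappa> T X" and c: "is_coproduct T (I :: 'i set) F C \<iota>" and "small \<kappa> I" and u: "u \<in> Hom T X C"
    and Q0: "Q (arr_zero T X C)"
    and Qa: "\<And>v w. v \<in> Hom T X C \<Longrightarrow> w \<in> Hom T X C \<Longrightarrow> Q v \<Longrightarrow> Q w \<Longrightarrow> Q (arr_add T v w)"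
    and Ql: "\<And>i v. i \<in> I \<Longrightarrow> v \<in> Hom T X (F i) \<Longrightarrow> Q (\<iota> i \<bullet> v)"
  shows "Q u"
proof -
  let ?G = "hom_group T X C"
  have "bij_betw (\<lambda>\<phi>. gfinprod ?G (\<lambda>i. \<iota> i \<bullet> \<phi> i) I)
      (carrier (sum_group I (\<lambda>i. hom_group T X (F i)))) (carrier ?G)"
    using assms(1,2,3) unfolding compact_obj_def iso_def by blast
  moreover have "u \<in> carrier ?G" using u by (simp add: hom_group_def)
  ultimately obtain \<phi> where \<phi>: "\<phi> \<in> carrier (sum_group I (\<lambda>i. hom_group T X (F i)))"
    "u = gfinprod ?G (\<lambda>i. \<iota> i \<bullet> \<phi> i) I"
    by (auto simp: bij_betw_def)
  have grp: "group (hom_group T X (F i))" for i using comm_group_hom by (simp add: comm_group_def)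
  have \<phi>i: "\<phi> i \<in> Hom T X (F i)" if "i \<in> I" for i
    using \<phi>(1) that by (auto simp: carrier_sum_group[OF grp] PiE_iff carrier_hom one_hom)
  have *: "Q (finprod ?G (\<lambda>i. \<iota> i \<bullet> \<phi> i) S)" if "finite S" "S \<subseteq> I" for S
    using that
  proof (induction S rule: finite_induct)
    case empty show ?case using Q0 by (simp add: finprod_hom_empty)
  next
    case (insert i S)
    have h: "\<iota> k \<bullet> \<phi> k \<in> Hom T X C" if "k \<in> insert i S" for k
      using that insert.prems \<phi>i coproduct_leg[OF c] by (blast intro: compose_in)
    have "finprod ?G (\<lambda>i. \<iota> i \<bullet> \<phi> i) (insert i S) =
        arr_add T (\<iota> i \<bullet> \<phi> i) (finprod ?G (\<lambda>i. \<iota> i \<bullet> \<phi> i) S)"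
      using finprod_hom_insert[OF insert.hyps(1,2) h] .
    moreover have "finprod ?G (\<lambda>i. \<iota> i \<bullet> \<phi> i) S \<in> Hom T X C"
      by (rule finprod_hom_in[OF insert.hyps(1)]) (rule h, simp)
    moreover have "Q (\<iota> i \<bullet> \<phi> i)" using Ql \<phi>i insert.prems by simp
    moreover have "\<iota> i \<bullet> \<phi> i \<in> Hom T X C" by (rule h) simp
    moreover have "Q (finprod ?G (\<lambda>i. \<iota> i \<bullet> \<phi> i) S)" using insert by simp
    ultimately show ?case using Qa by simp
  qed
  \<comment> \<open>\<open>gfinprod\<close> is the product over a finite support, or the unit by
    default; Q holds in either case.\<close>
  have "Q (arr_zero T X C)" by (rule Q0)
  moreover have "\<one>\<^bsub>?G\<^esub> = arr_zero T X C" by (simp add: hom_group_def)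
  ultimately show ?thesis using * \<phi>(2) by (auto simp: gfinprod_def)
qed

lemma compact_induct:
  assumes X: "compact_obj \<kappa> T X" and c: "is_coproduct T I F C \<iota>" and "small \<kappa> I" and u: "u \<in> Hom T X C"
    and Q0: "Q (arr_zero T X C)"
    and Qa: "\<And>v w. v \<in> Hom T X C \<Longrightarrow> w \<in> Hom T X C \<Longrightarrow> Q v \<Longrightarrow> Q w \<Longrightarrow> Q (arr_add T v w)"
    and Ql: "\<And>i v. i \<in> I \<Longrightarrow> v \<in> Hom T X (F i) \<Longrightarrow> Q (\<iota> i \<bullet> v)"
  shows "Q u"
proof -
  obtain J :: "'i set" and e where J: "small \<kappa> J" "bij_betw e J I" using small_reindex[OF assms(3)] .
  show ?thesis
  proof (rule compact_induct_small[OF X coproduct_reindex[OF J(2) c] J(1) u, of Q, OF Q0 Qa])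
    fix j v assume "j \<in> J" "v \<in> Hom T X (F (e j))"
    then show "Q (\<iota> (e j) \<bullet> v)" using Ql[of "e j" v] J(2) by (auto simp: bij_betw_def)
  qed
qed

lemma compact_supported:
  assumes X: "compact_obj \<kappa> T X" and c: "is_coproduct T I F C \<iota>" and "small \<kappa> I" and u: "u \<in> Hom T X C"
  shows "\<exists>J\<subseteq>I. supported C \<iota> J u"
proof (rule compact_induct[OF assms, where Q = "\<lambda>u. \<exists>J\<subseteq>I. supported C \<iota> J u"])
  show "\<exists>J\<subseteq>I. supported C \<iota> J (arr_zero T X C)" using supported_zero by blast
next
  fix v w assume vw: "v \<in> Hom T X C" "w \<in> Hom T X C"
    and "\<exists>J\<subseteq>I. supported C \<iota> J v" "\<exists>J\<subseteq>I. supported C \<iota> J w"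
  then obtain J K where "J \<subseteq> I" "K \<subseteq> I" "supported C \<iota> J v" "supported C \<iota> K w" by blast
  then show "\<exists>J\<subseteq>I. supported C \<iota> J (arr_add T v w)"
    using supported_add[OF _ _ vw] by (intro exI[of _ "J \<union> K"]) blast
next
  fix i v assume i: "i \<in> I" and v: "v \<in> Hom T X (F i)"
  show "\<exists>J\<subseteq>I. supported C \<iota> J (\<iota> i \<bullet> v)"
    using i supported_leg[of \<iota> i, OF coproduct_leg[OF c i] v] by (intro exI[of _ "{i}"]) simp
qed

text \<open>The support condition gives surjectivity of the canonical map. Injectivity holds for
  every X, because the projections of the coproduct recover all coordinates.\<close>

lemma compactI:
  assumes "\<And>(I :: 'i set) F C \<iota> u. small \<kappa> I \<Longrightarrow> is_coproduct T I F C \<iota> \<Longrightarrow> u \<in> Hom T X C \<Longrightarrow>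
    \<exists>J\<subseteq>I. supported C \<iota> J u"
  shows "compact_obj \<kappa> T X"
  unfolding compact_obj_def
proof (intro allI impI)
  fix I :: "'i set" and F C \<iota> assume I: "small \<kappa> I" and c: "is_coproduct T I F C \<iota>"
  let ?G = "hom_group T X C" and ?A = "\<lambda>i. hom_group T X (F i)"
  let ?h = "\<lambda>\<phi>. gfinprod ?G (\<lambda>i. \<iota> i \<bullet> \<phi> i) I"
  interpret G: comm_group ?G by (rule comm_group_hom)
  have grp: "group (?A i)" for i using comm_group_hom by (simp add: comm_group_def)
  have carr: "carrier ?G = Hom T X C" and one: "\<one>\<^bsub>?G\<^esub> = arr_zero T X C" by (simp_all add: hom_group_def)
  obtain p where p: "\<And>i. i \<in> I \<Longrightarrow> p i \<in> Hom T C (F i)"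
    "\<And>i. i \<in> I \<Longrightarrow> p i \<bullet> \<iota> i = ident T (F i)"
    "\<And>i k. i \<in> I \<Longrightarrow> k \<in> I \<Longrightarrow> k \<noteq> i \<Longrightarrow> p i \<bullet> \<iota> k = arr_zero T (F k) (F i)"
    using coproduct_projection[OF c] by metis
  have "(\<lambda>f. \<iota> i \<bullet> f) \<in> hom (?A i) ?G" if "i \<in> I" for i
    using coproduct_leg[OF c that] by (auto simp: hom_def hom_group_def compose_add_right intro: compose_in)
  then have hom: "?h \<in> hom (sum_group I ?A) ?G" using G.hom_group_sum[of I "\<lambda>i f. \<iota> i \<bullet> f" ?A] grp by blast
  have \<phi>i: "\<phi> i \<in> Hom T X (F i)" if "\<phi> \<in> carrier (sum_group I ?A)" "i \<in> I" for \<phi> i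
    using that by (auto simp: carrier_sum_group[OF grp] PiE_iff carrier_hom one_hom)
  have comp: "p j \<bullet> ?h \<phi> = \<phi> j" if \<phi>: "\<phi> \<in> carrier (sum_group I ?A)" and j: "j \<in> I" for \<phi> j
  proof -
    let ?S = "{i \<in> I. \<phi> i \<noteq> arr_zero T X (F i)}"
    have S: "finite ?S" using \<phi> by (simp add: carrier_sum_group[OF grp] one_hom carrier_hom)
    have h: "\<iota> i \<bullet> \<phi> i \<in> Hom T X C" if "i \<in> I" for i
      using \<phi>i[OF \<phi> that] coproduct_leg[OF c that] by (rule compose_in)
    have "?h \<phi> = gfinprod ?G (\<lambda>i. \<iota> i \<bullet> \<phi> i) ?S"
      using h comp_zero_right[OF coproduct_leg[OF c]]
      by (intro G.gfinprod_mono_neutral_cong_right) (auto simp: carr one)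
    also have "\<dots> = finprod ?G (\<lambda>i. \<iota> i \<bullet> \<phi> i) ?S"
      using S h by (intro G.gfinprod_eq_finprod) (auto simp: carr)
    finally have "p j \<bullet> ?h \<phi> = p j \<bullet> finprod ?G (\<lambda>i. \<iota> i \<bullet> \<phi> i) ?S" by simp
    also have "\<dots> = (if j \<in> ?S then p j \<bullet> (\<iota> j \<bullet> \<phi> j) else arr_zero T X (F j))"
    proof (rule finprod_hom_proj[OF S _ p(1)[OF j]])
      fix i assume i: "i \<in> ?S"
      then show "\<iota> i \<bullet> \<phi> i \<in> Hom T X C" using h by simp
      assume "i \<noteq> j"
      with i show "p j \<bullet> (\<iota> i \<bullet> \<phi> i) = arr_zero T X (F j)"
        using compose_assoc[OF \<phi>i[OF \<phi>] coproduct_leg[OF c] p(1)[OF j]] p(3)[OF j]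
          comp_zero_left[OF \<phi>i[OF \<phi>]] by auto
    qed
    also have "\<dots> = \<phi> j"
      using compose_assoc[OF \<phi>i[OF \<phi> j] coproduct_leg[OF c j] p(1)[OF j]] p(2)[OF j]
        compose_ident_left[OF \<phi>i[OF \<phi> j]] j by simp
    finally show ?thesis .
  qed
  have inj: "inj_on ?h (carrier (sum_group I ?A))"
  proof (rule inj_onI)
    fix \<phi> \<psi> assume \<phi>: "\<phi> \<in> carrier (sum_group I ?A)" and \<psi>: "\<psi> \<in> carrier (sum_group I ?A)" and "?h \<phi> = ?h \<psi>"
    then have "\<phi> j = \<psi> j" if "j \<in> I" for j using comp[OF \<phi> that] comp[OF \<psi> that] by simp
    then show "\<phi> = \<psi>" using \<phi> \<psi> by (auto simp: carrier_sum_group[OF grp] PiE_iff intro: extensionalityI)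
  qed
  have surj: "?h ` carrier (sum_group I ?A) = carrier ?G"
  proof
    show "?h ` carrier (sum_group I ?A) \<subseteq> carrier ?G" using hom by (auto simp: hom_def)
    show "carrier ?G \<subseteq> ?h ` carrier (sum_group I ?A)"
    proof
      fix u assume "u \<in> carrier ?G"
      then have u: "u \<in> Hom T X C" by (simp add: carr)
      obtain J where J: "J \<subseteq> I" "supported C \<iota> J u" using assms[OF I c u] by blast
      then have fin: "finite J" by (simp add: supported_def)
      \<comment> \<open>Keeping only the coordinates in J makes the family finitely supported. That
        they still sum up to u is the support condition applied to the truncation e.\<close>
      let ?\<phi> = "\<lambda>i\<in>I. if i \<in> J then p i \<bullet> u else arr_zero T X (F i)"
      have "finite {i \<in> I. ?\<phi> i \<noteq> arr_zero T X (F i)}" by (rule finite_subset[OF _ fin]) auto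
      then have \<phi>: "?\<phi> \<in> carrier (sum_group I ?A)"
        using p(1) u by (auto simp: carrier_sum_group[OF grp] PiE_iff carrier_hom one_hom compose_in zero_in)
      obtain e where e: "e \<in> Hom T C C" "\<forall>i\<in>I. e \<bullet> \<iota> i = (if i \<in> J then \<iota> i else arr_zero T (F i) C)"
        "e \<bullet> u = finprod ?G (\<lambda>i. \<iota> i \<bullet> (p i \<bullet> u)) J"
        using finprod_hom_truncate[OF c p fin J(1) u] by blast
      have h: "\<iota> i \<bullet> (p i \<bullet> u) \<in> Hom T X C" if "i \<in> I" for i
        using u p(1)[OF that] coproduct_leg[OF c that] by (blast intro: compose_in)
      have "\<forall>i\<in>J. e \<bullet> \<iota> i = \<iota> i" using e(2) J(1) by auto
      then have "u = finprod ?G (\<lambda>i. \<iota> i \<bullet> (p i \<bullet> u)) J"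
        using J(2) e(1,3) unfolding supported_def by metis
      also have "\<dots> = gfinprod ?G (\<lambda>i. \<iota> i \<bullet> (p i \<bullet> u)) J"
        using h J(1) fin by (intro G.gfinprod_eq_finprod[symmetric]) (auto simp: carr)
      also have "\<dots> = ?h ?\<phi>"
      proof (rule G.gfinprod_mono_neutral_cong_left[OF J(1)])
        show "\<iota> i \<bullet> ?\<phi> i = \<one>\<^bsub>?G\<^esub>" if "i \<in> I - J" for i
          using that comp_zero_right[OF coproduct_leg[OF c]] by (auto simp: one)
        show "\<iota> i \<bullet> (p i \<bullet> u) = \<iota> i \<bullet> ?\<phi> i" if "i \<in> J" for i using that J(1) by auto
        show "(\<lambda>i. \<iota> i \<bullet> ?\<phi> i) \<in> I \<rightarrow> carrier ?G"
          using h comp_zero_right[OF coproduct_leg[OF c]] by (auto simp: carr zero_in)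
      qed
      finally show "u \<in> ?h ` carrier (sum_group I ?A)" using \<phi> by blast
    qed
  qed
  show "?h \<in> iso (sum_group I ?A) ?G" using hom inj surj by (simp add: iso_def bij_betw_def)
qed

section \<open>Closure properties of compact objects\<close>

lemma compact_sh_iff: "compact_obj \<kappa> T (sh X) \<longleftrightarrow> compact_obj \<kappa> T X"
proof
  assume X: "compact_obj \<kappa> T (sh X)"
  show "compact_obj \<kappa> T X"
  proof (rule compactI)
    fix I :: "'i set" and F C \<iota> u assume I: "small \<kappa> I" and c: "is_coproduct T I F C \<iota>" and u: "u \<in> Hom T X C"
    from c have "is_coproduct T I (\<lambda>i. sh (F i)) (sh C) (\<lambda>i. sha (\<iota> i))" by (simp add: coproduct_sh)
    from compact_supported[OF X this I shift_arr_in[OF u]]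
    obtain J where J: "J \<subseteq> I" "supported (sh C) (\<lambda>i. sha (\<iota> i)) J (sha u)" by blast
    then show "\<exists>J\<subseteq>I. supported C \<iota> J u"
      using supported_sha[of J \<iota> F C u X, OF coproduct_leg[OF c] u] by blast
  qed
next
  assume X: "compact_obj \<kappa> T X"
  show "compact_obj \<kappa> T (sh X)"
  proof (rule compactI)
    fix I :: "'i set" and F C \<iota> u assume I: "small \<kappa> I" and c: "is_coproduct T I F C \<iota>" and u: "u \<in> Hom T (sh X) C"
    \<comment> \<open>Every object and every arrow is a shift, so the whole test family can be moved
      back by one.\<close>
    obtain C' where C': "C = sh C'" using sh_surj by metis
    define F' where "F' = (\<lambda>i. inv_into UNIV sh (F i))"
    have F': "F = (\<lambda>i. sh (F' i))" by (simp add: F'_def inv_sh)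
    define \<iota>' where "\<iota>' = (\<lambda>i. inv_into UNIV sha (\<iota> i))"
    have i': "\<iota> = (\<lambda>i. sha (\<iota>' i))"
      using bij_shift_arr by (simp add: \<iota>'_def bij_is_surj surj_f_inv_f)
    obtain u' where u': "u' \<in> Hom T X C'" "u = sha u'" using u C' sha_obtain by metis
    have c': "is_coproduct T I F' C' \<iota>'" using c C' F' i' by (simp add: coproduct_sh)
    from compact_supported[OF X c' I u'(1)]
    obtain J where J: "J \<subseteq> I" "supported C' \<iota>' J u'" by blast
    then show "\<exists>J\<subseteq>I. supported C \<iota> J u"
      using supported_sha[of J \<iota>' F' C' u' X, OF coproduct_leg[OF c'] u'(1)] C' i' u' by blast
  qed
qed

lemma compact_shift: "compact_obj \<kappa> T (shift T n X) \<longleftrightarrow> compact_obj \<kappa> T X"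
proof (induction n rule: int_induct[where k = 0])
  case base show ?case by (simp add: shift_0)
next
  case (step1 i) then show ?case by (simp add: shift_plus1 compact_sh_iff)
next
  case (step2 i) then show ?case using compact_sh_iff[of "shift T (i - 1) X"] by (simp add: sh_shift)
qed

lemma compact_retract: assumes "retract X Y" "compact_obj \<kappa> T Y" shows "compact_obj \<kappa> T X"
proof (rule compactI)
  fix I :: "'i set" and F C \<iota> u assume I: "small \<kappa> I" and c: "is_coproduct T I F C \<iota>" and u: "u \<in> Hom T X C"
  obtain i p where ip: "i \<in> Hom T X Y" "p \<in> Hom T Y X" "p \<bullet> i = ident T X"
    using assms unfolding retract_def by blast
  have up: "u \<bullet> p \<in> Hom T Y C" using ip u by (blast intro: compose_in)
  obtain J where J: "J \<subseteq> I" "supported C \<iota> J (u \<bullet> p)" using compact_supported[OF assms(2) c I up] by blast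
  have "(u \<bullet> p) \<bullet> i = u" using compose_assoc[OF ip(1,2) u] ip(3) compose_ident_right[OF u] by simp
  then show "\<exists>J\<subseteq>I. supported C \<iota> J u" using supported_comp[OF J(2) up ip(1)] J(1) by auto
qed

text \<open>Let e truncate C to a finite support J of u f. Then u - e u vanishes on X, so it comes
  from Z and has a finite support K there, while e u is supported on J. Hence the union of J and K
  supports u.\<close>

lemma compact_extension: assumes t: "tri X Y Z f g h" and "compact_obj \<kappa> T X" "compact_obj \<kappa> T Z"
  shows "compact_obj \<kappa> T Y"
proof (rule compactI)
  fix I :: "'i set" and F C \<iota> u assume I: "small \<kappa> I" and c: "is_coproduct T I F C \<iota>" and u: "u \<in> Hom T Y C"
  note ti = tri_in[OF t]
  have uf: "u \<bullet> f \<in> Hom T X C" using ti u by (blast intro: compose_in)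
  obtain J where J: "J \<subseteq> I" "supported C \<iota> J (u \<bullet> f)" using compact_supported[OF assms(2) c I uf] by blast
  obtain e where e: "e \<in> Hom T C C" "\<forall>i\<in>I. e \<bullet> \<iota> i = (if i \<in> J then \<iota> i else arr_zero T (F i) C)"
    using coproduct_truncate[OF c] by blast
  have "\<forall>i\<in>J. e \<bullet> \<iota> i = \<iota> i" using J(1) e(2) by auto
  then have "e \<bullet> (u \<bullet> f) = u \<bullet> f" using J(2) e(1) unfolding supported_def by blast
  then have euf: "(e \<bullet> u) \<bullet> f = u \<bullet> f" using compose_assoc[OF ti(1) u e(1)] by simp
  have eu: "e \<bullet> u \<in> Hom T Y C" using u e(1) by (rule compose_in)
  let ?d = "arr_sub u (e \<bullet> u)"
  have d: "?d \<in> Hom T Y C" using u eu by (rule sub_in)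
  have "?d \<bullet> f = arr_zero T X C"
    using comp_sub_left[OF ti(1) u eu] euf sub_eq_zero[OF uf uf] by simp
  then obtain v where v: "v \<in> Hom T Z C" "v \<bullet> g = ?d" using tri_coexact2[OF t d] by blast
  obtain K where K: "K \<subseteq> I" "supported C \<iota> K v" using compact_supported[OF assms(3) c I v(1)] by blast
  have "supported C \<iota> (J \<union> K) u" unfolding supported_def
  proof (intro conjI ballI impI)
    fix a assume a: "a \<in> Hom T C C" "\<forall>i\<in>J \<union> K. a \<bullet> \<iota> i = \<iota> i"
    have "a \<bullet> v = v" using a K unfolding supported_def by blast
    then have 1: "a \<bullet> ?d = ?d" using compose_assoc[OF ti(2) v(1) a(1)] v(2) by simp
    have ae: "a \<bullet> e = e"
    proof (rule coproduct_eq[OF c compose_in[OF e(1) a(1)] e(1)])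
      fix i assume i: "i \<in> I"
      show "(a \<bullet> e) \<bullet> \<iota> i = e \<bullet> \<iota> i"
        using compose_assoc[OF coproduct_leg[OF c i] e(1) a(1)] e(2) i a comp_zero_right[OF a(1)] by auto
    qed
    then have 2: "a \<bullet> (e \<bullet> u) = e \<bullet> u" using compose_assoc[OF u e(1) a(1)] by simp
    show "a \<bullet> u = u"
      using sub_add[OF u eu] compose_add_right[OF d eu a(1)] 1 2 by simp
  qed (use J K in \<open>simp add: supported_def\<close>)
  then show "\<exists>J\<subseteq>I. supported C \<iota> J u" using J K by blast
qed

lemma compact_cone: assumes "tri X Y Z f g h" "compact_obj \<kappa> T X" "compact_obj \<kappa> T Y" shows "compact_obj \<kappa> T Z"
  using compact_extension[OF tri_rotate[OF assms(1)]] assms compact_sh_iff by blast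

lemma compact_cocone: assumes "tri X Y Z f g h" "compact_obj \<kappa> T Y" "compact_obj \<kappa> T Z" shows "compact_obj \<kappa> T X"
  using compact_cone[OF tri_rotate[OF assms(1)]] assms compact_sh_iff by blast

lemma compact_finite_coproduct:
  assumes A: "is_coproduct T K G A \<kappa>'" "finite K" and G: "\<And>k. k \<in> K \<Longrightarrow> compact_obj \<kappa> T (G k)"
  shows "compact_obj \<kappa> T A"
proof (rule compactI)
  fix I :: "'i set" and F C \<iota> u assume I: "small \<kappa> I" and c: "is_coproduct T I F C \<iota>" and u: "u \<in> Hom T A C"
  have "\<exists>J\<subseteq>I. supported C \<iota> J (u \<bullet> \<kappa>' k)" if k: "k \<in> K" for k
    using compact_supported[OF G[OF k] c I compose_in[OF coproduct_leg[OF A(1) k] u]] .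
  then obtain J where J: "\<And>k. k \<in> K \<Longrightarrow> J k \<subseteq> I \<and> supported C \<iota> (J k) (u \<bullet> \<kappa>' k)" by metis
  have "supported C \<iota> (\<Union>k\<in>K. J k) u" unfolding supported_def
  proof (intro conjI ballI impI)
    show "finite (\<Union>k\<in>K. J k)" using A(2) J by (auto simp: supported_def)
    fix a assume a: "a \<in> Hom T C C" "\<forall>i\<in>(\<Union>k\<in>K. J k). a \<bullet> \<iota> i = \<iota> i"
    show "a \<bullet> u = u"
    proof (rule coproduct_eq[OF A(1) compose_in[OF u a(1)] u])
      fix k assume k: "k \<in> K"
      then have "a \<bullet> (u \<bullet> \<kappa>' k) = u \<bullet> \<kappa>' k" using J[OF k] a unfolding supported_def by blast
      then show "(a \<bullet> u) \<bullet> \<kappa>' k = u \<bullet> \<kappa>' k"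
        using compose_assoc[OF coproduct_leg[OF A(1) k] u a(1)] by simp
    qed
  qed
  then show "\<exists>J\<subseteq>I. supported C \<iota> J u" using J by (intro exI[of _ "\<Union>k\<in>K. J k"]) auto
qed

lemma compact_zero: assumes "is_zero T Z" shows "compact_obj \<kappa> T Z"
proof (rule compactI)
  fix I :: "'i set" and F C \<iota> u assume "u \<in> Hom T Z C"
  then have "u = arr_zero T Z C" using is_zero_vanish(1)[OF assms] by (rule hom_vanishesD[rotated])
  then show "\<exists>J\<subseteq>I. supported C \<iota> J u" using supported_zero by blast
qed

text \<open>Applied to shifts of M, this closes both the aisle and the coaisle under small
  coproducts.\<close>

lemma compact_vanish_coproduct:
  assumes X: "compact_obj \<kappa> T X" and c: "is_coproduct T I F C \<iota>" and "small \<kappa> I"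
    and v: "\<And>i. i \<in> I \<Longrightarrow> hom_vanishes T X (F i)"
  shows "hom_vanishes T X C"
proof (rule hom_vanishesI)
  fix u assume u: "u \<in> Hom T X C"
  show "u = arr_zero T X C"
  proof (rule compact_induct[OF assms(1-3) u, where Q = "\<lambda>u. u = arr_zero T X C"])
    fix i w assume "i \<in> I" "w \<in> Hom T X (F i)"
    then show "\<iota> i \<bullet> w = arr_zero T X C"
      using hom_vanishesD[OF v] comp_zero_right[OF coproduct_leg[OF c]] by metis
  qed (simp_all add: add_zero_left zero_in)
qed

end

section \<open>Aisle, coaisle and projective dimension\<close>

locale silting_setting = compactly_generated_triangulated_category \<kappa> T
  for \<kappa> :: "'i rel" and T :: "('o, 'm) tricat" +
  fixes M :: 'o
  assumes compact_silting: "compact_silting_generator \<kappa> T M"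
begin

lemma compact_M: "compact_obj \<kappa> T (shift T j M)"
  using compact_silting by (simp add: compact_silting_generator_def compact_shift)

text \<open>With the shift moved onto M, degree i of Y is seen by Hom(M[-i], Y); higher degrees
  correspond to lower shifts of M.\<close>

lemma T_le_iff: "Y \<in> T_le T M n \<longleftrightarrow> (\<forall>i>n. hom_vanishes T (shift T (- i) M) Y)"
  by (simp add: T_le_def perp_gt_def hom_vanishes_shift_right)

lemma T_ge_iff: "Y \<in> T_ge T M n \<longleftrightarrow> (\<forall>i<n. hom_vanishes T (shift T (- i) M) Y)"
  by (auto simp: T_ge_def perp_le_def hom_vanishes_shift_right)

lemma T_leD: "Y \<in> T_le T M n \<Longrightarrow> j < - n \<Longrightarrow> hom_vanishes T (shift T j M) Y"
  using T_le_iff[of Y n] by (metis minus_less_iff minus_minus)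

lemma T_geD: "Y \<in> T_ge T M n \<Longrightarrow> - n < j \<Longrightarrow> hom_vanishes T (shift T j M) Y"
  using T_ge_iff[of Y n] by (metis minus_less_iff minus_minus)

lemma T_leI: "(\<And>j. j < - n \<Longrightarrow> hom_vanishes T (shift T j M) Y) \<Longrightarrow> Y \<in> T_le T M n"
  by (simp add: T_le_iff)

lemma T_geI: "(\<And>j. - n < j \<Longrightarrow> hom_vanishes T (shift T j M) Y) \<Longrightarrow> Y \<in> T_ge T M n"
  by (simp add: T_ge_iff)

lemma T_le_mono: "Y \<in> T_le T M n \<Longrightarrow> n \<le> m \<Longrightarrow> Y \<in> T_le T M m"
  by (simp add: T_le_iff)

lemma T_ge_mono: "Y \<in> T_ge T M n \<Longrightarrow> m \<le> n \<Longrightarrow> Y \<in> T_ge T M m"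
  by (simp add: T_ge_iff)

lemma T_le_shift: "shift T k Y \<in> T_le T M n \<longleftrightarrow> Y \<in> T_le T M (n + k)"
proof -
  have *: "hom_vanishes T (shift T (- i) M) (shift T k Y) \<longleftrightarrow> hom_vanishes T (shift T (- (i + k)) M) Y" for i
    by (simp add: hom_vanishes_shift_right[of _ k] shift_shift algebra_simps)
  show ?thesis
  proof
    assume "shift T k Y \<in> T_le T M n"
    then show "Y \<in> T_le T M (n + k)"
      unfolding T_le_iff * by (metis add_less_cancel_right diff_add_cancel)
  next
    assume "Y \<in> T_le T M (n + k)"
    then show "shift T k Y \<in> T_le T M n"
      unfolding T_le_iff * by (metis add_less_cancel_right)
  qed
qed

lemma T_ge_shift: "shift T k Y \<in> T_ge T M n \<longleftrightarrow> Y \<in> T_ge T M (n + k)"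
proof -
  have *: "hom_vanishes T (shift T (- i) M) (shift T k Y) \<longleftrightarrow> hom_vanishes T (shift T (- (i + k)) M) Y" for i
    by (simp add: hom_vanishes_shift_right[of _ k] shift_shift algebra_simps)
  show ?thesis
  proof
    assume "shift T k Y \<in> T_ge T M n"
    then show "Y \<in> T_ge T M (n + k)"
      unfolding T_ge_iff * by (metis add_less_cancel_right diff_add_cancel)
  next
    assume "Y \<in> T_ge T M (n + k)"
    then show "shift T k Y \<in> T_ge T M n"
      unfolding T_ge_iff * by (metis add_less_cancel_right)
  qed
qed

lemma T_le_sh: "sh Y \<in> T_le T M n \<longleftrightarrow> Y \<in> T_le T M (n + 1)"
  using T_le_shift[of 1] by (simp add: shift_1)

lemma T_ge_sh: "sh Y \<in> T_ge T M n \<longleftrightarrow> Y \<in> T_ge T M (n + 1)"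
  using T_ge_shift[of 1] by (simp add: shift_1)

lemma T_le_extension: "tri X Y Z f g h \<Longrightarrow> X \<in> T_le T M n \<Longrightarrow> Z \<in> T_le T M n \<Longrightarrow> Y \<in> T_le T M n"
  using tri_vanish2 unfolding T_le_iff by blast

lemma T_le_cone: "tri X Y Z f g h \<Longrightarrow> X \<in> T_le T M (n + 1) \<Longrightarrow> Y \<in> T_le T M n \<Longrightarrow> Z \<in> T_le T M n"
  using T_le_extension[OF tri_rotate] by (simp add: T_le_sh)

lemma T_ge_extension: "tri X Y Z f g h \<Longrightarrow> X \<in> T_ge T M n \<Longrightarrow> Z \<in> T_ge T M n \<Longrightarrow> Y \<in> T_ge T M n"
  using tri_vanish2 unfolding T_ge_iff by blast

lemma T_ge_cone: "tri X Y Z f g h \<Longrightarrow> X \<in> T_ge T M (n + 1) \<Longrightarrow> Y \<in> T_ge T M n \<Longrightarrow> Z \<in> T_ge T M n"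
  using T_ge_extension[OF tri_rotate] by (simp add: T_ge_sh)

lemma T_ge_cocone: "tri X Y Z f g h \<Longrightarrow> Y \<in> T_ge T M n \<Longrightarrow> Z \<in> T_ge T M (n - 1) \<Longrightarrow> X \<in> T_ge T M n"
  using T_ge_cone[OF tri_rotate, of X Y Z f g h "n - 1"] by (simp add: T_ge_sh)

lemma T_le_coproduct:
  "is_coproduct T I F C \<iota> \<Longrightarrow> small \<kappa> I \<Longrightarrow> (\<And>i. i \<in> I \<Longrightarrow> F i \<in> T_le T M n) \<Longrightarrow> C \<in> T_le T M n"
  using compact_vanish_coproduct[OF compact_M, of I F C \<iota>] unfolding T_le_iff by blast

lemma T_ge_coproduct:
  "is_coproduct T I F C \<iota> \<Longrightarrow> small \<kappa> I \<Longrightarrow> (\<And>i. i \<in> I \<Longrightarrow> F i \<in> T_ge T M n) \<Longrightarrow> C \<in> T_ge T M n"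
  using compact_vanish_coproduct[OF compact_M, of I F C \<iota>] unfolding T_ge_iff by blast

lemma zero_T_le: "is_zero T Z \<Longrightarrow> Z \<in> T_le T M n"
  by (simp add: T_le_iff is_zero_vanish)

lemma t_structure_T: "t_structure T (T_le T M 0) (T_ge T M 1)"
  using compact_silting by (simp add: compact_silting_generator_def silting_def T_le_def T_ge_def)

lemma orthogonal: assumes "U \<in> T_le T M n" "V \<in> T_ge T M (n + 1)" shows "hom_vanishes T U V"
proof -
  have "shift T n U \<in> T_le T M 0" "shift T n V \<in> T_ge T M 1"
    using assms by (simp_all add: T_le_shift T_ge_shift add.commute)
  then have "hom_vanishes T (shift T n U) (shift T n V)"
    using t_structure_T unfolding t_structure_def right_perp_def by blast
  then show ?thesis by (simp add: hom_vanishes_shift)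
qed

lemma truncation: "\<exists>U\<in>T_le T M n. \<exists>V\<in>T_ge T M (n + 1). \<exists>f g h. tri U X V f g h"
proof -
  have "shift T n X \<in> star T (T_le T M 0) (T_ge T M 1)"
    using t_structure_T unfolding t_structure_def by blast
  then obtain U V f g h where U: "U \<in> T_le T M 0" "V \<in> T_ge T M 1" "tri U (shift T n X) V f g h"
    unfolding star_iff by blast
  obtain f' g' h' where "tri (shift T (- n) U) (shift T (- n) (shift T n X)) (shift T (- n) V) f' g' h'"
    using tri_shift[OF U(3)] by blast
  then have "tri (shift T (- n) U) X (shift T (- n) V) f' g' h'" by (simp add: shift_shift shift_0)
  moreover have "shift T (- n) U \<in> T_le T M n" "shift T (- n) V \<in> T_ge T M (n + 1)"
    using U by (simp_all add: T_le_shift T_ge_shift)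
  ultimately show ?thesis by blast
qed

text \<open>The aisle is the left orthogonal of the coaisle, and M has no maps to the coaisle by the
  definition of \<open>perp_le\<close>. In this way the t-structure axioms encode that M has no
  positive self-extensions.\<close>

lemma shift_M_T_le: "shift T j M \<in> T_le T M (- j)"
proof -
  have "hom_vanishes T M V" if "V \<in> T_ge T M 1" for V
    using T_geD[OF that, of 0] by (simp add: shift_0)
  then have "M \<in> T_le T M 0"
    using t_structure_T unfolding t_structure_def left_perp_def by blast
  then show ?thesis by (simp add: T_le_shift)
qed

lemma zero_if_vanishes: assumes "\<And>j. hom_vanishes T (shift T j M) X" shows "is_zero T X"
proof -
  have "generates T {M}" using compact_silting by (simp add: compact_silting_generator_def)
  moreover have "\<forall>C\<in>{M}. \<forall>i. hom_vanishes T C (shift T i X)"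
    using assms by (simp add: hom_vanishes_shift_right)
  ultimately show ?thesis unfolding generates_def by blast
qed

section \<open>Projective dimension as a vanishing condition\<close>

definition pd_le :: "int \<Rightarrow> 'o \<Rightarrow> bool" where
  "pd_le n X \<longleftrightarrow> (\<forall>U\<in>T_le T M (- n - 1). hom_vanishes T X U)"

lemma pd_leD: "pd_le n X \<Longrightarrow> U \<in> T_le T M m \<Longrightarrow> m < - n \<Longrightarrow> hom_vanishes T X U"
  unfolding pd_le_def using T_le_mono[of U m "- n - 1"] by auto

lemma pd_le_mono: "pd_le n X \<Longrightarrow> n \<le> m \<Longrightarrow> pd_le m X"
  unfolding pd_le_def by (meson T_le_mono diff_right_mono neg_le_iff_le)

lemma pd_le_shift: "pd_le n (shift T k X) \<longleftrightarrow> pd_le (n - k) X"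
proof -
  have *: "hom_vanishes T (shift T k X) U \<longleftrightarrow> hom_vanishes T X (shift T (- k) U)" for U
    by (simp add: hom_vanishes_shift_right)
  have "U \<in> T_le T M (- n - 1) \<longleftrightarrow> shift T (- k) U \<in> T_le T M (- (n - k) - 1)" for U
    by (simp add: T_le_shift)
  moreover have "\<exists>V. U = shift T (- k) V" for U
    by (rule exI[of _ "shift T k U"]) (simp add: shift_shift shift_0)
  ultimately show ?thesis unfolding pd_le_def * by metis
qed

lemma pd_le_extension: "tri X Y Z f g h \<Longrightarrow> pd_le n X \<Longrightarrow> pd_le n Z \<Longrightarrow> pd_le n Y"
  unfolding pd_le_def using tri_covanish2 by blast

lemma pd_le_sh: "pd_le n (sh X) \<longleftrightarrow> pd_le (n - 1) X"
  using pd_le_shift[of n 1 X] by (simp add: shift_1)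

lemma pd_le_cone: "tri X Y Z f g h \<Longrightarrow> pd_le n Y \<Longrightarrow> pd_le (n - 1) X \<Longrightarrow> pd_le n Z"
  using pd_le_extension[OF tri_rotate] pd_le_sh by blast

lemma pd_le_cocone: assumes "tri X Y Z f g h" "pd_le n Y" "pd_le (n + 1) Z" shows "pd_le n X"
proof -
  have "pd_le (n + 1) (sh X)"
    using pd_le_cone[OF tri_rotate[OF assms(1)], of "n + 1"] assms by simp
  then show ?thesis by (simp add: pd_le_sh)
qed

lemma pd_le_coproduct:
  "is_coproduct T I F C \<iota> \<Longrightarrow> (\<And>i. i \<in> I \<Longrightarrow> pd_le n (F i)) \<Longrightarrow> pd_le n C"
  unfolding pd_le_def using coproduct_vanish by blast

lemma pd_le_retract: "retract X Y \<Longrightarrow> pd_le n Y \<Longrightarrow> pd_le n X"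
  unfolding pd_le_def using retract_vanish_left by blast

lemma pd_le_zero: "is_zero T Z \<Longrightarrow> pd_le n Z"
  by (simp add: pd_le_def is_zero_vanish)

text \<open>The building blocks: M[j] has projective dimension at most j and lies in degrees at most
  -j, so finite extensions of shifts of M are bounded in both senses.\<close>

lemma pd_le_shift_M: "pd_le j (shift T j M)"
  unfolding pd_le_def using T_leD by auto

section \<open>Killing the maps from shifts of the generator\<close>

lemma finite_sumsI:
  assumes "\<And>i. i < n \<Longrightarrow> F i \<in> A" "is_coproduct T {..<n::nat} F C \<iota>"
  shows "C \<in> finite_sums T A"
proof -
  have "\<forall>i<n. F i \<in> A" using assms(1) by simp
  with assms(2) show ?thesis unfolding finite_sums_def by (intro CollectI exI conjI)
qed

lemma finite_sumsE:
  assumes "C \<in> finite_sums T A"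
  obtains n F \<iota> where "\<forall>i<n. F i \<in> A" "is_coproduct T {..<n::nat} F C \<iota>"
proof -
  from assms obtain n F \<iota> where "(\<forall>i<n. F i \<in> A) \<and> is_coproduct T {..<n::nat} F C \<iota>"
    unfolding finite_sums_def by (elim CollectE exE)
  then show thesis by (intro that[of n F \<iota>]) simp_all
qed

abbreviation shifts :: "int set \<Rightarrow> 'o set" where
  "shifts J \<equiv> (\<lambda>j. shift T j M) ` J"

text \<open>The arrows themselves will index the universal coproduct, with \<open>source T\<close>
  as its family.\<close>

definition arrs :: "int set \<Rightarrow> 'o \<Rightarrow> 'm set" where
  "arrs J X = (\<Union>j\<in>J. Hom T (shift T j M) X)"

lemma small_arrs: "small \<kappa> (arrs J X)"
  unfolding arrs_def by (rule small_UN[OF small_int]) (rule small_hom[OF compact_M])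

lemma arrs_Hom: "f \<in> arrs J X \<Longrightarrow> f \<in> Hom T (source T f) X"
  by (auto simp: arrs_def Hom_def)

definition kill :: "int set \<Rightarrow> 'o \<Rightarrow> 'o \<Rightarrow> 'm \<Rightarrow> bool" where
  "kill J X X' t \<longleftrightarrow> (\<exists>C \<iota> c h. is_coproduct T (arrs J X) (source T) C \<iota> \<and> tri C X X' c t h \<and>
     (\<forall>f\<in>arrs J X. c \<bullet> \<iota> f = f))"

lemma kill_ex: "\<exists>X' t. kill J X X' t"
proof -
  obtain C \<iota> where C: "is_coproduct T (arrs J X) (source T) C \<iota>"
    using coproduct_ex[OF small_arrs] by blast
  obtain c where c: "c \<in> Hom T C X" "\<forall>f\<in>arrs J X. c \<bullet> \<iota> f = f"
    using coproduct_desc[OF C, of "\<lambda>f. f" X] arrs_Hom by blast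
  obtain X' t h where "tri C X X' c t h" using cone_ex[OF c(1)] by blast
  then show ?thesis using C c unfolding kill_def by blast
qed

lemma kill_in: "kill J X X' t \<Longrightarrow> t \<in> Hom T X X'"
  unfolding kill_def by (auto simp: tri_def)

lemma kill_comp: assumes "kill J X X' t" "j \<in> J" "u \<in> Hom T (shift T j M) X"
  shows "t \<bullet> u = arr_zero T (shift T j M) X'"
proof -
  obtain C \<iota> c h where k: "is_coproduct T (arrs J X) (source T) C \<iota>" "tri C X X' c t h"
    "\<forall>f\<in>arrs J X. c \<bullet> \<iota> f = f" using assms(1) unfolding kill_def by blast
  have ua: "u \<in> arrs J X" using assms by (auto simp: arrs_def)
  have l: "\<iota> u \<in> Hom T (shift T j M) C" using coproduct_leg[OF k(1) ua] assms(3) by (simp add: Hom_source)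
  have "t \<bullet> u = (t \<bullet> c) \<bullet> \<iota> u"
    using k(3) ua compose_assoc[OF l tri_in(1,2)[OF k(2)]] by simp
  then show ?thesis using tri_comp1[OF k(2)] comp_zero_left[OF l] by simp
qed

text \<open>The arrow y lifts to the universal coproduct C, and compactness of Y confines the lift
  to finitely many summands.\<close>

lemma kill_factor: assumes "kill J X X' t" "compact_obj \<kappa> T Y" "y \<in> Hom T Y X" "t \<bullet> y = arr_zero T Y X'"
  shows "\<exists>A\<in>finite_sums T (shifts J). \<exists>a\<in>Hom T A X. \<exists>b\<in>Hom T Y A. y = a \<bullet> b"
proof -
  obtain C \<iota> c h where k: "is_coproduct T (arrs J X) (source T) C \<iota>" "tri C X X' c t h"
    using assms(1) unfolding kill_def by blast
  obtain v where v: "v \<in> Hom T Y C" "c \<bullet> v = y" using tri_exact2[OF k(2) assms(3,4)] by blast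
  obtain K where K: "K \<subseteq> arrs J X" "supported C \<iota> K v"
    using compact_supported[OF assms(2) k(1) small_arrs v(1)] by blast
  obtain n F A \<kappa>' a b where f: "\<forall>k<(n::nat). F k \<in> source T ` K" "is_coproduct T {..<n} F A \<kappa>'"
    "a \<in> Hom T A C" "b \<in> Hom T Y A" "v = a \<bullet> b"
    using supported_factor_finite[OF k(1) K(2,1) v(1)] by blast
  have KJ: "source T ` K \<subseteq> shifts J" using K(1) by (auto simp: arrs_def Hom_def)
  have A: "A \<in> finite_sums T (shifts J)"
    by (rule finite_sumsI[OF _ f(2)]) (use f(1) KJ in blast)
  have c: "c \<in> Hom T C X" using tri_in[OF k(2)] by simp
  have "y = (c \<bullet> a) \<bullet> b" using compose_assoc[OF f(4,3) c] v(2) f(5) by simp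
  then show ?thesis using A compose_in[OF f(3) c] f(4) by blast
qed

text \<open>C[1] lies in degrees at most n - 1, so a map from M[j] to X' with -j \<ge> n comes from
  X. There it is zero if -j > n, and it is killed by t if -j = n.\<close>

lemma kill_T_le: assumes "kill {- n} X X' t" "X \<in> T_le T M n" shows "X' \<in> T_le T M (n - 1)"
proof (rule T_leI)
  fix j assume j: "j < - (n - 1)"
  obtain C \<iota> c h where k: "is_coproduct T (arrs {- n} X) (source T) C \<iota>" "tri C X X' c t h"
    using assms(1) unfolding kill_def by blast
  have "source T f \<in> T_le T M n" if "f \<in> arrs {- n} X" for f
    using that shift_M_T_le[of "- n"] by (auto simp: arrs_def Hom_source)
  then have "C \<in> T_le T M n" using T_le_coproduct[OF k(1) small_arrs] by blast
  then have shC: "sh C \<in> T_le T M (n - 1)" by (simp add: T_le_sh)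
  note ti = tri_in[OF k(2)]
  show "hom_vanishes T (shift T j M) X'"
  proof (rule hom_vanishesI)
    fix u assume u: "u \<in> Hom T (shift T j M) X'"
    have "h \<bullet> u = arr_zero T (shift T j M) (sh C)"
      using hom_vanishesD[OF T_leD[OF shC j] compose_in[OF u ti(3)]] .
    then obtain v where v: "v \<in> Hom T (shift T j M) X" "t \<bullet> v = u" using tri_exact3[OF k(2) u] by blast
    show "u = arr_zero T (shift T j M) X'"
    proof (cases "j = - n")
      case True
      then show ?thesis using kill_comp[OF assms(1), of j v] v by simp
    next
      case False
      then have "j < - n" using j by simp
      then have "v = arr_zero T (shift T j M) X" using T_leD[OF assms(2)] v(1) by (blast intro: hom_vanishesD)
      then show ?thesis using v(2) comp_zero_right[OF ti(2)] by simp
    qed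
  qed
qed

section \<open>The tower of universal maps\<close>

lemma tower_ex: "\<exists>Xs ts. Xs 0 = X \<and> (\<forall>k::nat. kill (J k) (Xs k) (Xs (Suc k)) (ts k))"
proof -
  define s where "s k Y = (SOME p. kill (J k) Y (fst p) (snd p))" for k Y
  have s: "kill (J k) Y (fst (s k Y)) (snd (s k Y))" for k Y
  proof -
    obtain Y' t where "kill (J k) Y Y' t" using kill_ex by blast
    then have "kill (J k) Y (fst (Y', t)) (snd (Y', t))" by simp
    then show ?thesis unfolding s_def by (rule someI)
  qed
  let ?X = "rec_nat X (\<lambda>k Y. fst (s k Y))"
  have "kill (J k) (?X k) (?X (Suc k)) (snd (s k (?X k)))" for k using s by simp
  moreover have "?X 0 = X" by simp
  ultimately show ?thesis by (intro exI[of _ ?X] exI[of _ "\<lambda>k. snd (s k (?X k))"] conjI allI)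
qed

primrec tower_map :: "(nat \<Rightarrow> 'm) \<Rightarrow> 'o \<Rightarrow> nat \<Rightarrow> 'm" where
  "tower_map ts X 0 = ident T X"
| "tower_map ts X (Suc n) = ts n \<bullet> tower_map ts X n"

lemma tower_map_in: "(\<And>k. ts k \<in> Hom T (Xs k) (Xs (Suc k))) \<Longrightarrow> tower_map ts (Xs 0) n \<in> Hom T (Xs 0) (Xs n)"
  by (induction n) (auto intro: ident_in compose_in)

lemma finite_sums_compact: assumes "A \<in> finite_sums T (shifts J)" shows "compact_obj \<kappa> T A"
  using assms
proof (rule finite_sumsE)
  fix n F \<iota> assume F: "\<forall>i<n. F i \<in> shifts J" "is_coproduct T {..<n::nat} F A \<iota>"
  have "compact_obj \<kappa> T (F i)" if "i \<in> {..<n}" for i using F(1) that compact_M by auto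
  then show ?thesis using compact_finite_coproduct[OF F(2)] by blast
qed

text \<open>Starts at stage n with Y = X and D = 0. At each lower stage the composite from Y factors
  through a finite sum A; passing to the cocone of Y -> A makes it vanish and enlarges the cone D by
  A. So D is an extension of finite sums from the stages passed, which is recorded by an arbitrary
  extension-closed Q.\<close>

lemma tower_descent:
  assumes k: "\<And>k. kill (J k) (Xs k) (Xs (Suc k)) (ts k)"
    and X: "compact_obj \<kappa> T (Xs 0)" and z: "tower_map ts (Xs 0) n = arr_zero T (Xs 0) (Xs n)"
    and Q0: "\<And>Z. is_zero T Z \<Longrightarrow> Z \<in> Q"
    and Qe: "\<And>A Z B f g h. tri A Z B f g h \<Longrightarrow> A \<in> Q \<Longrightarrow> B \<in> Q \<Longrightarrow> Z \<in> Q"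
    and Qs: "\<And>k. m \<le> k \<Longrightarrow> k < n \<Longrightarrow> finite_sums T (shifts (J k)) \<subseteq> Q"
    and mn: "m \<le> n"
  shows "\<exists>Y y D a b. compact_obj \<kappa> T Y \<and> tri Y (Xs 0) D y a b \<and> D \<in> Q \<and>
    tower_map ts (Xs 0) m \<bullet> y = arr_zero T Y (Xs m)"
  using mn Qs
proof (induction m rule: inc_induct)
  case base
  obtain O0 where O0: "is_zero T O0" using zero_object by blast
  show ?case using tri_zero_right[OF O0, of "Xs 0"] X O0 Q0 z comp_zero_left[OF ident_in]
    by (metis)
next
  case (step m)
  have tin: "ts k \<in> Hom T (Xs k) (Xs (Suc k))" for k using k by (rule kill_in)
  note tm = tower_map_in[of ts Xs, OF tin]
  obtain Y y D a b where Y: "compact_obj \<kappa> T Y" "tri Y (Xs 0) D y a b" "D \<in> Q"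
    "tower_map ts (Xs 0) (Suc m) \<bullet> y = arr_zero T Y (Xs (Suc m))"
    using step.IH step.prems by (metis Suc_leD)
  have y: "y \<in> Hom T Y (Xs 0)" using tri_in[OF Y(2)] by simp
  have "ts m \<bullet> (tower_map ts (Xs 0) m \<bullet> y) = arr_zero T Y (Xs (Suc m))"
    using Y(4) compose_assoc[OF y tm tin] by simp
  from kill_factor[OF k Y(1) compose_in[OF y tm] this]
  obtain A p q where A: "A \<in> finite_sums T (shifts (J m))" "p \<in> Hom T A (Xs m)" "q \<in> Hom T Y A"
    "tower_map ts (Xs 0) m \<bullet> y = p \<bullet> q" by blast
  obtain Y' y' h where Y': "tri Y' Y A y' q h" using cocone_ex[OF A(3)] by blast
  have y': "y' \<in> Hom T Y' Y" using tri_in[OF Y'] by simp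
  obtain D' a' b' where D': "tri Y' (Xs 0) D' (y \<bullet> y') a' b'" using cone_ex[OF compose_in[OF y' y]] by blast
  have "\<exists>u v w. tri A D' D u v w" by (rule octahedral[OF Y' Y(2) D']) (intro exI)
  then have "D' \<in> Q" using Qe A(1) step Y(3) by blast
  moreover have "compact_obj \<kappa> T Y'" using compact_cocone[OF Y' Y(1) finite_sums_compact[OF A(1)]] .
  moreover have "tower_map ts (Xs 0) m \<bullet> (y \<bullet> y') = arr_zero T Y' (Xs m)"
    using compose_assoc[OF y' y tm] A(4) compose_assoc[OF y' A(3,2)] tri_comp1[OF Y'] comp_zero_right[OF A(2)]
    by simp
  ultimately show ?case using D' by blast
qed

lemma is_zero_cone_surj: assumes "tri X Y Z f g h" "is_zero T Z" "u \<in> Hom T W Y" shows "\<exists>v\<in>Hom T W X. f \<bullet> v = u"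
  using tri_exact2[OF assms(1,3)] hom_vanishesD[OF is_zero_vanish(2)[OF assms(2)] compose_in[OF assms(3) tri_in(2)[OF assms(1)]]]
  by blast

text \<open>On the coproduct of the tower, the shift map induces zero on all morphisms from shifts of
  \<open>M\<close>, so \<open>1 - shift\<close> is invertible; no homotopy colimit is needed.\<close>

lemma tower_vanishes:
  assumes k: "\<And>k. kill UNIV (Xs k) (Xs (Suc k)) (ts k)" and X: "compact_obj \<kappa> T (Xs 0)"
  shows "\<exists>n. tower_map ts (Xs 0) n = arr_zero T (Xs 0) (Xs n)"
proof -
  have tin: "ts k \<in> Hom T (Xs k) (Xs (Suc k))" for k using k by (rule kill_in)
  obtain C \<iota> where C: "is_coproduct T (UNIV :: nat set) Xs C \<iota>" using coproduct_ex[OF small_nat] by blast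
  have leg: "\<iota> n \<in> Hom T (Xs n) C" for n using coproduct_leg[OF C] by simp
  have "\<iota> (Suc n) \<bullet> ts n \<in> Hom T (Xs n) C" for n using tin leg by (blast intro: compose_in)
  \<comment> \<open>s sends each summand to the next one along the tower.\<close>
  then obtain s where s: "s \<in> Hom T C C" "\<And>n. s \<bullet> \<iota> n = \<iota> (Suc n) \<bullet> ts n"
    using coproduct_desc[OF C, of "\<lambda>n. \<iota> (Suc n) \<bullet> ts n" C] by auto
  have s0: "s \<bullet> u = arr_zero T (shift T j M) C" if u: "u \<in> Hom T (shift T j M) C" for j u
  proof (rule compact_induct[OF compact_M C small_nat u, where Q = "\<lambda>u. s \<bullet> u = arr_zero T (shift T j M) C"])
    show "s \<bullet> arr_zero T (shift T j M) C = arr_zero T (shift T j M) C" by (rule comp_zero_right[OF s(1)])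
  next
    fix v w assume "v \<in> Hom T (shift T j M) C" "w \<in> Hom T (shift T j M) C"
      "s \<bullet> v = arr_zero T (shift T j M) C" "s \<bullet> w = arr_zero T (shift T j M) C"
    then show "s \<bullet> arr_add T v w = arr_zero T (shift T j M) C"
      using compose_add_right[OF _ _ s(1)] add_zero_left[OF zero_in] by simp
  next
    fix n v assume v: "v \<in> Hom T (shift T j M) (Xs n)"
    have "s \<bullet> (\<iota> n \<bullet> v) = \<iota> (Suc n) \<bullet> (ts n \<bullet> v)"
      using compose_assoc[OF v leg s(1)] s(2) compose_assoc[OF v tin leg] by simp
    then show "s \<bullet> (\<iota> n \<bullet> v) = arr_zero T (shift T j M) C"
      using kill_comp[OF k _ v] comp_zero_right[OF leg] by simp
  qed
  let ?d = "arr_sub (ident T C) s"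
  have d: "?d \<in> Hom T C C" using s(1) ident_in by (rule sub_in[rotated])
  have comp_d: "?d \<bullet> u = arr_sub u (s \<bullet> u)" if "u \<in> Hom T W C" for u W
    using comp_sub_left[OF that ident_in s(1)] compose_ident_left[OF that] by simp
  have d_id: "?d \<bullet> u = u" if u: "u \<in> Hom T (shift T j M) C" for u j
    using comp_d[OF u] s0[OF u] sub_zero_right[OF u] by simp
  obtain D g h where D: "tri C C D ?d g h" using cone_ex[OF d] by blast
  note ti = tri_in[OF D]
  \<comment> \<open>D is the cone of 1 - s, which acts as the identity on maps from shifts of M.
    Hence D receives no nonzero map from these, and M generates.\<close>
  have "is_zero T D"
  proof (rule zero_if_vanishes, rule hom_vanishesI)
    fix j v assume v: "v \<in> Hom T (shift T j M) D"
    have j: "shift T j M = sh (shift T (j - 1) M)" by (simp add: sh_shift)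
    have hv: "h \<bullet> v \<in> Hom T (sh (shift T (j - 1) M)) (sh C)" using compose_in[OF v ti(3)] j by simp
    then obtain w where w: "w \<in> Hom T (shift T (j - 1) M) C" "h \<bullet> v = sha w" by (rule sha_obtain)
    have "sha ?d \<bullet> (h \<bullet> v) = arr_zero T (shift T j M) (sh C)"
      using compose_assoc[OF v ti(3) shift_arr_in[OF d]] tri_comp3[OF D] comp_zero_left[OF v] by simp
    then have "sha (?d \<bullet> w) = arr_zero T (shift T j M) (sh C)"
      using w shift_compose[OF w(1) d] by simp
    then have "h \<bullet> v = arr_zero T (shift T j M) (sh C)" using d_id[OF w(1)] w(2) by simp
    then obtain x where x: "x \<in> Hom T (shift T j M) C" "g \<bullet> x = v" using tri_exact3[OF D v] by blast
    have "v = (g \<bullet> ?d) \<bullet> x" using x d_id[OF x(1)] compose_assoc[OF x(1) d ti(2)] by simp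
    then show "v = arr_zero T (shift T j M) D" using tri_comp1[OF D] comp_zero_left[OF x(1)] by simp
  qed
  \<comment> \<open>Solve x - s x = \<open>\<iota> 0\<close>. Comparing coordinates gives x_0 = 1
    and x_(n+1) = t_n x_n, so the coordinates of x are the composites along the tower.\<close>
  then obtain x where x: "x \<in> Hom T (Xs 0) C" "?d \<bullet> x = \<iota> 0" using is_zero_cone_surj[OF D _ leg] by blast
  have "\<exists>p. p \<in> Hom T C (Xs j) \<and> p \<bullet> \<iota> j = ident T (Xs j) \<and> (\<forall>i. i \<noteq> j \<longrightarrow> p \<bullet> \<iota> i = arr_zero T (Xs i) (Xs j))" for j
    using coproduct_projection[OF C, of j] by auto
  then obtain p where p: "\<And>j. p j \<in> Hom T C (Xs j)" "\<And>j. p j \<bullet> \<iota> j = ident T (Xs j)"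
    "\<And>i j. i \<noteq> j \<Longrightarrow> p j \<bullet> \<iota> i = arr_zero T (Xs i) (Xs j)" by metis
  have px: "p n \<bullet> x \<in> Hom T (Xs 0) (Xs n)" for n using x(1) p(1) by (rule compose_in)
  have sx: "s \<bullet> x \<in> Hom T (Xs 0) C" using x(1) s(1) by (rule compose_in)
  have xs: "arr_sub x (s \<bullet> x) = \<iota> 0" using x comp_d[OF x(1)] by simp
  have rec: "arr_sub (p n \<bullet> x) (p n \<bullet> (s \<bullet> x)) = p n \<bullet> \<iota> 0" for n
    using comp_sub_right[OF x(1) sx p(1)[of n]] xs by simp
  have psi: "(p j \<bullet> s) \<bullet> \<iota> i = (p j \<bullet> \<iota> (Suc i)) \<bullet> ts i" for i j
  proof -
    have "(p j \<bullet> s) \<bullet> \<iota> i = p j \<bullet> (s \<bullet> \<iota> i)" by (rule compose_assoc[OF leg s(1) p(1), symmetric])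
    also have "\<dots> = p j \<bullet> (\<iota> (Suc i) \<bullet> ts i)" by (simp only: s(2))
    also have "\<dots> = (p j \<bullet> \<iota> (Suc i)) \<bullet> ts i" by (rule compose_assoc[OF tin leg p(1)])
    finally show ?thesis .
  qed
  have ps0: "p 0 \<bullet> s = arr_zero T C (Xs 0)"
  proof (rule coproduct_eq[OF C compose_in[OF s(1) p(1)] zero_in])
    fix i
    show "(p 0 \<bullet> s) \<bullet> \<iota> i = arr_zero T C (Xs 0) \<bullet> \<iota> i"
      by (simp add: psi p(3) comp_zero_left[OF tin] comp_zero_left[OF leg])
  qed
  have psS: "p (Suc n) \<bullet> s = ts n \<bullet> p n" for n
  proof (rule coproduct_eq[OF C compose_in[OF s(1) p(1)] compose_in[OF p(1) tin]])
    fix i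
    show "(p (Suc n) \<bullet> s) \<bullet> \<iota> i = (ts n \<bullet> p n) \<bullet> \<iota> i"
    proof (cases "i = n")
      case True
      then show ?thesis
        by (simp add: psi p(2) compose_assoc[OF leg p(1) tin, symmetric]
            compose_ident_left[OF tin] compose_ident_right[OF tin])
    next
      case False
      then show ?thesis
        by (simp add: psi p(3) compose_assoc[OF leg p(1) tin, symmetric]
            comp_zero_left[OF tin] comp_zero_right[OF tin])
    qed
  qed
  have eq: "p n \<bullet> x = tower_map ts (Xs 0) n" for n
  proof (induction n)
    case 0
    have "p 0 \<bullet> (s \<bullet> x) = arr_zero T (Xs 0) (Xs 0)"
      using compose_assoc[OF x(1) s(1) p(1)] ps0 comp_zero_left[OF x(1)] by simp
    then show ?case using rec[of 0] p(2) sub_zero_right[OF px] by simp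
  next
    case (Suc n)
    have 1: "p (Suc n) \<bullet> (s \<bullet> x) = ts n \<bullet> (p n \<bullet> x)"
      using compose_assoc[OF x(1) s(1) p(1)] psS compose_assoc[OF x(1) p(1) tin] by simp
    have "p (Suc n) \<bullet> x = p (Suc n) \<bullet> (s \<bullet> x)"
      using rec[of "Suc n"] p(3)[of 0 "Suc n"] sub_eq_zero[OF px compose_in[OF sx p(1)]] by simp
    then show ?case using 1 Suc by simp
  qed
  \<comment> \<open>A map from a compact object to a coproduct has only finitely many nonzero
    coordinates.\<close>
  have "\<exists>N. \<forall>n\<ge>N. p n \<bullet> x = arr_zero T (Xs 0) (Xs n)"
  proof (rule compact_induct[OF X C small_nat x(1), where Q = "\<lambda>u. \<exists>N. \<forall>n\<ge>N. p n \<bullet> u = arr_zero T (Xs 0) (Xs n)"])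
    show "\<exists>N. \<forall>n\<ge>N. p n \<bullet> arr_zero T (Xs 0) C = arr_zero T (Xs 0) (Xs n)" using comp_zero_right[OF p(1)] by blast
  next
    fix v w assume vw: "v \<in> Hom T (Xs 0) C" "w \<in> Hom T (Xs 0) C"
      and "\<exists>N. \<forall>n\<ge>N. p n \<bullet> v = arr_zero T (Xs 0) (Xs n)" "\<exists>N. \<forall>n\<ge>N. p n \<bullet> w = arr_zero T (Xs 0) (Xs n)"
    then obtain N N' where "\<forall>n\<ge>N. p n \<bullet> v = arr_zero T (Xs 0) (Xs n)" "\<forall>n\<ge>N'. p n \<bullet> w = arr_zero T (Xs 0) (Xs n)" by blast
    then show "\<exists>N. \<forall>n\<ge>N. p n \<bullet> arr_add T v w = arr_zero T (Xs 0) (Xs n)"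
      using compose_add_right[OF vw p(1)] add_zero_left[OF zero_in] by (intro exI[of _ "max N N'"]) simp
  next
    fix i v assume v: "v \<in> Hom T (Xs 0) (Xs i)"
    have "p n \<bullet> (\<iota> i \<bullet> v) = arr_zero T (Xs 0) (Xs n)" if "n \<ge> Suc i" for n
      using compose_assoc[OF v leg p(1)] p(3)[of i n] that comp_zero_left[OF v] by simp
    then show "\<exists>N. \<forall>n\<ge>N. p n \<bullet> (\<iota> i \<bullet> v) = arr_zero T (Xs 0) (Xs n)" by blast
  qed
  then show ?thesis using eq by auto
qed

section \<open>Boundedness of compact objects\<close>

lemma finite_sums_bounded: assumes "A \<in> finite_sums T (shifts J)"
  shows "\<exists>N. A \<in> T_le T M N \<and> pd_le N A"
proof -
  obtain n F \<iota> where A: "\<forall>i<n. F i \<in> shifts J" "is_coproduct T {..<n::nat} F A \<iota>"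
    using assms by (rule finite_sumsE)
  have "\<forall>i. \<exists>j. i < n \<longrightarrow> F i = shift T j M" using A(1) by blast
  then obtain j where j: "\<And>i. i < n \<Longrightarrow> F i = shift T (j i) M" by metis
  \<comment> \<open>The sum of absolute values dominates every \<open>j i\<close> and
    \<open>- j i\<close>, hence the projective dimensions and the degrees of all summands at
    once.\<close>
  have b: "\<bar>j i\<bar> \<le> (\<Sum>i<n. \<bar>j i\<bar>)" if "i < n" for i
    using that by (intro member_le_sum) auto
  let ?N = "\<Sum>i<n. \<bar>j i\<bar>"
  have "F i \<in> T_le T M ?N" "pd_le ?N (F i)" if "i < n" for i
    using j[OF that] b[OF that] shift_M_T_le[of "j i"] pd_le_shift_M[of "j i"] T_le_mono[of "F i" "- j i" ?N]
      pd_le_mono[of "j i" "F i" ?N] by auto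
  then have "A \<in> T_le T M ?N" "pd_le ?N A"
    using T_le_coproduct[OF A(2) small_finite] pd_le_coproduct[OF A(2)] by auto
  then show ?thesis by blast
qed

lemma compact_bounded: assumes X: "compact_obj \<kappa> T X" shows "\<exists>N. X \<in> T_le T M N \<and> pd_le N X"
proof -
  obtain Xs ts where Xs: "Xs 0 = X" "\<And>k::nat. kill UNIV (Xs k) (Xs (Suc k)) (ts k)"
    using tower_ex[of X "\<lambda>k. UNIV"] by blast
  obtain n where n: "tower_map ts (Xs 0) n = arr_zero T (Xs 0) (Xs n)"
    using tower_vanishes[of Xs ts] Xs X by blast
  let ?Q = "{D. \<exists>N. D \<in> T_le T M N \<and> pd_le N D}"
  have "\<exists>Y y D a b. compact_obj \<kappa> T Y \<and> tri Y (Xs 0) D y a b \<and> D \<in> ?Q \<and>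
    tower_map ts (Xs 0) 0 \<bullet> y = arr_zero T Y (Xs 0)"
  proof (rule tower_descent[OF Xs(2) _ n])
    show "compact_obj \<kappa> T (Xs 0)" using X Xs(1) by simp
    show "Z \<in> ?Q" if "is_zero T Z" for Z using that zero_T_le pd_le_zero by blast
    show "Z \<in> ?Q" if t: "tri A Z B f g h" and "A \<in> ?Q" "B \<in> ?Q" for A Z B f g h
    proof -
      obtain N N' where "A \<in> T_le T M N" "pd_le N A" "B \<in> T_le T M N'" "pd_le N' B" using \<open>A \<in> ?Q\<close> \<open>B \<in> ?Q\<close> by blast
      then show ?thesis
        using T_le_extension[OF t, of "max N N'"] pd_le_extension[OF t, of "max N N'"]
          T_le_mono[of _ _ "max N N'"] pd_le_mono[of _ _ "max N N'"] by (intro CollectI exI[of _ "max N N'"]) simp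
    qed
    show "finite_sums T (shifts UNIV) \<subseteq> ?Q" using finite_sums_bounded by blast
  qed simp
  then obtain Y y D a b where "tri Y (Xs 0) D y a b" "D \<in> ?Q" "tower_map ts (Xs 0) 0 \<bullet> y = arr_zero T Y (Xs 0)"
    by (elim exE conjE)
  then have D: "tri Y X D y a b" "D \<in> ?Q" "ident T X \<bullet> y = arr_zero T Y X" using Xs(1) by simp_all
  \<comment> \<open>At stage 0 the composite along the tower is the identity, so y is zero and X
    splits off D.\<close>
  obtain v where "v \<in> Hom T D X" "v \<bullet> a = ident T X" using tri_coexact2[OF D(1) ident_in D(3)] by blast
  then have "retract X D" using tri_in[OF D(1)] unfolding retract_def by blast
  then show ?thesis using D(2) pd_le_retract retract_vanish_right unfolding T_le_iff by blast
qed

text \<open>Running the tower one degree at a time and descending to stage \<open>1\<close> shows that the top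
  cohomology of a compact object is finitely generated.\<close>

lemma top_cover:
  assumes X: "compact_obj \<kappa> T X" and Xb: "X \<in> T_le T M b"
  shows "\<exists>A\<in>finite_sums T {shift T (- b) M}. \<exists>X' a t h. tri A X X' a t h \<and> compact_obj \<kappa> T X' \<and> X' \<in> T_le T M (b - 1)"
proof -
  obtain Xs ts where Xs: "Xs 0 = X" "\<And>k::nat. kill {- (b - int k)} (Xs k) (Xs (Suc k)) (ts k)"
    using tower_ex[of X "\<lambda>k. {- (b - int k)}"] by blast
  have le: "Xs k \<in> T_le T M (b - int k)" for k
  proof (induction k)
    case (Suc k)
    then show ?case using kill_T_le[OF Xs(2)] by (simp add: algebra_simps)
  qed (simp add: Xs Xb)
  have tin: "ts k \<in> Hom T (Xs k) (Xs (Suc k))" for k using Xs(2) by (rule kill_in)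
  obtain N where N: "pd_le N X" using compact_bounded[OF X] by blast
  \<comment> \<open>Stage n lies in degrees at most b - n < -N, where an object of projective
    dimension at most N has no maps to it; so the composite vanishes. The maximum with 1 allows the
    descent to stop at stage 1.\<close>
  define n where "n = nat (max 1 (b + N + 1))"
  have "1 \<le> n" "b - int n < - N" by (auto simp: n_def)
  have n: "tower_map ts (Xs 0) n = arr_zero T (Xs 0) (Xs n)"
    using pd_leD[OF N le \<open>b - int n < - N\<close>] tower_map_in[of ts Xs n, OF tin] Xs(1) by (simp add: hom_vanishesD)
  have fs: "finite_sums T (shifts {- c}) \<subseteq> T_le T M c" for c
  proof
    fix A assume "A \<in> finite_sums T (shifts {- c})"
    then obtain n F \<iota> where A: "\<forall>i<n. F i \<in> shifts {- c}" "is_coproduct T {..<n::nat} F A \<iota>"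
      by (rule finite_sumsE)
    then show "A \<in> T_le T M c" using T_le_coproduct[OF A(2) small_finite] shift_M_T_le[of "- c"] by simp
  qed
  have "\<exists>Y y D a b'. compact_obj \<kappa> T Y \<and> tri Y (Xs 0) D y a b' \<and> D \<in> T_le T M (b - 1) \<and>
    tower_map ts (Xs 0) 1 \<bullet> y = arr_zero T Y (Xs 1)"
  proof (rule tower_descent[OF Xs(2) _ n])
    show "compact_obj \<kappa> T (Xs 0)" using X Xs(1) by simp
    show "Z \<in> T_le T M (b - 1)" if "is_zero T Z" for Z using that by (rule zero_T_le)
    show "Z \<in> T_le T M (b - 1)" if "tri A Z B f g h" "A \<in> T_le T M (b - 1)" "B \<in> T_le T M (b - 1)" for A Z B f g h
      using that by (rule T_le_extension)
    show "finite_sums T (shifts {- (b - int k)}) \<subseteq> T_le T M (b - 1)" if "1 \<le> k" for k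
      using fs[of "b - int k"] T_le_mono[of _ "b - int k" "b - 1"] that by (auto simp del: image_insert)
  qed (fact \<open>1 \<le> n\<close>)
  \<comment> \<open>Stopping at stage 1 leaves out the first layer. Only sums of M[-b+k] with k
    \<ge> 1 enter D, so D has nothing in degree b.\<close>
  then obtain Y y D r q where Y: "compact_obj \<kappa> T Y" "tri Y X D y r q" "D \<in> T_le T M (b - 1)"
    "tower_map ts X 1 \<bullet> y = arr_zero T Y (Xs 1)" using Xs(1) by auto
  note Yi = tri_in[OF Y(2)]
  have t0: "ts 0 \<in> Hom T X (Xs 1)" using tin[of 0] Xs(1) by simp
  have ty: "ts 0 \<bullet> y = arr_zero T Y (Xs 1)" using Y(4) compose_ident_right[OF t0] by simp
  have "kill {- b} X (Xs 1) (ts 0)" using Xs(2)[of 0] Xs(1) by simp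
  from kill_factor[OF this Y(1) Yi(1) ty] obtain A a c where A: "A \<in> finite_sums T (shifts {- b})" "a \<in> Hom T A X" "c \<in> Hom T Y A" "y = a \<bullet> c"
    by blast
  obtain X' t h where X': "tri A X X' a t h" using cone_ex[OF A(2)] by blast
  note Xi = tri_in[OF X']
  have "A \<in> T_le T M b" using A(1) fs by blast
  then have shA: "sh A \<in> T_le T M (b - 1)" by (simp add: T_le_sh)
  have "X' \<in> T_le T M (b - 1)"
  proof (rule T_leI, rule hom_vanishesI)
    fix j u assume j: "j < - (b - 1)" and u: "u \<in> Hom T (shift T j M) X'"
    have "h \<bullet> u = arr_zero T (shift T j M) (sh A)"
      using hom_vanishesD[OF T_leD[OF shA j] compose_in[OF u Xi(3)]] .
    then obtain v where v: "v \<in> Hom T (shift T j M) X" "t \<bullet> v = u" using tri_exact3[OF X' u] by blast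
    \<comment> \<open>D vanishes in degrees \<ge> b, so v lifts to Y and therefore factors through
      a. Thus the finite sum A already covers what the universal coproduct covers.\<close>
    have "r \<bullet> v = arr_zero T (shift T j M) D"
      using hom_vanishesD[OF T_leD[OF Y(3) j] compose_in[OF v(1) Yi(2)]] .
    then obtain w where w: "w \<in> Hom T (shift T j M) Y" "y \<bullet> w = v" using tri_exact2[OF Y(2) v(1)] by blast
    have cw: "c \<bullet> w \<in> Hom T (shift T j M) A" using w(1) A(3) by (rule compose_in)
    have "u = (t \<bullet> a) \<bullet> (c \<bullet> w)"
      using v(2) w(2) A(4) compose_assoc[OF w(1) A(3,2)] compose_assoc[OF cw A(2) Xi(2)] by simp
    then show "u = arr_zero T (shift T j M) X'" using tri_comp1[OF X'] comp_zero_left[OF cw] by simp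
  qed
  moreover have "compact_obj \<kappa> T X'" using compact_cone[OF X' finite_sums_compact[OF A(1)] X] .
  moreover have "A \<in> finite_sums T {shift T (- b) M}" using A(1) by simp
  ultimately show ?thesis using X' by blast
qed

end

section \<open>The dimensions in terms of vanishing\<close>

context silting_setting
begin

text \<open>The truncation is a choice, so only its defining triangle can be used. For X in the
  aisle it changes nothing in degree 0, and it leaves no other degree.\<close>

lemma is_zero_trunc_ge:
  assumes X: "X \<in> T_le T M 0"
  shows "is_zero T (trunc_ge T M 0 X) \<longleftrightarrow> hom_vanishes T M X"
proof -
  let ?P = "\<lambda>V. V \<in> T_ge T M 0 \<and> (\<exists>f g h. (f, g, h) \<in> triangles T \<and> source T f \<in> T_le T M (0 - 1) \<and>
     target T f = X \<and> target T g = V)"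
  have "\<exists>V. ?P V"
    using truncation[of "- 1" X] by (auto simp: tri_def Hom_def)
  then have "?P (trunc_ge T M 0 X)" unfolding trunc_ge_def by (rule someI_ex)
  then obtain U f g h where V: "trunc_ge T M 0 X \<in> T_ge T M 0" "U \<in> T_le T M (- 1)"
    and t: "tri U X (trunc_ge T M 0 X) f g h"
    using triangles_tri by fastforce
  let ?V = "trunc_ge T M 0 X"
  have M0: "shift T 0 M = M" by (simp add: shift_0)
  have shU: "sh U \<in> T_le T M (- 1)" using V(2) T_le_mono by (auto simp: T_le_sh)
  show ?thesis
  proof
    assume "is_zero T ?V"
    then show "hom_vanishes T M X"
      using tri_vanish2[OF t] T_leD[OF V(2), of 0] is_zero_vanish(2) M0 by simp
  next
    assume "hom_vanishes T M X"
    then have 0: "hom_vanishes T M ?V" using tri_vanish3[OF t] T_leD[OF shU, of 0] M0 by simp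
    have "?V \<in> T_le T M 0" using T_le_cone[OF t _ X] T_le_mono[OF V(2)] by simp
    then have "hom_vanishes T (shift T j M) ?V" for j
      using T_leD[of ?V 0 j] T_geD[OF V(1), of j] 0 M0 by (cases j "0::int" rule: linorder_cases) auto
    then show "is_zero T ?V" by (rule zero_if_vanishes)
  qed
qed

lemma trunc_le_0: "trunc_le T M 0 X \<in> T_le T M 0"
  "hom_vanishes T M (trunc_le T M 0 X) \<longleftrightarrow> hom_vanishes T M X"
proof -
  let ?P = "\<lambda>U. U \<in> T_le T M 0 \<and> (\<exists>f g h. (f, g, h) \<in> triangles T \<and> source T f = U \<and>
     target T f = X \<and> target T g \<in> T_ge T M (0 + 1))"
  have "\<exists>U. ?P U"
    using truncation[of 0 X] by (auto simp: tri_def Hom_def)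
  then have "?P (trunc_le T M 0 X)" unfolding trunc_le_def by (rule someI_ex)
  then obtain V f g h where V: "trunc_le T M 0 X \<in> T_le T M 0" "V \<in> T_ge T M 1"
    and t: "tri (trunc_le T M 0 X) X V f g h"
    using triangles_tri by fastforce
  show "trunc_le T M 0 X \<in> T_le T M 0" by (rule V(1))
  have M0: "shift T 0 M = M" by (simp add: shift_0)
  have "hom_vanishes T M V" using T_geD[OF V(2), of 0] M0 by simp
  moreover have "hom_vanishes T (sh M) V" using T_geD[OF V(2), of 1] by (simp add: shift_1)
  ultimately show "hom_vanishes T M (trunc_le T M 0 X) \<longleftrightarrow> hom_vanishes T M X"
    using tri_vanish2[OF t] tri_vanish1[OF t] by blast
qed

lemma is_zero_Hl: "is_zero T (Hl T M l X) \<longleftrightarrow> hom_vanishes T (shift T (- l) M) X"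
  by (simp add: Hl_def H0_def is_zero_trunc_ge trunc_le_0 hom_vanishes_shift_right)

lemma T_minus_iff: "X \<in> T_minus T M \<longleftrightarrow> (\<exists>n. X \<in> T_le T M n)"
proof
  assume "\<exists>n. X \<in> T_le T M n"
  then obtain n where "X \<in> T_le T M n" by blast
  then have "X \<in> T_le T M (max 1 n)" by (rule T_le_mono) simp
  then show "X \<in> T_minus T M" unfolding T_minus_def by (intro UN_I[of "max 1 n"]) auto
qed (auto simp: T_minus_def)

lemma T_plus_iff: "X \<in> T_plus T M \<longleftrightarrow> (\<exists>n. X \<in> T_ge T M n)"
proof
  assume "\<exists>n. X \<in> T_ge T M n"
  then obtain n where "X \<in> T_ge T M n" by blast
  then have "X \<in> T_ge T M (- max 1 (- n))" by (rule T_ge_mono) simp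
  then show "X \<in> T_plus T M" unfolding T_plus_def by (intro UN_I[of "max 1 (- n)"]) auto
qed (auto simp: T_plus_def)

text \<open>One direction tests objects of the low aisle at i = 0, where n + sup U \<le> -1; the
  other shifts an arbitrary U by i into that aisle. The computation stays in \<open>ereal\<close>,
  since sup U is -\<infinity> for U = 0.\<close>

lemma projdim_eq: "projdim T M X = (INF n\<in>{n. pd_le n X}. ereal (of_int n))"
proof -
  have "(\<forall>U\<in>T_minus T M. \<forall>i::int. ereal (of_int i) > ereal (of_int n) + coh_sup T M U \<longrightarrow>
               hom_vanishes T X (shift T i U)) \<longleftrightarrow> pd_le n X" (is "?L \<longleftrightarrow> _") for n
  proof
    assume L: ?L
    show "pd_le n X" unfolding pd_le_def
    proof
      fix U assume U: "U \<in> T_le T M (- n - 1)"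
      have "coh_sup T M U \<le> ereal (of_int (- n - 1))"
        unfolding coh_sup_def is_zero_Hl
      proof (rule SUP_least)
        fix l assume "l \<in> {l. \<not> hom_vanishes T (shift T (- l) M) U}"
        then have "l \<le> - n - 1" using T_leD[OF U, of "- l"] by fastforce
        then have "real_of_int l \<le> real_of_int (- n - 1)" by (simp only: of_int_le_iff)
        then show "ereal (real_of_int l) \<le> ereal (real_of_int (- n - 1))" by (simp only: ereal_less_eq)
      qed
      then have "ereal (of_int n) + coh_sup T M U \<le> ereal (of_int n) + ereal (of_int (- n - 1))"
        by (rule add_left_mono)
      also have "\<dots> < ereal (of_int 0)" by simp
      finally have "hom_vanishes T X (shift T 0 U)" using L U T_minus_iff by blast
      then show "hom_vanishes T X U" by (simp add: shift_0)
    qed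
  next
    assume P: "pd_le n X"
    show ?L
    proof (intro ballI allI impI)
      fix U i assume *: "ereal (of_int i) > ereal (of_int n) + coh_sup T M U"
      have "shift T i U \<in> T_le T M (- n - 1)"
      proof (rule T_leI, rule ccontr)
        fix j assume j: "j < - (- n - 1)" "\<not> hom_vanishes T (shift T j M) (shift T i U)"
        then have "\<not> hom_vanishes T (shift T (- (i - j)) M) U"
          by (simp add: hom_vanishes_shift_right shift_shift)
        then have "ereal (of_int (i - j)) \<le> coh_sup T M U"
          unfolding coh_sup_def is_zero_Hl by (intro SUP_upper) simp
        then have "ereal (of_int n) + ereal (of_int (i - j)) \<le> ereal (of_int n) + coh_sup T M U"
          by (rule add_left_mono)
        also note *
        finally have "real_of_int n + real_of_int (i - j) < real_of_int i" by simp
        then show False using j(1) by linarith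
      qed
      then show "hom_vanishes T X (shift T i U)" using P unfolding pd_le_def by blast
    qed
  qed
  then show ?thesis unfolding projdim_def by simp
qed

lemma projdim_le: "pd_le n X \<Longrightarrow> projdim T M X \<le> ereal (of_int n)"
  unfolding projdim_eq by (rule INF_lower) simp

text \<open>\<open>projdim\<close> is an infimum over integers, so a real bound may be rounded
  down.\<close>

lemma projdim_le_real: assumes "projdim T M X \<le> ereal r" shows "pd_le \<lfloor>r\<rfloor> X"
proof -
  have "r < of_int (\<lfloor>r\<rfloor> + 1)" by linarith
  then have "ereal r < ereal (of_int (\<lfloor>r\<rfloor> + 1))" by simp
  then have "projdim T M X < ereal (of_int (\<lfloor>r\<rfloor> + 1))" using assms by (rule le_less_trans[rotated])
  then obtain n where n: "pd_le n X" "ereal (of_int n) < ereal (of_int (\<lfloor>r\<rfloor> + 1))"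
    unfolding projdim_eq INF_less_iff by blast
  then have "real_of_int n < real_of_int (\<lfloor>r\<rfloor> + 1)" by simp
  then have "n \<le> \<lfloor>r\<rfloor>" by linarith
  then show ?thesis using n(1) pd_le_mono by blast
qed

lemma projdim_finite_iff: "projdim T M X < \<infinity> \<longleftrightarrow> (\<exists>n. pd_le n X)"
proof
  assume "projdim T M X < \<infinity>"
  then show "\<exists>n. pd_le n X" unfolding projdim_eq INF_less_iff by blast
next
  assume "\<exists>n. pd_le n X"
  then obtain n where "pd_le n X" by blast
  then have "projdim T M X \<le> ereal (of_int n)" by (rule projdim_le)
  also have "\<dots> < \<infinity>" by simp
  finally show "projdim T M X < \<infinity>" .
qed

lemma projdim_shift: "projdim T M X + ereal (of_int k) \<le> projdim T M (shift T k X)"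
proof -
  have "projdim T M X + ereal (of_int k) \<le> ereal (of_int n)" if "pd_le n (shift T k X)" for n
  proof -
    have "projdim T M X \<le> ereal (of_int (n - k))" using that by (intro projdim_le) (simp add: pd_le_shift)
    then have "projdim T M X + ereal (of_int k) \<le> ereal (of_int (n - k)) + ereal (of_int k)"
      by (rule add_right_mono)
    then show ?thesis by simp
  qed
  then show ?thesis unfolding projdim_eq[of "shift T k X"] by (intro INF_greatest) simp
qed

lemma coh_inf_eq: assumes "\<not> is_zero T X" "X \<in> T_plus T M"
  shows "\<exists>l. coh_inf T M X = ereal (of_int l) \<and> X \<in> T_ge T M l"
proof -
  let ?L = "{l. \<not> hom_vanishes T (shift T (- l) M) X}"
  obtain n where n: "X \<in> T_ge T M n" using assms(2) T_plus_iff by blast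
  have ln: "n \<le> l" if "l \<in> ?L" for l using T_geD[OF n, of "- l"] that by fastforce
  have "\<exists>j. \<not> hom_vanishes T (shift T j M) X" using assms(1) zero_if_vanishes by blast
  then obtain j where "- j \<in> ?L" by auto
  \<comment> \<open>The lower bound n turns degrees into natural numbers l - n, among which a least
    one exists.\<close>
  then obtain l where l: "l \<in> ?L" "\<And>k. k \<in> ?L \<Longrightarrow> nat (l - n) \<le> nat (k - n)"
    using ex_has_least_nat[of "\<lambda>l. l \<in> ?L" "- j" "\<lambda>l. nat (l - n)"] by blast
  have lk: "l \<le> k" if "k \<in> ?L" for k using l(2)[OF that] ln[OF that] ln[OF l(1)] by linarith
  have "coh_inf T M X = ereal (of_int l)"
    unfolding coh_inf_def is_zero_Hl
  proof (rule antisym)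
    show "(INF l\<in>?L. ereal (of_int l)) \<le> ereal (of_int l)" using l(1) by (rule INF_lower)
    show "ereal (of_int l) \<le> (INF l\<in>?L. ereal (of_int l))" using lk by (intro INF_greatest) auto
  qed
  moreover have "X \<in> T_ge T M l" unfolding T_ge_iff using lk by fastforce
  ultimately show ?thesis by blast
qed

lemma coh_inf_nonneg: assumes "X \<in> T_ge T M 0" shows "0 \<le> coh_inf T M X"
  unfolding coh_inf_def is_zero_Hl
proof (rule INF_greatest)
  fix l assume "l \<in> {l. \<not> hom_vanishes T (shift T (- l) M) X}"
  then have "0 \<le> l" using T_geD[OF assms, of "- l"] by fastforce
  then show "0 \<le> ereal (of_int l)" by simp
qed

lemma projdim_zero: assumes "is_zero T X" shows "projdim T M X = - \<infinity>"
proof (rule ereal_bot)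
  fix B :: real
  have "projdim T M X \<le> ereal (of_int \<lfloor>B\<rfloor>)" using pd_le_zero[OF assms] by (rule projdim_le)
  also have "\<dots> \<le> ereal B" by simp
  finally show "projdim T M X \<le> ereal B" .
qed

lemma compact_T_minus: "compact_obj \<kappa> T X \<Longrightarrow> X \<in> T_minus T M"
  using compact_bounded T_minus_iff by blast

lemma compact_projdim: "compact_obj \<kappa> T X \<Longrightarrow> projdim T M X < \<infinity>"
  using compact_bounded projdim_finite_iff by blast

lemma compact_T_minus_c: assumes "compact_obj \<kappa> T X" shows "X \<in> T_minus_c \<kappa> T M"
proof -
  obtain O0 where O0: "is_zero T O0" using zero_object by blast
  have "X \<in> star T (compacts \<kappa> T) (T_le T M (- m))" for m
    unfolding star_iff compacts_def using tri_zero_right[OF O0, of X] assms zero_T_le[OF O0] by blast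
  then show ?thesis unfolding T_minus_c_def by blast
qed

lemma T_minus_c_compact: assumes X: "X \<in> T_minus_c \<kappa> T M" and "projdim T M X < \<infinity>" shows "compact_obj \<kappa> T X"
proof -
  obtain n where n: "pd_le n X" using assms(2) projdim_finite_iff by blast
  \<comment> \<open>For m > n the arrow from X to Y is zero, which makes X a summand of C; m \<ge> 1
    is the range allowed in \<open>T_minus_c\<close>.\<close>
  let ?m = "max 1 (n + 1)"
  have "X \<in> star T (compacts \<kappa> T) (T_le T M (- ?m))" using X unfolding T_minus_c_def by simp
  then obtain C Y f g h where C: "C \<in> compacts \<kappa> T" "Y \<in> T_le T M (- ?m)" "tri C X Y f g h"
    unfolding star_iff by blast
  have "g = arr_zero T X Y"
    using hom_vanishesD[OF pd_leD[OF n C(2)]] tri_in[OF C(3)] by simp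
  then have "X \<in> smd T {C}" using tri_split_smd[OF C(3)] by simp
  then have "retract X C" using smd_retract by blast
  then show ?thesis using compact_retract C(1) by (simp add: compacts_def)
qed

section \<open>Descriptions of \<open>fpd\<close> by suprema\<close>

lemma fpd_set_eq:
  "{X \<in> compacts \<kappa> T \<inter> T_b T M \<inter> T_ge T M 0. projdim T M X < \<infinity>} = {X. compact_obj \<kappa> T X \<and> X \<in> T_ge T M 0}"
  using compact_projdim compact_T_minus T_plus_iff by (auto simp: compacts_def T_b_def)

lemma fpd_eq: "fpd \<kappa> T M = (SUP X\<in>{X. compact_obj \<kappa> T X \<and> X \<in> T_ge T M 0}. projdim T M X)"
  unfolding fpd_def fpd_set_eq ..

lemma fpd_eq_T_minus_c:
  "fpd \<kappa> T M = (SUP X\<in>{X \<in> T_minus_c \<kappa> T M \<inter> T_ge T M 0. projdim T M X < \<infinity>}. projdim T M X)"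
proof -
  have "{X \<in> T_minus_c \<kappa> T M \<inter> T_ge T M 0. projdim T M X < \<infinity>} = {X. compact_obj \<kappa> T X \<and> X \<in> T_ge T M 0}"
    using compact_projdim compact_T_minus_c T_minus_c_compact by blast
  then show ?thesis by (simp add: fpd_eq)
qed

text \<open>Shifting X by its infimum l brings it into degrees \<ge> 0 and raises the projective
  dimension by l. Conversely, an object in degrees \<ge> 0 has nonnegative infimum. The zero object
  contributes only -\<infinity> to \<open>fpd\<close>.\<close>

lemma fpd_eq_inf:
  "fpd \<kappa> T M = (SUP X\<in>{X \<in> compacts \<kappa> T \<inter> T_b T M. \<not> is_zero T X}. projdim T M X + coh_inf T M X)"
    (is "_ = (SUP X\<in>?S. ?f X)")
proof (rule antisym)
  show "fpd \<kappa> T M \<le> (SUP X\<in>?S. ?f X)" unfolding fpd_eq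
  proof (rule SUP_least)
    fix X assume X: "X \<in> {X. compact_obj \<kappa> T X \<and> X \<in> T_ge T M 0}"
    show "projdim T M X \<le> (SUP X\<in>?S. ?f X)"
    proof (cases "is_zero T X")
      case True then show ?thesis by (simp add: projdim_zero)
    next
      case False
      then have "X \<in> ?S" using X compact_T_minus T_plus_iff by (auto simp: compacts_def T_b_def)
      then have "?f X \<le> (SUP X\<in>?S. ?f X)" by (rule SUP_upper)
      moreover have "projdim T M X \<le> ?f X" using X coh_inf_nonneg by (intro add_increasing2) auto
      ultimately show ?thesis by (rule order_trans[rotated])
    qed
  qed
  show "(SUP X\<in>?S. ?f X) \<le> fpd \<kappa> T M"
  proof (rule SUP_least)
    fix X assume X: "X \<in> ?S"
    then obtain l where l: "coh_inf T M X = ereal (of_int l)" "X \<in> T_ge T M l"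
      using coh_inf_eq by (auto simp: T_b_def)
    have "?f X \<le> projdim T M (shift T l X)" using projdim_shift l(1) by simp
    also have "\<dots> \<le> fpd \<kappa> T M" unfolding fpd_eq
      using X l(2) by (intro SUP_upper) (simp add: compacts_def compact_shift T_ge_shift)
    finally show "?f X \<le> fpd \<kappa> T M" .
  qed
qed

lemma T_b_c_set_eq:
  "{X \<in> T_b_c \<kappa> T M. projdim T M X < \<infinity> \<and> \<not> is_zero T X} = {X \<in> compacts \<kappa> T \<inter> T_b T M. \<not> is_zero T X}"
  using compact_projdim compact_T_minus_c T_minus_c_compact by (auto simp: T_b_c_def compacts_def)

lemma coconnective_eq: "coconnective T M = T_ge T M 0"
proof (intro equalityI subsetI)
  fix X assume "X \<in> coconnective T M"
  then have "hom_vanishes T (shift T n M) X" if "n \<ge> 1" for n using that by (auto simp: coconnective_def)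
  then show "X \<in> T_ge T M 0" by (intro T_geI) simp
next
  fix X assume X: "X \<in> T_ge T M 0"
  then show "X \<in> coconnective T M" unfolding coconnective_def using T_geD[OF X] by simp
qed

section \<open>Finite extensions of shifts of M\<close>

lemma finite_sums_mono: "A \<subseteq> B \<Longrightarrow> finite_sums T A \<subseteq> finite_sums T B"
  by (meson finite_sumsE finite_sumsI subsetD subsetI)

lemma star_mono: "A \<subseteq> A' \<Longrightarrow> B \<subseteq> B' \<Longrightarrow> star T A B \<subseteq> star T A' B'"
  unfolding star_def by blast

lemma coprod_mono: "A \<subseteq> B \<Longrightarrow> coprod T A n \<subseteq> coprod T B n"
  by (induction n rule: induct_nat_012) (simp_all add: finite_sums_mono star_mono)

lemma coprod_closed:
  assumes Qe: "\<And>A Z B f g h. tri A Z B f g h \<Longrightarrow> A \<in> Q \<Longrightarrow> B \<in> Q \<Longrightarrow> Z \<in> Q"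
    and Qs: "finite_sums T A \<subseteq> Q"
  shows "coprod T A n \<subseteq> Q"
proof (induction n rule: less_induct)
  case (less n)
  show ?case
  proof (cases n)
    case 0 then show ?thesis by simp
  next
    case (Suc k)
    show ?thesis
    proof (cases k)
      case 0 then show ?thesis using Suc Qs by simp
    next
      case (Suc l)
      have IH: "coprod T A k \<subseteq> Q" using less \<open>n = Suc k\<close> by simp
      have "star T (finite_sums T A) (coprod T A k) \<subseteq> Q"
      proof
        fix Z assume "Z \<in> star T (finite_sums T A) (coprod T A k)"
        then obtain X Y f g h where "X \<in> finite_sums T A" "Y \<in> coprod T A k" "tri X Z Y f g h"
          unfolding star_iff by blast
        then show "Z \<in> Q" using Qe Qs IH by blast
      qed
      then show ?thesis using Suc \<open>n = Suc k\<close> by simp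
    qed
  qed
qed

lemma pd_le_coprod: assumes "\<And>X. X \<in> A \<Longrightarrow> pd_le n X" "X \<in> coprod T A k" shows "pd_le n X"
proof -
  have "coprod T A k \<subseteq> {X. pd_le n X}"
  proof (rule coprod_closed)
    show "finite_sums T A \<subseteq> {X. pd_le n X}"
    proof
      fix C assume "C \<in> finite_sums T A"
      then obtain m F \<iota> where F: "\<forall>i<m. F i \<in> A" "is_coproduct T {..<m::nat} F C \<iota>" by (rule finite_sumsE)
      then show "C \<in> {X. pd_le n X}" using pd_le_coproduct[OF F(2)] assms(1) by simp
    qed
  qed (use pd_le_extension in blast)
  then show ?thesis using assms(2) by blast
qed

lemma T_ge_coprod: assumes "\<And>X. X \<in> A \<Longrightarrow> X \<in> T_ge T M n" "X \<in> coprod T A k" shows "X \<in> T_ge T M n"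
proof -
  have "coprod T A k \<subseteq> T_ge T M n"
  proof (rule coprod_closed)
    show "finite_sums T A \<subseteq> T_ge T M n"
    proof
      fix C assume "C \<in> finite_sums T A"
      then obtain m F \<iota> where F: "\<forall>i<m. F i \<in> A" "is_coproduct T {..<m::nat} F C \<iota>" by (rule finite_sumsE)
      then show "C \<in> T_ge T M n" using T_ge_coproduct[OF F(2) small_finite] assms(1) by simp
    qed
  qed (use T_ge_extension in blast)
  then show ?thesis using assms(2) by blast
qed

lemma pd_le_gen_nonneg: assumes "Y \<in> gen_nonneg T M" shows "pd_le 0 Y"
proof -
  obtain n where "Y \<in> smd T (coprod T {shift T (- i) M |i. 0 \<le> i} n)"
    using assms unfolding gen_nonneg_def by blast
  then obtain F where F: "F \<in> coprod T {shift T (- i) M |i. 0 \<le> i} n" "retract Y F" using smd_retract by blast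
  have "pd_le 0 X" if "X \<in> {shift T (- i) M |i. 0 \<le> i}" for X
    using that pd_le_mono[OF pd_le_shift_M] by auto
  then show ?thesis using pd_le_coprod[OF _ F(1)] pd_le_retract[OF F(2)] by blast
qed

text \<open>Objects of \<open>gen_nonneg\<close> have projective dimension at most 0, and the shift
  by n raises this bound to n.\<close>

lemma fpd_le_findim: "fpd \<kappa> T M \<le> findim \<kappa> T M"
  unfolding findim_def
proof (rule INF_greatest)
  fix n :: nat assume "n \<in> {n. coconnective T M \<inter> compacts \<kappa> T \<subseteq> shift T (int n) ` gen_nonneg T M}"
  then have n: "X \<in> shift T (int n) ` gen_nonneg T M" if "compact_obj \<kappa> T X" "X \<in> T_ge T M 0" for X
    using that by (auto simp: coconnective_eq compacts_def)
  show "fpd \<kappa> T M \<le> ereal (of_nat n)" unfolding fpd_eq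
  proof (rule SUP_least)
    fix X assume "X \<in> {X. compact_obj \<kappa> T X \<and> X \<in> T_ge T M 0}"
    then obtain Y where Y: "X = shift T (int n) Y" "Y \<in> gen_nonneg T M" using n by blast
    then have "pd_le (int n) X" using pd_le_gen_nonneg by (simp add: pd_le_shift)
    then show "projdim T M X \<le> ereal (of_nat n)" using projdim_le by fastforce
  qed
qed

text \<open>Each step removes the top degree by \<open>top_cover\<close>; the octahedral axiom puts
  the new sum A in front of the extension built for the lower degrees, which is the order used in
  \<open>coprod\<close>. The k + 1 steps use the shifts M[-b], ..., M[-b+k].\<close>

lemma weight_filtration:
  assumes "compact_obj \<kappa> T X" "X \<in> T_le T M b"
  shows "\<exists>F\<in>coprod T (shifts {- b..<- b + int (Suc k)}) (Suc k). \<exists>X' f g h.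
    tri F X X' f g h \<and> compact_obj \<kappa> T X' \<and> X' \<in> T_le T M (b - int (Suc k))"
  using assms
proof (induction k arbitrary: X b)
  case 0
  have "{- b..<- b + int (Suc 0)} = {- b}" by auto
  then show ?case using top_cover[OF 0] by simp
next
  case (Suc k)
  obtain A X1 a t h where A: "A \<in> finite_sums T {shift T (- b) M}" "tri A X X1 a t h"
    "compact_obj \<kappa> T X1" "X1 \<in> T_le T M (b - 1)"
    using top_cover[OF Suc.prems] by blast
  obtain F1 X' f g h' where F1: "F1 \<in> coprod T (shifts {- (b - 1)..<- (b - 1) + int (Suc k)}) (Suc k)"
    "tri F1 X1 X' f g h'" "compact_obj \<kappa> T X'" "X' \<in> T_le T M (b - 1 - int (Suc k))"
    using Suc.IH[OF A(3,4)] by blast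
  obtain F p q r s t' where F: "tri F X X' p (g \<bullet> t) q" "tri A F F1 r s t'"
    using octahedral_cocone[OF A(2) F1(2)] by blast
  let ?S = "shifts {- b..<- b + int (Suc (Suc k))}"
  have "{shift T (- b) M} \<subseteq> ?S" "shifts {- (b - 1)..<- (b - 1) + int (Suc k)} \<subseteq> ?S" by auto
  then have "A \<in> finite_sums T ?S" "F1 \<in> coprod T ?S (Suc k)"
    using subsetD[OF finite_sums_mono A(1)] subsetD[OF coprod_mono F1(1)] by simp_all
  then have "F \<in> coprod T ?S (Suc (Suc k))" using F(2) by (simp only: coprod.simps star_iff) blast
  moreover have "X' \<in> T_le T M (b - int (Suc (Suc k)))" using F1(4) by (simp add: algebra_simps)
  ultimately show ?case using F(1) F1(3) by blast
qed

lemma gen_nonneg_if_pd_le: assumes X: "compact_obj \<kappa> T X" and p: "pd_le 0 X" shows "X \<in> gen_nonneg T M"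
proof -
  obtain N where N: "X \<in> T_le T M N" using compact_bounded[OF X] by blast
  define k where "k = nat N"
  have k: "X \<in> T_le T M (int k)" using N by (rule T_le_mono) (simp add: k_def)
  \<comment> \<open>Starting at degree k, k + 1 steps pass through degree 0. So only shifts M[-i]
    with i \<ge> 0 occur, and X' lies in degrees \<le> -1, to which X has no maps.\<close>
  obtain F X' f g h where F: "F \<in> coprod T (shifts {- int k..<- int k + int (Suc k)}) (Suc k)"
    "tri F X X' f g h" "X' \<in> T_le T M (int k - int (Suc k))"
    using weight_filtration[OF X k] by blast
  have "g = arr_zero T X X'" using hom_vanishesD[OF pd_leD[OF p F(3)]] tri_in[OF F(2)] by simp
  moreover have "shifts {- int k..<- int k + int (Suc k)} \<subseteq> {shift T (- i) M |i. 0 \<le> i}"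
  proof
    fix Y assume "Y \<in> shifts {- int k..<- int k + int (Suc k)}"
    then obtain j where "Y = shift T j M" "j \<le> 0" by auto
    then show "Y \<in> {shift T (- i) M |i. 0 \<le> i}" by (intro CollectI exI[of _ "- j"]) simp
  qed
  then have "F \<in> coprod T {shift T (- i) M |i. 0 \<le> i} (Suc k)" using subsetD[OF coprod_mono F(1)] by simp
  ultimately have "X \<in> smd T (coprod T {shift T (- i) M |i. 0 \<le> i} (Suc k))"
    using tri_split_smd[OF F(2)] by blast
  then show ?thesis unfolding gen_nonneg_def by (intro UN_I[of "Suc k"]) auto
qed

text \<open>The maximum with 0 excludes -\<infinity>, so that \<open>real_of_ereal\<close> loses
  nothing.\<close>

lemma fpd_pd_le: assumes "fpd \<kappa> T M \<noteq> \<infinity>" "compact_obj \<kappa> T X" "X \<in> T_ge T M 0"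
  shows "pd_le \<lfloor>real_of_ereal (max 0 (fpd \<kappa> T M))\<rfloor> X"
proof (rule projdim_le_real)
  have "projdim T M X \<le> fpd \<kappa> T M" unfolding fpd_eq using assms by (intro SUP_upper) simp
  also have "\<dots> \<le> ereal (real_of_ereal (max 0 (fpd \<kappa> T M)))"
    using assms(1) by (cases "fpd \<kappa> T M") (auto simp: max_def)
  finally show "projdim T M X \<le> ereal (real_of_ereal (max 0 (fpd \<kappa> T M)))" .
qed

lemma findim_le: "findim \<kappa> T M \<le> max 0 (fpd \<kappa> T M)"
proof (cases "fpd \<kappa> T M = \<infinity>")
  case True then show ?thesis by simp
next
  case False
  define r where "r = real_of_ereal (max 0 (fpd \<kappa> T M))"
  have r: "max 0 (fpd \<kappa> T M) = ereal r" "0 \<le> r"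
    using False by (cases "fpd \<kappa> T M"; simp add: r_def max_def)+
  \<comment> \<open>The infimum in \<open>findim\<close> runs over natural numbers, whence the
    rounding and the maximum with 0.\<close>
  define n where "n = nat \<lfloor>r\<rfloor>"
  have n: "int n = \<lfloor>r\<rfloor>" using r(2) by (simp add: n_def)
  have "X \<in> shift T (int n) ` gen_nonneg T M" if X: "compact_obj \<kappa> T X" "X \<in> T_ge T M 0" for X
  proof -
    have "pd_le (int n) X" using fpd_pd_le[OF False X] n by (simp add: r_def)
    then have "shift T (- int n) X \<in> gen_nonneg T M"
      using X by (intro gen_nonneg_if_pd_le) (simp_all add: compact_shift pd_le_shift)
    then show ?thesis by (intro image_eqI[of _ _ "shift T (- int n) X"]) (simp_all add: shift_shift shift_0)
  qed
  then have "findim \<kappa> T M \<le> ereal (of_nat n)"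
    unfolding findim_def coconnective_eq by (intro INF_lower) (auto simp: compacts_def)
  also have "ereal (of_nat n) \<le> ereal r" using n r(2) by simp linarith
  finally show ?thesis using r(1) by simp
qed

end

section \<open>The heart of a tilting object\<close>

context silting_setting
begin

lemma heart_iff: "X \<in> heart T M \<longleftrightarrow> X \<in> T_le T M 0 \<and> X \<in> T_ge T M 0"
  by (simp add: heart_def)

lemma sh_T_le: "X \<in> T_le T M 0 \<Longrightarrow> sh X \<in> T_le T M (- 1)"
  by (simp add: T_le_sh)

lemma vanish_T_le_neg: "X \<in> T_le T M (- 1) \<Longrightarrow> W \<in> T_ge T M 0 \<Longrightarrow> hom_vanishes T X W"
  using orthogonal[of X "- 1" W] by simp

lemma vanish_M: "X \<in> T_le T M (- 1) \<Longrightarrow> hom_vanishes T M X"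
  using T_leD[of X "- 1" 0] by (simp add: shift_0)

section \<open>Kernels and cokernels from triangles in the heart\<close>

text \<open>The shifted difference of u and v factors through an arrow W[1] -> C. For W and C in the
  heart there is no nonzero one, which gives uniqueness in the universal property of a
  kernel.\<close>

lemma tri_left_cancel: assumes t: "tri K P C k p h" and "hom_vanishes T (sh W) C"
    and u: "u \<in> Hom T W K" and v: "v \<in> Hom T W K" and eq: "k \<bullet> u = k \<bullet> v"
  shows "u = v"
proof -
  note ti = tri_in[OF t]
  let ?d = "arr_sub u v"
  have d: "?d \<in> Hom T W K" using u v by (rule sub_in)
  have "k \<bullet> ?d = arr_zero T W P"
    using comp_sub_right[OF u v ti(1)] eq sub_eq_zero[OF compose_in[OF u ti(1)] compose_in[OF v ti(1)]] by simp
  then have "sha k \<bullet> sha ?d = arr_zero T (sh W) (sh P)" using shift_compose[OF d ti(1)] sha_zero by simp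
  then obtain w where "w \<in> Hom T (sh W) C" "h \<bullet> w = sha ?d" using tri_exact4[OF t shift_arr_in[OF d]] by blast
  then have "sha ?d = arr_zero T (sh W) (sh K)"
    using hom_vanishesD[OF assms(2)] comp_zero_right[OF ti(3)] by metis
  then show ?thesis using sha_eq_zero sub_eq_zero[OF u v] by simp
qed

lemma tri_right_cancel: assumes t: "tri K P C k p h" and "hom_vanishes T (sh K) W"
    and u: "u \<in> Hom T C W" and v: "v \<in> Hom T C W" and eq: "u \<bullet> p = v \<bullet> p"
  shows "u = v"
proof -
  note ti = tri_in[OF t]
  let ?d = "arr_sub u v"
  have d: "?d \<in> Hom T C W" using u v by (rule sub_in)
  have "?d \<bullet> p = arr_zero T P W"
    using comp_sub_left[OF ti(2) u v] eq sub_eq_zero[OF compose_in[OF ti(2) u] compose_in[OF ti(2) v]] by simp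
  then obtain w where "w \<in> Hom T (sh K) W" "w \<bullet> h = ?d" using tri_coexact3[OF t d] by blast
  then have "?d = arr_zero T C W"
    using hom_vanishesD[OF assms(2)] comp_zero_left[OF ti(3)] by metis
  then show ?thesis using sub_eq_zero[OF u v] by simp
qed

lemma heart_tri_kernel:
  assumes t: "tri K P C k p h" and H: "K \<in> heart T M" "P \<in> heart T M" "C \<in> heart T M"
  shows "kernel_in T (heart T M) k p"
  unfolding kernel_in_def
proof (intro conjI ballI impI)
  note ti = tri_in[OF t]
  show "arr_in T (heart T M) k" "arr_in T (heart T M) p" "target T k = source T p"
    using ti H by (simp_all add: arr_in_def Hom_def)
  show "p \<bullet> k = arr_zero T (source T k) (target T p)"
    using tri_comp1[OF t] ti by (simp add: Hom_def)
  fix W u assume W: "W \<in> heart T M" and u: "u \<in> Hom T W (source T p)" and z: "p \<bullet> u = arr_zero T W (target T p)"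
  have u': "u \<in> Hom T W P" "p \<bullet> u = arr_zero T W C" using u z ti by (simp_all add: Hom_def)
  obtain v where v: "v \<in> Hom T W K" "k \<bullet> v = u" using tri_exact2[OF t u'] by blast
  have "hom_vanishes T (sh W) C" using W H sh_T_le vanish_T_le_neg by (simp add: heart_iff)
  then have "w = v" if "w \<in> Hom T W K" "k \<bullet> w = u" for w
    using tri_left_cancel[OF t _ that(1) v(1)] that(2) v(2) by simp
  then show "\<exists>!v. v \<in> Hom T W (source T k) \<and> k \<bullet> v = u"
    using v Hom_source[OF ti(1)] by blast
qed

text \<open>The cokernel is taken of d rather than of k; it suffices that maps killing d also kill
  k. This covers the composite of k with an epi, as it occurs when resolutions are spliced.\<close>

lemma heart_tri_cokernel:
  assumes t: "tri K P C k p h" and H: "K \<in> heart T M" "P \<in> heart T M" "C \<in> heart T M"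
    and d: "d \<in> Hom T L P" "L \<in> heart T M" "p \<bullet> d = arr_zero T L C"
    and univ: "\<And>W u. W \<in> heart T M \<Longrightarrow> u \<in> Hom T P W \<Longrightarrow> u \<bullet> d = arr_zero T L W \<Longrightarrow> u \<bullet> k = arr_zero T K W"
  shows "cokernel_in T (heart T M) p d"
  unfolding cokernel_in_def
proof (intro conjI ballI impI)
  note ti = tri_in[OF t]
  show "arr_in T (heart T M) p" "arr_in T (heart T M) d" "source T p = target T d"
    using ti H d by (simp_all add: arr_in_def Hom_def)
  show "p \<bullet> d = arr_zero T (source T d) (target T p)"
    using d ti by (simp add: Hom_def)
  fix W u assume W: "W \<in> heart T M" and u: "u \<in> Hom T (target T d) W" and z: "u \<bullet> d = arr_zero T (source T d) W"
  have u': "u \<in> Hom T P W" "u \<bullet> d = arr_zero T L W" using u z d by (simp_all add: Hom_def)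
  obtain v where v: "v \<in> Hom T C W" "v \<bullet> p = u" using tri_coexact2[OF t u'(1) univ[OF W u']] by blast
  have "hom_vanishes T (sh K) W" using W H sh_T_le vanish_T_le_neg by (simp add: heart_iff)
  then have "w = v" if "w \<in> Hom T C W" "w \<bullet> p = u" for w
    using tri_right_cancel[OF t _ that(1) v(1)] that(2) v(2) by simp
  then show "\<exists>!v. v \<in> Hom T (target T p) W \<and> v \<bullet> p = u"
    using v Hom_target[OF ti(2)] by blast
qed

section \<open>Epimorphisms of the heart\<close>

text \<open>For arrows of the heart this amounts to being epi, but unlike epi it can be read off
  from the cone.\<close>

definition M_surj :: "'o \<Rightarrow> 'm \<Rightarrow> 'o \<Rightarrow> bool" where
  "M_surj X f Y \<longleftrightarrow> (\<forall>y\<in>Hom T M Y. \<exists>x\<in>Hom T M X. f \<bullet> x = y)"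

text \<open>The long exact sequence for M: a map M -> C comes from Y because X[1] lies in degrees
  \<le> -1, then it comes from X and so vanishes in C.\<close>

lemma M_surj_cone:
  assumes t: "tri X Y C f g h" and X: "X \<in> T_le T M 0" and Y: "Y \<in> T_le T M 0" and s: "M_surj X f Y"
  shows "C \<in> T_le T M (- 1)"
proof -
  have C: "C \<in> T_le T M 0" using T_le_cone[OF t _ Y] T_le_mono[OF X] by simp
  note ti = tri_in[OF t]
  have "hom_vanishes T M C"
  proof (rule hom_vanishesI)
    fix u assume u: "u \<in> Hom T M C"
    have "h \<bullet> u = arr_zero T M (sh X)"
      using hom_vanishesD[OF vanish_M[OF sh_T_le[OF X]] compose_in[OF u ti(3)]] .
    then obtain y where y: "y \<in> Hom T M Y" "g \<bullet> y = u" using tri_exact3[OF t u] by blast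
    then obtain x where x: "x \<in> Hom T M X" "f \<bullet> x = y" using s unfolding M_surj_def by blast
    then have "u = (g \<bullet> f) \<bullet> x" using y compose_assoc[OF x(1) ti(1,2)] by simp
    then show "u = arr_zero T M C" using tri_comp1[OF t] comp_zero_left[OF x(1)] by simp
  qed
  then have "hom_vanishes T (shift T j M) C" if "j < 1" for j
    using T_leD[OF C, of j] that by (cases "j = 0") (auto simp: shift_0)
  then show ?thesis by (intro T_leI) simp
qed

lemma epi_of_cone:
  assumes t: "tri X Y C f g h" and X: "X \<in> heart T M" and Y: "Y \<in> heart T M" and C: "C \<in> T_le T M (- 1)"
  shows "epi_in T (heart T M) f"
  unfolding epi_in_def
proof (intro conjI ballI impI)
  note ti = tri_in[OF t]
  show "arr_in T (heart T M) f" using ti X Y by (simp add: arr_in_def Hom_def)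
  fix W u v assume W: "W \<in> heart T M" and u: "u \<in> Hom T (target T f) W" and v: "v \<in> Hom T (target T f) W"
    and eq: "u \<bullet> f = v \<bullet> f"
  have u': "u \<in> Hom T Y W" and v': "v \<in> Hom T Y W" using u v ti by (simp_all add: Hom_def)
  let ?d = "arr_sub u v"
  have d: "?d \<in> Hom T Y W" using u' v' by (rule sub_in)
  have "?d \<bullet> f = arr_zero T X W"
    using comp_sub_left[OF ti(1) u' v'] eq sub_eq_zero[OF compose_in[OF ti(1) u'] compose_in[OF ti(1) v']] by simp
  then obtain w where w: "w \<in> Hom T C W" "w \<bullet> g = ?d" using tri_coexact2[OF t d] by blast
  have "hom_vanishes T C W" using C W vanish_T_le_neg by (simp add: heart_iff)
  then have "?d = arr_zero T Y W" using w hom_vanishesD comp_zero_left[OF ti(2)] by metis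
  then show "u = v" using sub_eq_zero[OF u' v'] by simp
qed

text \<open>V is the degree 0 part of the cone, that is, the cokernel of f in the heart. The part U
  cut off lies in degrees \<le> -1, to which M has no maps, so Hom(M, -) does not notice it.\<close>

lemma cone_cokernel:
  assumes t: "tri X Y C f g h" and X: "X \<in> heart T M" and Y: "Y \<in> heart T M"
  shows "\<exists>V\<in>heart T M. \<exists>q\<in>Hom T Y V. q \<bullet> f = arr_zero T X V \<and>
    (\<forall>x\<in>Hom T M Y. q \<bullet> x = arr_zero T M V \<longrightarrow> (\<exists>y\<in>Hom T M X. f \<bullet> y = x))"
proof -
  note ti = tri_in[OF t]
  have C: "C \<in> T_le T M 0" using T_le_cone[OF t] X Y T_le_mono[of X 0] by (simp add: heart_iff)
  obtain U V a q r where U: "U \<in> T_le T M (- 1)" "V \<in> T_ge T M 0" "tri U C V a q r"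
    using truncation[of "- 1" C] by auto
  note qi = tri_in[OF U(3)]
  have V: "V \<in> heart T M" using T_le_cone[OF U(3) _ C] T_le_mono[OF U(1)] U(2) by (simp add: heart_iff)
  have qg: "q \<bullet> g \<in> Hom T Y V" using ti qi by (blast intro: compose_in)
  have "(q \<bullet> g) \<bullet> f = arr_zero T X V"
    using compose_assoc[OF ti(1,2) qi(2)] tri_comp1[OF t] comp_zero_right[OF qi(2)] by simp
  moreover have "\<exists>y\<in>Hom T M X. f \<bullet> y = x" if x: "x \<in> Hom T M Y" and z: "(q \<bullet> g) \<bullet> x = arr_zero T M V" for x
  proof -
    have gx: "g \<bullet> x \<in> Hom T M C" using x ti(2) by (rule compose_in)
    have "q \<bullet> (g \<bullet> x) = arr_zero T M V" using z compose_assoc[OF x ti(2) qi(2)] by simp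
    then obtain w where "w \<in> Hom T M U" "a \<bullet> w = g \<bullet> x" using tri_exact2[OF U(3) gx] by blast
    then have "g \<bullet> x = arr_zero T M C" using hom_vanishesD[OF vanish_M[OF U(1)]] comp_zero_right[OF qi(1)] by metis
    then show ?thesis using tri_exact2[OF t x] by blast
  qed
  ultimately show ?thesis using V qg by blast
qed

text \<open>An epi forces the arrow to the cokernel to be zero, and then every map M -> Y
  lifts.\<close>

lemma epi_M_surj: assumes e: "epi_in T (heart T M) f" and f: "f \<in> Hom T X Y" shows "M_surj X f Y"
proof -
  have X: "X \<in> heart T M" and Y: "Y \<in> heart T M" using e f by (auto simp: epi_in_def arr_in_def Hom_def)
  obtain C g h where t: "tri X Y C f g h" using cone_ex[OF f] by blast
  obtain V q where q: "V \<in> heart T M" "q \<in> Hom T Y V" "q \<bullet> f = arr_zero T X V"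
    "\<forall>x\<in>Hom T M Y. q \<bullet> x = arr_zero T M V \<longrightarrow> (\<exists>y\<in>Hom T M X. f \<bullet> y = x)"
    using cone_cokernel[OF t X Y] by blast
  have "q \<bullet> f = arr_zero T Y V \<bullet> f" using q(3) comp_zero_left[OF f] by simp
  then have "q = arr_zero T Y V"
    using e q(1,2) zero_in[of Y V] Hom_target[OF f] unfolding epi_in_def by blast
  then show ?thesis using q(4) comp_zero_left unfolding M_surj_def by blast
qed

text \<open>The cocone of an arrow of the heart may have cohomology in degree 1, namely the
  cokernel. For an epi this is absent, so the cocone stays in the heart.\<close>

lemma epi_kernel: assumes e: "epi_in T (heart T M) f" and f: "f \<in> Hom T X Y"
  shows "\<exists>K k h. K \<in> heart T M \<and> tri K X Y k f h"
proof -
  have X: "X \<in> heart T M" and Y: "Y \<in> heart T M" using e f by (auto simp: epi_in_def arr_in_def Hom_def)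
  obtain K k h where t: "tri K X Y k f h" using cocone_ex[OF f] by blast
  have "sh K \<in> T_le T M (- 1)"
    using M_surj_cone[OF tri_rotate[OF t]] X Y epi_M_surj[OF e f] by (simp add: heart_iff)
  moreover have "K \<in> T_ge T M 0" using T_ge_cocone[OF t] X Y T_ge_mono[of Y 0] by (simp add: heart_iff)
  ultimately show ?thesis using t by (auto simp: heart_iff T_le_sh)
qed

section \<open>Exactness in the heart\<close>

lemma exact_in_comp: assumes ex: "exact_in T (heart T M) f g" and f: "f \<in> Hom T X Y" and g: "g \<in> Hom T Y Z"
  shows "g \<bullet> f = arr_zero T X Z"
proof -
  obtain j c where c: "cokernel_in T (heart T M) c f" and j: "kernel_in T (heart T M) j c" and jg: "kernel_in T (heart T M) j g"
    using ex unfolding exact_in_def image_in_def by blast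
  have X: "X \<in> heart T M" using c f by (simp add: cokernel_in_def arr_in_def Hom_def)
  have "f \<in> Hom T X (source T c)" "c \<bullet> f = arr_zero T X (target T c)"
    using c f by (simp_all add: cokernel_in_def Hom_def)
  then obtain v where v: "v \<in> Hom T X (source T j)" "j \<bullet> v = f" using j X unfolding kernel_in_def by blast
  have j': "j \<in> Hom T (source T j) Y" using jg g by (simp add: kernel_in_def Hom_def)
  have "g \<bullet> j = arr_zero T (source T j) Z" using jg g by (simp add: kernel_in_def Hom_def)
  then show ?thesis using v(2) compose_assoc[OF v(1) j' g] comp_zero_left[OF v(1)] by simp
qed

text \<open>The abstract image in \<open>exact_in\<close> meets the triangles through the cokernel:
  x factors through j, so c kills it; the arrow q built from the cone factors through c, so q kills
  x as well, and then x lifts.\<close>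

lemma exact_in_M:
  assumes ex: "exact_in T (heart T M) f g" and f: "f \<in> Hom T X Y" and g: "g \<in> Hom T Y Z" and MH: "M \<in> heart T M"
    and x: "x \<in> Hom T M Y" and gx: "g \<bullet> x = arr_zero T M Z"
  shows "\<exists>y\<in>Hom T M X. f \<bullet> y = x"
proof -
  obtain j c where c: "cokernel_in T (heart T M) c f" and j: "kernel_in T (heart T M) j c" and jg: "kernel_in T (heart T M) j g"
    using ex unfolding exact_in_def image_in_def by blast
  have XY: "X \<in> heart T M" "Y \<in> heart T M" using c f by (simp_all add: cokernel_in_def arr_in_def Hom_def)
  have c': "c \<in> Hom T Y (target T c)" using c f by (simp add: cokernel_in_def Hom_def)
  have j': "j \<in> Hom T (source T j) Y" using jg g by (simp add: kernel_in_def Hom_def)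
  have "x \<in> Hom T M (source T g)" "g \<bullet> x = arr_zero T M (target T g)" using x gx g by (simp_all add: Hom_def)
  then obtain w where w: "w \<in> Hom T M (source T j)" "j \<bullet> w = x" using jg MH unfolding kernel_in_def by blast
  have "c \<bullet> j = arr_zero T (source T j) (target T c)" using j by (simp add: kernel_in_def)
  then have cx: "c \<bullet> x = arr_zero T M (target T c)"
    using w(2) compose_assoc[OF w(1) j' c'] comp_zero_left[OF w(1)] by simp
  obtain C g' h where t: "tri X Y C f g' h" using cone_ex[OF f] by blast
  obtain V q where q: "V \<in> heart T M" "q \<in> Hom T Y V" "q \<bullet> f = arr_zero T X V"
    "\<forall>x\<in>Hom T M Y. q \<bullet> x = arr_zero T M V \<longrightarrow> (\<exists>y\<in>Hom T M X. f \<bullet> y = x)"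
    using cone_cokernel[OF t XY] by blast
  have "q \<in> Hom T (target T f) V" "q \<bullet> f = arr_zero T (source T f) V" using q f by (simp_all add: Hom_def)
  then obtain r where r: "r \<in> Hom T (target T c) V" "r \<bullet> c = q" using c q(1) unfolding cokernel_in_def by blast
  have "q \<bullet> x = arr_zero T M V" using r(2) compose_assoc[OF x c' r(1)] cx comp_zero_right[OF r(1)] by simp
  then show ?thesis using q(4) x by blast
qed

lemma mono_inD: assumes "mono_in T A k" "k \<in> Hom T K P" "W \<in> A" "u \<in> Hom T W K" "v \<in> Hom T W K" "k \<bullet> u = k \<bullet> v"
  shows "u = v"
  using assms(1,3-6) unfolding mono_in_def Hom_source[OF assms(2)] by blast

lemma mono_in_comp_iff:
  assumes k: "mono_in T A k" "k \<in> Hom T K P" and d: "d \<in> Hom T L K" and W: "W \<in> A"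
    and u: "u \<in> Hom T W L" and v: "v \<in> Hom T W L"
  shows "(k \<bullet> d) \<bullet> u = (k \<bullet> d) \<bullet> v \<longleftrightarrow> d \<bullet> u = d \<bullet> v"
proof
  have eq: "(k \<bullet> d) \<bullet> u = k \<bullet> (d \<bullet> u)" "(k \<bullet> d) \<bullet> v = k \<bullet> (d \<bullet> v)"
    using compose_assoc[OF u d k(2)] compose_assoc[OF v d k(2)] by simp_all
  show "d \<bullet> u = d \<bullet> v" if "(k \<bullet> d) \<bullet> u = (k \<bullet> d) \<bullet> v"
    using mono_inD[OF k W compose_in[OF u d] compose_in[OF v d]] that eq by simp
  show "(k \<bullet> d) \<bullet> u = (k \<bullet> d) \<bullet> v" if "d \<bullet> u = d \<bullet> v" using that eq by simp
qed

text \<open>Allows an arrow into a kernel K to be exchanged with its composite into P, both when a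
  resolution is cut and when it is spliced.\<close>

lemma kernel_in_mono_comp:
  assumes k: "mono_in T A k" "k \<in> Hom T K P" and d: "d \<in> Hom T L K"
  shows "kernel_in T A j (k \<bullet> d) \<longleftrightarrow> kernel_in T A j d"
proof -
  have kd: "k \<bullet> d \<in> Hom T L P" using d k(2) by (rule compose_in)
  have s: "source T (k \<bullet> d) = L" "target T (k \<bullet> d) = P" "source T d = L" "target T d = K"
    using kd d by (simp_all add: Hom_def)
  have z: "(k \<bullet> d) \<bullet> u = arr_zero T W P \<longleftrightarrow> d \<bullet> u = arr_zero T W K" if "W \<in> A" "u \<in> Hom T W L" for W u
    using mono_in_comp_iff[OF k d that zero_in] comp_zero_right[OF kd] comp_zero_right[OF d] by simp
  have a: "arr_in T A (k \<bullet> d) \<longleftrightarrow> arr_in T A d"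
    using k s by (simp add: mono_in_def arr_in_def Hom_def)
  have j: "(k \<bullet> d) \<bullet> j = arr_zero T (source T j) P \<longleftrightarrow> d \<bullet> j = arr_zero T (source T j) K"
    if "arr_in T A j" "target T j = L"
    using z[of "source T j" j] that by (simp add: arr_in_def Hom_def)
  have u: "(\<forall>W\<in>A. \<forall>u\<in>Hom T W L. (k \<bullet> d) \<bullet> u = arr_zero T W P \<longrightarrow> Q W u) \<longleftrightarrow>
      (\<forall>W\<in>A. \<forall>u\<in>Hom T W L. d \<bullet> u = arr_zero T W K \<longrightarrow> Q W u)" for Q
    by (intro ball_cong refl) (simp add: z)
  show ?thesis unfolding kernel_in_def s a u using j by blast
qed

lemma exact_in_mono_comp:
  assumes k: "mono_in T A k" "k \<in> Hom T K P" and d: "d \<in> Hom T L K"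
  shows "exact_in T A e (k \<bullet> d) \<longleftrightarrow> exact_in T A e d"
  unfolding exact_in_def by (simp only: kernel_in_mono_comp[OF assms])

lemma mono_in_mono_comp:
  assumes k: "mono_in T A k" "k \<in> Hom T K P" and d: "d \<in> Hom T L K"
  shows "mono_in T A (k \<bullet> d) \<longleftrightarrow> mono_in T A d"
proof -
  have kd: "k \<bullet> d \<in> Hom T L P" using d k(2) by (rule compose_in)
  have s: "source T (k \<bullet> d) = L" "target T (k \<bullet> d) = P" "source T d = L" "target T d = K"
    using kd d by (simp_all add: Hom_def)
  have a: "arr_in T A (k \<bullet> d) \<longleftrightarrow> arr_in T A d"
    using k s by (simp add: mono_in_def arr_in_def Hom_def)
  have "(\<forall>W\<in>A. \<forall>u\<in>Hom T W L. \<forall>v\<in>Hom T W L. (k \<bullet> d) \<bullet> u = (k \<bullet> d) \<bullet> v \<longrightarrow> u = v) \<longleftrightarrow>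
      (\<forall>W\<in>A. \<forall>u\<in>Hom T W L. \<forall>v\<in>Hom T W L. d \<bullet> u = d \<bullet> v \<longrightarrow> u = v)"
    by (intro ball_cong refl) (simp add: mono_in_comp_iff[OF k d])
  then show ?thesis unfolding mono_in_def s a by simp
qed

lemma heart_tri_mono:
  assumes t: "tri K P C k p h" and K: "K \<in> heart T M" and P: "P \<in> heart T M" and C: "C \<in> heart T M"
  shows "mono_in T (heart T M) k"
  unfolding mono_in_def Hom_source[OF tri_in(1)[OF t]]
proof (intro conjI ballI impI)
  show "arr_in T (heart T M) k" using tri_in(1)[OF t] K P by (simp add: arr_in_def Hom_def)
  fix W u v assume W: "W \<in> heart T M" and u: "u \<in> Hom T W K" and v: "v \<in> Hom T W K" and eq: "k \<bullet> u = k \<bullet> v"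
  have "hom_vanishes T (sh W) C" using W C sh_T_le vanish_T_le_neg by (simp add: heart_iff)
  from tri_left_cancel[OF t this u v eq] show "u = v" .
qed

section \<open>Cutting and splicing finite resolutions\<close>

text \<open>A resolution of length 0 is an isomorphism P -> H. Phrased as a triangle with zero first
  term, it gives inductions a base case of the same shape as their step.\<close>

lemma has_resolution_0:
  assumes "has_resolution T (heart T M) B 0 H" and H: "H \<in> heart T M"
  shows "\<exists>K P k p h. tri K P H k p h \<and> is_zero T K \<and> P \<in> heart T M \<inter> B"
proof -
  obtain P d where P: "P (0::nat) \<in> heart T M \<inter> B" "d (0::nat) \<in> Hom T (P 0) H"
    "epi_in T (heart T M) (d 0)" "mono_in T (heart T M) (d 0)"
    using assms(1) unfolding has_resolution_def by auto
  obtain K k h where K: "K \<in> heart T M" "tri K (P 0) H k (d 0) h" using epi_kernel[OF P(3,2)] by blast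
  note ti = tri_in[OF K(2)]
  have "d 0 \<bullet> k = d 0 \<bullet> arr_zero T K (P 0)" using tri_comp1[OF K(2)] comp_zero_right[OF P(2)] by simp
  then have k0: "k = arr_zero T K (P 0)"
    using mono_inD[OF P(4,2) K(1) ti(1) zero_in] by blast
  \<comment> \<open>k is zero because d 0 is mono, and k is mono as a kernel; so the identity of K
    is zero.\<close>
  have "k \<bullet> ident T K = k \<bullet> arr_zero T K K"
    using k0 comp_zero_right[OF ti(1)] compose_ident_right[OF ti(1)] by simp
  then have "ident T K = arr_zero T K K"
    using mono_inD[OF heart_tri_mono[OF K(2,1) _ H] ti(1) K(1) ident_in zero_in] P(1) by blast
  then show ?thesis using K(2) P(1) is_zero_iff by blast
qed

text \<open>K is the first syzygy. The differential from P 1 lands in it, and exactness at P 0,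
  tested on maps from M, makes the resulting arrow d' epi.\<close>

lemma has_resolution_Suc:
  assumes "has_resolution T (heart T M) B (Suc n) H" and H: "H \<in> heart T M" and MH: "M \<in> heart T M"
  shows "\<exists>K P k p h. tri K P H k p h \<and> K \<in> heart T M \<and> P \<in> heart T M \<inter> B \<and> has_resolution T (heart T M) B n K"
proof -
  obtain P d where P: "\<And>i. i \<le> Suc n \<Longrightarrow> P i \<in> heart T M \<inter> B" and d0: "d 0 \<in> Hom T (P 0) H"
    and d: "\<And>i. i < Suc n \<Longrightarrow> d (Suc i) \<in> Hom T (P (Suc i)) (P i)" and epi: "epi_in T (heart T M) (d 0)"
    and ex: "\<And>i. i < Suc n \<Longrightarrow> exact_in T (heart T M) (d (Suc i)) (d i)" and mono: "mono_in T (heart T M) (d (Suc n))"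
    using assms(1) unfolding has_resolution_def by blast
  obtain K k h where K: "K \<in> heart T M" "tri K (P 0) H k (d 0) h" using epi_kernel[OF epi d0] by blast
  note ti = tri_in[OF K(2)]
  have d1: "d (Suc 0) \<in> Hom T (P (Suc 0)) (P 0)" using d[of 0] by simp
  have ex0: "exact_in T (heart T M) (d (Suc 0)) (d 0)" using ex[of 0] by simp
  obtain d' where d': "d' \<in> Hom T (P (Suc 0)) K" "k \<bullet> d' = d (Suc 0)"
    using tri_exact2[OF K(2) d1 exact_in_comp[OF ex0 d1 d0]] by blast
  have P0: "P 0 \<in> heart T M" and P1: "P (Suc 0) \<in> heart T M" using P by auto
  note mk = heart_tri_mono[OF K(2,1) P0 H]
  have "M_surj (P (Suc 0)) d' K" unfolding M_surj_def
  proof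
    fix z assume z: "z \<in> Hom T M K"
    have kz: "k \<bullet> z \<in> Hom T M (P 0)" using z ti(1) by (rule compose_in)
    have "d 0 \<bullet> (k \<bullet> z) = arr_zero T M H"
      using compose_assoc[OF z ti(1) d0] tri_comp1[OF K(2)] comp_zero_left[OF z] by simp
    then obtain y where y: "y \<in> Hom T M (P (Suc 0))" "d (Suc 0) \<bullet> y = k \<bullet> z"
      using exact_in_M[OF ex0 d1 d0 MH kz] by blast
    then have "k \<bullet> (d' \<bullet> y) = k \<bullet> z" using compose_assoc[OF y(1) d'(1) ti(1)] d'(2) by simp
    then have "d' \<bullet> y = z" using mono_inD[OF mk ti(1) MH compose_in[OF y(1) d'(1)] z] by blast
    then show "\<exists>x\<in>Hom T M (P (Suc 0)). d' \<bullet> x = z" using y(1) by blast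
  qed
  moreover obtain C g h' where C: "tri (P (Suc 0)) K C d' g h'" using cone_ex[OF d'(1)] by blast
  ultimately have epi': "epi_in T (heart T M) d'"
    using epi_of_cone[OF C P1 K(1)] M_surj_cone[OF C] P1 K(1) by (simp add: heart_iff)
  define P' where "P' i = P (Suc i)" for i
  define e where "e i = (if i = 0 then d' else d (Suc i))" for i
  have "has_resolution T (heart T M) B n K" unfolding has_resolution_def
  proof (intro exI[of _ P'] exI[of _ e] conjI allI impI)
    show "P' i \<in> heart T M \<inter> B" if "i \<le> n" for i using P[of "Suc i"] that by (simp add: P'_def)
    show "e 0 \<in> Hom T (P' 0) K" using d' by (simp add: P'_def e_def)
    show "e (Suc i) \<in> Hom T (P' (Suc i)) (P' i)" if "i < n" for i using d[of "Suc i"] that by (simp add: P'_def e_def)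
    show "epi_in T (heart T M) (e 0)" using epi' by (simp add: e_def)
    show "exact_in T (heart T M) (e (Suc i)) (e i)" if "i < n" for i
    proof (cases i)
      case 0
      have "exact_in T (heart T M) (d (Suc (Suc 0))) (k \<bullet> d')" using ex[of "Suc 0"] that d'(2) 0 by simp
      then show ?thesis using exact_in_mono_comp[OF mk ti(1) d'(1)] 0 by (simp add: e_def)
    next
      case (Suc j) then show ?thesis using ex[of "Suc i"] that by (simp add: e_def)
    qed
    show "mono_in T (heart T M) (e n)"
    proof (cases n)
      case 0
      have "mono_in T (heart T M) (k \<bullet> d')" using mono d'(2) 0 by simp
      then show ?thesis using mono_in_mono_comp[OF mk ti(1) d'(1)] 0 by (simp add: e_def)
    next
      case (Suc j) then show ?thesis using mono by (simp add: e_def)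
    qed
  qed
  then show ?thesis using K P[of 0] by blast
qed

text \<open>Since d 0 is epi, the image of its composite with k is K; hence p is the cokernel of
  that composite, and k is the kernel of p.\<close>

lemma has_resolution_Cons:
  assumes t: "tri K P0 H k p h" and K: "K \<in> heart T M" and P0: "P0 \<in> heart T M \<inter> B" and H: "H \<in> heart T M"
    and r: "has_resolution T (heart T M) B n K"
  shows "has_resolution T (heart T M) B (Suc n) H"
proof -
  note ti = tri_in[OF t]
  obtain P d where P: "\<And>i. i \<le> n \<Longrightarrow> P i \<in> heart T M \<inter> B" and d0: "d 0 \<in> Hom T (P 0) K"
    and d: "\<And>i. i < n \<Longrightarrow> d (Suc i) \<in> Hom T (P (Suc i)) (P i)" and epi: "epi_in T (heart T M) (d 0)"
    and ex: "\<And>i. i < n \<Longrightarrow> exact_in T (heart T M) (d (Suc i)) (d i)" and mono: "mono_in T (heart T M) (d n)"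
    using r unfolding has_resolution_def by blast
  have P1: "P 0 \<in> heart T M" and P0': "P0 \<in> heart T M" using P P0 by auto
  note mk = heart_tri_mono[OF t K P0' H]
  have kd: "k \<bullet> d 0 \<in> Hom T (P 0) P0" using d0 ti(1) by (rule compose_in)
  have "cokernel_in T (heart T M) p (k \<bullet> d 0)"
  proof (rule heart_tri_cokernel[OF t K P0' H kd P1])
    show "p \<bullet> (k \<bullet> d 0) = arr_zero T (P 0) H"
      using compose_assoc[OF d0 ti(1,2)] tri_comp1[OF t] comp_zero_left[OF d0] by simp
    fix W u assume W: "W \<in> heart T M" and u: "u \<in> Hom T P0 W" and z: "u \<bullet> (k \<bullet> d 0) = arr_zero T (P 0) W"
    have uk: "u \<bullet> k \<in> Hom T K W" using ti(1) u by (rule compose_in)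
    have "(u \<bullet> k) \<bullet> d 0 = arr_zero T K W \<bullet> d 0"
      using z compose_assoc[OF d0 ti(1) u] comp_zero_left[OF d0] by simp
    then show "u \<bullet> k = arr_zero T K W"
      using epi W uk zero_in[of K W] Hom_target[OF d0] unfolding epi_in_def by blast
  qed
  then have ex0: "exact_in T (heart T M) (k \<bullet> d 0) p"
    using heart_tri_kernel[OF t K P0' H] unfolding exact_in_def image_in_def by blast
  have sK: "sh K \<in> T_le T M (- 1)" using K sh_T_le by (simp add: heart_iff)
  have epi': "epi_in T (heart T M) p" using epi_of_cone[OF tri_rotate[OF t] P0' H sK] .
  define P' where "P' i = (case i of 0 \<Rightarrow> P0 | Suc j \<Rightarrow> P j)" for i
  define e where "e i = (case i of 0 \<Rightarrow> p | Suc j \<Rightarrow> (if j = 0 then k \<bullet> d 0 else d j))" for i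
  show ?thesis unfolding has_resolution_def
  proof (intro exI[of _ P'] exI[of _ e] conjI allI impI)
    show "P' i \<in> heart T M \<inter> B" if "i \<le> Suc n" for i using P P0 that by (cases i) (auto simp: P'_def)
    show "e 0 \<in> Hom T (P' 0) H" using ti by (simp add: P'_def e_def)
    show "e (Suc i) \<in> Hom T (P' (Suc i)) (P' i)" if "i < Suc n" for i
      using kd d[of "i - 1"] that by (cases i) (auto simp: P'_def e_def)
    show "epi_in T (heart T M) (e 0)" using epi' by (simp add: e_def)
    show "exact_in T (heart T M) (e (Suc i)) (e i)" if "i < Suc n" for i
    proof (cases i)
      case 0 then show ?thesis using ex0 by (simp add: e_def)
    next
      case (Suc j)
      then have "exact_in T (heart T M) (d (Suc j)) (d j)" using ex that by simp
      then show ?thesis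
        using exact_in_mono_comp[OF mk ti(1) d0] Suc by (auto simp: e_def)
    qed
    show "mono_in T (heart T M) (e (Suc n))"
      using mono mono_in_mono_comp[OF mk ti(1) d0] by (auto simp: e_def)
  qed
qed

lemma has_resolution_self: assumes "H \<in> heart T M \<inter> B" shows "has_resolution T (heart T M) B 0 H"
  unfolding has_resolution_def
proof (intro exI[of _ "\<lambda>i. H"] exI[of _ "\<lambda>i. ident T H"] conjI allI impI)
  show "epi_in T (heart T M) (ident T H)" "mono_in T (heart T M) (ident T H)"
    using assms compose_ident_left compose_ident_right by (auto simp: epi_in_def mono_in_def arr_in_def)
qed (use assms ident_in in auto)

section \<open>Projective objects of the heart and add(M)\<close>

lemma finite_sums_M: "finite_sums T {M} = finite_sums T (shifts {0})"
  by (simp add: shift_0)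

lemma add_fin_compact: assumes "P \<in> add_fin T M" shows "compact_obj \<kappa> T P"
proof -
  obtain A where "A \<in> finite_sums T {M}" "retract P A" using assms smd_retract unfolding add_fin_def by blast
  then show ?thesis using compact_retract finite_sums_compact finite_sums_M by metis
qed

lemma finite_sums_M_heart: assumes "A \<in> finite_sums T {M}" and MH: "M \<in> heart T M"
  shows "A \<in> heart T M"
proof -
  obtain n F \<iota> where F: "\<forall>i<n. F i \<in> {M}" "is_coproduct T {..<n::nat} F A \<iota>" using assms(1) by (rule finite_sumsE)
  then show ?thesis
    using T_le_coproduct[OF F(2) small_finite, of 0] T_ge_coproduct[OF F(2) small_finite, of 0] MH
    by (simp add: heart_iff)
qed

lemma finite_sums_M_pd: assumes "A \<in> finite_sums T {M}" shows "pd_le 0 A"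
proof -
  obtain n F \<iota> where F: "\<forall>i<n. F i \<in> {M}" "is_coproduct T {..<n::nat} F A \<iota>" using assms(1) by (rule finite_sumsE)
  have "pd_le 0 M" using pd_le_shift_M[of 0] by (simp add: shift_0)
  then show ?thesis using pd_le_coproduct[OF F(2)] F(1) by simp
qed

lemma add_fin_pd: assumes "P \<in> add_fin T M" shows "pd_le 0 P"
proof -
  obtain A where "A \<in> finite_sums T {M}" "retract P A" using assms smd_retract unfolding add_fin_def by blast
  then show ?thesis using pd_le_retract finite_sums_M_pd by blast
qed

text \<open>The cone of an epi lies in degrees \<le> -1, so P has no maps to it and every map
  lifts.\<close>

lemma pd_le_projective: assumes P: "P \<in> heart T M" and pd: "pd_le 0 P" shows "projective_in T (heart T M) P"
  unfolding projective_in_def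
proof (intro conjI allI impI ballI)
  fix g f assume g: "epi_in T (heart T M) g" and f: "f \<in> Hom T P (target T g)"
  let ?X = "source T g" and ?Y = "target T g"
  have g': "g \<in> Hom T ?X ?Y" by (simp add: Hom_def)
  have X: "?X \<in> T_le T M 0" "?Y \<in> T_le T M 0" using g by (simp_all add: epi_in_def arr_in_def heart_iff)
  obtain C q h where t: "tri ?X ?Y C g q h" using cone_ex[OF g'] by blast
  have "C \<in> T_le T M (- 1)" using M_surj_cone[OF t X epi_M_surj[OF g g']] .
  then have "hom_vanishes T P C" using pd_leD[OF pd] by simp
  then have "q \<bullet> f = arr_zero T P C" using compose_in[OF f tri_in(2)[OF t]] by (rule hom_vanishesD)
  then show "\<exists>f'\<in>Hom T P ?X. g \<bullet> f' = f" using tri_exact2[OF t f] by blast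
qed (rule P)

text \<open>The universal map from a coproduct of copies of M is epi, so a projective object is a
  retract of such a coproduct.\<close>

lemma projective_pd_le: assumes Q: "projective_in T (heart T M) Q" and MH: "M \<in> heart T M" shows "pd_le 0 Q"
proof -
  have QH: "Q \<in> heart T M" using Q by (simp add: projective_in_def)
  \<comment> \<open>The set is written with \<open>- 0\<close> to match \<open>kill_T_le\<close> at
    n = 0.\<close>
  obtain X' t where k: "kill {- 0} Q X' t" using kill_ex by blast
  then obtain C \<iota> c h where C: "is_coproduct T (arrs {- 0} Q) (source T) C \<iota>" "tri C Q X' c t h"
    unfolding kill_def by blast
  have src: "source T f = M" if "f \<in> arrs {- 0} Q" for f using that by (simp add: arrs_def Hom_def shift_0)
  have CH: "C \<in> heart T M"
    using T_le_coproduct[OF C(1) small_arrs, of 0] T_ge_coproduct[OF C(1) small_arrs, of 0] src MH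
    by (simp add: heart_iff)
  have "X' \<in> T_le T M (- 1)" using kill_T_le[OF k] QH by (simp add: heart_iff)
  then have epi: "epi_in T (heart T M) c" using epi_of_cone[OF C(2) CH QH] by blast
  have c: "c \<in> Hom T C Q" using tri_in[OF C(2)] by simp
  have "ident T Q \<in> Hom T Q (target T c)" using c ident_in by (simp add: Hom_def)
  then obtain s where "s \<in> Hom T Q (source T c)" "c \<bullet> s = ident T Q"
    using Q epi unfolding projective_in_def by blast
  then have "retract Q C" using c unfolding retract_def by (auto simp: Hom_def)
  moreover have "pd_le 0 C"
    using pd_le_coproduct[OF C(1)] src pd_le_shift_M[of 0] by (simp add: shift_0)
  ultimately show ?thesis by (rule pd_le_retract)
qed

section \<open>Resolutions, compactness and projective dimension\<close>

lemma resolution_compact: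
  assumes "has_resolution T (heart T M) (add_fin T M) n H" "H \<in> heart T M" and MH: "M \<in> heart T M"
  shows "compact_obj \<kappa> T H"
  using assms(1,2)
proof (induction n arbitrary: H)
  case 0
  obtain K P k p h where "tri K P H k p h" "is_zero T K" "P \<in> heart T M \<inter> add_fin T M"
    using has_resolution_0[OF 0] by blast
  then show ?case using compact_cone compact_zero add_fin_compact by blast
next
  case (Suc n)
  obtain K P k p h where "tri K P H k p h" "K \<in> heart T M" "P \<in> heart T M \<inter> add_fin T M"
    "has_resolution T (heart T M) (add_fin T M) n K"
    using has_resolution_Suc[OF Suc.prems MH] by blast
  then show ?case using compact_cone Suc.IH add_fin_compact by blast
qed

lemma resolution_pd_le:
  assumes "has_resolution T (heart T M) {Q. projective_in T (heart T M) Q} n H" "H \<in> heart T M" and MH: "M \<in> heart T M"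
  shows "pd_le (int n) H"
  using assms(1,2)
proof (induction n arbitrary: H)
  case 0
  obtain K P k p h where "tri K P H k p h" "is_zero T K" "projective_in T (heart T M) P"
    using has_resolution_0[OF 0] by blast
  then show ?case using pd_le_cone[of K P H k p h 0] pd_le_zero projective_pd_le[OF _ MH] by simp
next
  case (Suc n)
  obtain K P k p h where K: "tri K P H k p h" "K \<in> heart T M" "projective_in T (heart T M) P"
    "has_resolution T (heart T M) {Q. projective_in T (heart T M) Q} n K"
    using has_resolution_Suc[OF Suc.prems MH] by blast
  have "pd_le (int (Suc n)) P" using pd_le_mono[OF projective_pd_le[OF K(3) MH]] by simp
  then show ?case using pd_le_cone[OF K(1)] Suc.IH[OF K(4,2)] by simp
qed

text \<open>\<open>top_cover\<close> in degree 0 maps a finite sum of copies of M onto H. The kernel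
  K = X'[-1] is again compact and in the heart, with a bound smaller by one; when the bound is 0 the
  cover splits.\<close>

lemma resolution_ex:
  assumes "compact_obj \<kappa> T H" "H \<in> heart T M" "pd_le (int n) H" and MH: "M \<in> heart T M"
  shows "has_resolution T (heart T M) (add_fin T M) n H"
  using assms(1-3)
proof (induction n arbitrary: H)
  case 0
  obtain A X' a t h where A: "A \<in> finite_sums T {M}" "tri A H X' a t h" "X' \<in> T_le T M (- 1)"
    using top_cover[of H 0] 0 by (auto simp: heart_iff shift_0)
  have "t = arr_zero T H X'" using hom_vanishesD[OF pd_leD[OF 0(3) A(3)]] tri_in[OF A(2)] by simp
  then have "H \<in> add_fin T M" using tri_split_smd[OF A(2) _ A(1)] unfolding add_fin_def by blast
  then show ?case using has_resolution_self 0(2) by blast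
next
  case (Suc n)
  obtain A X' a t h where A: "A \<in> finite_sums T {M}" "tri A H X' a t h" "compact_obj \<kappa> T X'" "X' \<in> T_le T M (- 1)"
    using top_cover[of H 0] Suc.prems by (auto simp: heart_iff shift_0)
  obtain K where K: "X' = sh K" using sh_surj by metis
  obtain k where t: "tri K A H k a t" using A(2) K tri_rotate_back by metis
  have AH: "A \<in> heart T M" using finite_sums_M_heart[OF A(1) MH] .
  have "K \<in> T_ge T M 0" using T_ge_cocone[OF t] AH Suc.prems(2) T_ge_mono[of H 0] by (simp add: heart_iff)
  then have KH: "K \<in> heart T M" using A(4) K by (simp add: heart_iff T_le_sh)
  have "pd_le (int n) A" using pd_le_mono[OF finite_sums_M_pd[OF A(1)]] by simp
  then have "pd_le (int n) K" using pd_le_cocone[OF t] Suc.prems(3) by (simp add: add.commute)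
  moreover have "compact_obj \<kappa> T K" using A(3) K compact_sh_iff by simp
  ultimately have "has_resolution T (heart T M) (add_fin T M) n K" using Suc.IH KH by blast
  moreover have "A \<in> heart T M \<inter> add_fin T M" using AH A(1) subset_smd unfolding add_fin_def by blast
  ultimately show ?case using has_resolution_Cons[OF t KH _ Suc.prems(2)] by blast
qed

lemma has_resolution_mono:
  assumes "has_resolution T A B n H" "A \<inter> B \<subseteq> B'" shows "has_resolution T A B' n H"
proof -
  obtain P d where P: "(\<forall>i\<le>n. P i \<in> A \<inter> B) \<and>
        d 0 \<in> Hom T (P 0) H \<and> (\<forall>i<n. d (Suc i) \<in> Hom T (P (Suc i)) (P i)) \<and>
        epi_in T A (d 0) \<and> (\<forall>i<n. exact_in T A (d (Suc i)) (d i)) \<and> mono_in T A (d n)"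
    using assms(1) unfolding has_resolution_def by (elim exE)
  then have "\<forall>i\<le>n. P i \<in> A \<inter> B'" using assms(2) by blast
  with P show ?thesis unfolding has_resolution_def by (intro exI[of _ P] exI[of _ d]) simp
qed

lemma tilting_M_heart: assumes "tilting \<kappa> T M" shows "M \<in> heart T M"
proof -
  \<comment> \<open>M is the coproduct of one copy of itself; \<open>undefined\<close> merely names
    an element of the index type.\<close>
  have "is_coproduct T {undefined :: 'i} (\<lambda>_. M) M (\<lambda>_. ident T M)"
    by (rule coproductI) (use ident_in compose_ident_right in auto)
  then have "M \<in> {C. \<exists>(I :: 'i set) \<iota>. small \<kappa> I \<and> is_coproduct T I (\<lambda>_. M) C \<iota>}"
    using small_finite[of "{undefined :: 'i}"] by blast
  then have "M \<in> Add \<kappa> T M" unfolding Add_def by (rule subsetD[OF subset_smd])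
  then have v: "hom_vanishes T M (shift T i M)" if "i \<noteq> 0" for i
    using assms that unfolding tilting_def by blast
  have "M \<in> T_ge T M 0"
  proof (rule T_geI)
    fix j :: int assume "- 0 < j"
    then show "hom_vanishes T (shift T j M) M" using v[of "- j"] by (simp add: hom_vanishes_shift_right)
  qed
  moreover have "M \<in> T_le T M 0" using shift_M_T_le[of 0] by (simp add: shift_0)
  ultimately show ?thesis by (simp add: heart_iff)
qed

section \<open>Comparison of the dimensions\<close>

lemma M_nonzero: assumes "\<not> is_zero T X" shows "\<not> is_zero T M"
proof
  assume "is_zero T M"
  then have "hom_vanishes T (shift T j M) X" for j using is_zero_shift is_zero_vanish(1) by blast
  then show False using assms zero_if_vanishes by blast
qed

text \<open>A bound of -1 would forbid maps to degrees \<le> 0, in particular the identity of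
  X.\<close>

lemma heart_not_pd_le: assumes "X \<in> heart T M" "\<not> is_zero T X" shows "\<not> pd_le (- 1) X"
proof
  assume "pd_le (- 1) X"
  then have "hom_vanishes T X X" using pd_leD[of "- 1" X X 0] assms(1) by (simp add: heart_iff)
  then show False using assms(2) is_zero_self_vanish by blast
qed

lemma projdim_ge: assumes "\<not> pd_le (n - 1) X" shows "ereal (of_int n) \<le> projdim T M X"
  unfolding projdim_eq
proof (rule INF_greatest)
  fix m assume "m \<in> {n. pd_le n X}"
  then have "n \<le> m" using assms pd_le_mono[of m X "n - 1"] by force
  then show "ereal (of_int n) \<le> ereal (of_int m)" by simp
qed

text \<open>M itself takes part in the supremum. It is nonzero because it generates a category with
  a nonzero object, so its projective dimension is not negative.\<close>

lemma fpd_nonneg: assumes MH: "M \<in> heart T M" and "\<not> is_zero T X" shows "0 \<le> fpd \<kappa> T M"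
proof -
  have "ereal (of_int 0) \<le> projdim T M M" using heart_not_pd_le[OF MH M_nonzero[OF assms(2)]] by (intro projdim_ge) simp
  also have "\<dots> \<le> fpd \<kappa> T M" unfolding fpd_eq
    using MH compact_M[of 0] by (intro SUP_upper) (simp add: heart_iff shift_0)
  finally show ?thesis by (simp add: zero_ereal_def)
qed

lemma projdim_in_nonneg: "0 \<le> projdim_in T A H"
  unfolding projdim_in_def by (rule INF_greatest) simp

lemma projdim_in_le:
  assumes "compact_obj \<kappa> T H" "H \<in> heart T M" "pd_le (int n) H" and MH: "M \<in> heart T M"
  shows "projdim_in T (heart T M) H \<le> ereal (of_nat n)"
proof -
  have "has_resolution T (heart T M) {Q. projective_in T (heart T M) Q} n H"
    using has_resolution_mono[OF resolution_ex[OF assms]] pd_le_projective add_fin_pd by blast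
  then show ?thesis unfolding projdim_in_def by (intro INF_lower) simp
qed

lemma projdim_in_ge:
  assumes "H \<in> heart T M" "\<not> pd_le (int n - 1) H" and MH: "M \<in> heart T M"
  shows "ereal (of_nat n) \<le> projdim_in T (heart T M) H"
  unfolding projdim_in_def
proof (rule INF_greatest)
  fix m assume "m \<in> {n. has_resolution T (heart T M) {Q. projective_in T (heart T M) Q} n H}"
  then have "pd_le (int m) H" using resolution_pd_le[OF _ assms(1) MH] by simp
  then have "n \<le> m" using assms(2) pd_le_mono[of "int m" H "int n - 1"] by force
  then show "ereal (of_nat n) \<le> ereal (of_nat m)" by simp
qed

text \<open>A finite resolution by add(M) makes H compact, so \<open>fpd\<close> bounds it, and the
  bound is realized by an actual resolution. Nonnegativity of \<open>fpd\<close> lets the rounded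
  bound serve as a length.\<close>

lemma fpd_heart_le: assumes MH: "M \<in> heart T M" and nz: "\<not> is_zero T X" shows "fpd_heart T M \<le> fpd \<kappa> T M"
  unfolding fpd_heart_def
proof (rule SUP_least)
  fix H assume "H \<in> {H \<in> heart T M. \<exists>n. has_resolution T (heart T M) (add_fin T M) n H}"
  then have H: "H \<in> heart T M" and C: "compact_obj \<kappa> T H" using resolution_compact MH by blast+
  show "projdim_in T (heart T M) H \<le> fpd \<kappa> T M"
  proof (cases "fpd \<kappa> T M = \<infinity>")
    case False
    then obtain r where r: "fpd \<kappa> T M = ereal r" "0 \<le> r" using fpd_nonneg[OF assms] by (cases "fpd \<kappa> T M") auto
    then have "max 0 (fpd \<kappa> T M) = ereal r" by (simp add: max_def)
    then have "pd_le \<lfloor>r\<rfloor> H" using fpd_pd_le[OF False C] H by (simp add: heart_iff)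
    then have "pd_le (int (nat \<lfloor>r\<rfloor>)) H" using r(2) by simp
    then have "projdim_in T (heart T M) H \<le> ereal (of_nat (nat \<lfloor>r\<rfloor>))" using projdim_in_le[OF C H _ MH] by blast
    also have "\<dots> \<le> ereal r" using r(2) by simp
    finally show ?thesis using r(1) by simp
  qed simp
qed

text \<open>Cutting off the part of \<open>X\<close> in positive degrees leaves an object of the heart with the same
  top obstruction.\<close>

lemma fpd_le_heart: assumes MH: "M \<in> heart T M" shows "fpd \<kappa> T M \<le> fpd_heart T M"
  unfolding fpd_eq
proof (rule SUP_least)
  fix X assume "X \<in> {X. compact_obj \<kappa> T X \<and> X \<in> T_ge T M 0}"
  then have X: "compact_obj \<kappa> T X" and X0: "X \<in> T_ge T M 0" by auto
  \<comment> \<open>Every compact object of the heart has a finite resolution by add(M), so it takes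
    part in the supremum of \<open>fpd_heart\<close>.\<close>
  have le: "projdim_in T (heart T M) H \<le> fpd_heart T M" if H: "H \<in> heart T M" "compact_obj \<kappa> T H" for H
  proof -
    obtain N where "pd_le N H" using compact_bounded[OF H(2)] by blast
    then have "pd_le (int (nat N)) H" by (rule pd_le_mono) simp
    then have "has_resolution T (heart T M) (add_fin T M) (nat N) H" using resolution_ex H MH by blast
    then show ?thesis unfolding fpd_heart_def using H(1) by (intro SUP_upper) blast
  qed
  have h0: "0 \<le> fpd_heart T M"
    using le[OF MH] compact_M[of 0] projdim_in_nonneg[of "heart T M" M] by (simp add: shift_0 order_trans)
  show "projdim T M X \<le> fpd_heart T M"
  proof (cases "pd_le 0 X")
    case True
    then have "projdim T M X \<le> 0" using projdim_le[of 0] by (simp add: zero_ereal_def)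
    then show ?thesis using h0 by (rule order_trans)
  next
    case False
    obtain N where N: "X \<in> T_le T M N" "pd_le N X" using compact_bounded[OF X] by blast
    have "pd_le (int (nat N)) X" using N(2) by (rule pd_le_mono) simp
    \<comment> \<open>p is the projective dimension of X. In this case it is at least 1, so
      minimality applies to p - 1.\<close>
    then obtain p where p: "pd_le (int p) X" "\<And>m. m < p \<Longrightarrow> \<not> pd_le (int m) X" using exists_least_iff[of "\<lambda>n. pd_le (int n) X"] by blast
    have p0: "p \<noteq> 0" using p(1) False by (auto intro!: Nat.gr0I)
    then have np: "\<not> pd_le (int p - 1) X" using p(2)[of "p - 1"] by (simp add: of_nat_diff)
    define k where "k = nat N"
    have "X \<in> T_le T M (int (Suc k))" using N(1) by (rule T_le_mono) (simp add: k_def)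
    \<comment> \<open>Top degree and number of steps are both k + 1, so the degrees above 0 are
      removed and the remainder H lies in degrees \<le> 0.\<close>
    from weight_filtration[OF X this, of k]
    obtain F H f g h where F: "F \<in> coprod T (shifts {- int (Suc k)..<0}) (Suc k)" "tri F X H f g h"
      "compact_obj \<kappa> T H" "H \<in> T_le T M 0" by auto
    \<comment> \<open>M is in the heart, so M[j] with j < 0 lies in degrees \<ge> 1. A cone on an F
      in these degrees acquires nothing in negative degrees.\<close>
    have "Y \<in> T_ge T M 1" if "Y \<in> shifts {- int (Suc k)..<0}" for Y
      using that MH T_ge_mono[of M 0] by (auto simp: T_ge_shift heart_iff)
    then have F1: "F \<in> T_ge T M 1" using T_ge_coprod F(1) by blast
    have HH: "H \<in> heart T M" using T_ge_cone[OF F(2) _ X0] F1 F(4) by (simp add: heart_iff)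
    have "pd_le (- 1) Y" if "Y \<in> shifts {- int (Suc k)..<0}" for Y
      using that pd_le_mono[OF pd_le_shift_M] by auto
    then have "pd_le (- 1) F" using pd_le_coprod F(1) by blast
    \<comment> \<open>F has projective dimension at most -1, hence at most p - 1, so the failure of
      this bound for X must come from H.\<close>
    then have "pd_le (int p - 1) F" by (rule pd_le_mono) simp
    then have "\<not> pd_le (int p - 1) H" using np pd_le_extension[OF F(2)] by blast
    then have "ereal (of_nat p) \<le> projdim_in T (heart T M) H" using projdim_in_ge[OF HH _ MH] by blast
    moreover have "projdim T M X \<le> ereal (of_nat p)" using projdim_le[OF p(1)] by simp
    ultimately show ?thesis using le[OF HH F(3)] by (meson order_trans)
  qed
qed

end

theorem theorem4p6:
  fixes \<kappa> :: "'i rel" and T :: "('o, 'm) tricat" and M :: 'o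
  assumes "compactly_generated_triangulated_category \<kappa> T"
    and "compact_silting_generator \<kappa> T M"
  shows
    "fpd \<kappa> T M =
       (SUP X\<in>{X \<in> compacts \<kappa> T \<inter> T_b T M. \<not> is_zero T X}.
          projdim T M X + coh_inf T M X) \<and>
     fpd \<kappa> T M =
       (SUP X\<in>{X \<in> T_b_c \<kappa> T M. projdim T M X < \<infinity> \<and> \<not> is_zero T X}.
          projdim T M X + coh_inf T M X) \<and>
     fpd \<kappa> T M =
       (SUP X\<in>{X \<in> T_minus_c \<kappa> T M \<inter> T_ge T M 0. projdim T M X < \<infinity>}. projdim T M X) \<and>
     fpd \<kappa> T M \<le> findim \<kappa> T M \<and>
     findim \<kappa> T M \<le> max 0 (fpd \<kappa> T M) \<and>
     (tilting \<kappa> T M \<longrightarrow> (\<exists>X. \<not> is_zero T X) \<longrightarrow>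
        fpd \<kappa> T M = fpd_heart T M \<and> fpd_heart T M = findim \<kappa> T M)"
proof -
  interpret compactly_generated_triangulated_category \<kappa> T by (rule assms(1))
  interpret silting_setting \<kappa> T M by unfold_locales (rule assms(2))
  have "fpd \<kappa> T M = fpd_heart T M \<and> fpd_heart T M = findim \<kappa> T M"
    if t: "tilting \<kappa> T M" and nz: "\<exists>X. \<not> is_zero T X"
  proof -
    obtain X where X: "\<not> is_zero T X" using nz by blast
    note MH = tilting_M_heart[OF t]
    have eq: "fpd \<kappa> T M = fpd_heart T M" by (rule antisym[OF fpd_le_heart[OF MH] fpd_heart_le[OF MH X]])
    \<comment> \<open>As \<open>fpd\<close> is not negative here, the maximum with 0 disappears and
      the two general bounds coincide.\<close>
    have "findim \<kappa> T M \<le> fpd \<kappa> T M" using findim_le fpd_nonneg[OF MH X] by (simp add: max_absorb2)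
    then have "findim \<kappa> T M = fpd \<kappa> T M" using fpd_le_findim by (rule antisym)
    then show ?thesis using eq by simp
  qed
  then show ?thesis
    using fpd_eq_inf fpd_eq_T_minus_c fpd_le_findim findim_le T_b_c_set_eq by simp
qed

end
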